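(* Let $B=\operatorname{diag}(b_1^{-1},b_2^{-1})$ with $b_1<0<b_2$, and $Q=\begin{pmatrix}0&Q_{12}\\ Q_{21}&0\end{pmatrix}$ with $Q_{12},Q_{21}\in C[0,1]$. Consider the problem $$-iBy'+Q(x)y=\lambda y,\quad y=\operatorname{col}(y_1,y_2),\quad x\in[0,1],$$ $$a_{j1}y_1(0)+a_{j2}y_2(0)+a_{j3}y_1(1)+a_{j4}y_2(1)=0,\quad j\in\{1,2\},$$ and put $J_{jk}=\det\begin{pmatrix}a_{1j}&a_{1k}\\ a_{2j}&a_{2k}\end{pmatrix}$, $j,k\in\{1,\dots,4\}$. If $$|J_{32}|+|b_1J_{13}Q_{12}(0)+b_2J_{42}Q_{21}(1)|\neq0,$$ $$|J_{14}|+|b_1J_{13}Q_{12}(1)+b_2J_{42}Q_{21}(0)|\neq0,$$ then the system of root functions of this problem (i.e. of the operator $L_{C,D}(Q)$) is complete and minimal in $L^2([0,1];\mathbb{C}^2)$.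
   Context: The numbers $a_{jk}$ are complex and the $2\times4$ matrix $(a_{jk})$ has rank $2$. With $C=\begin{pmatrix}a_{11}&a_{12}\\ a_{21}&a_{22}\end{pmatrix}$, $D=\begin{pmatrix}a_{13}&a_{14}\\ a_{23}&a_{24}\end{pmatrix}$ the boundary conditions read $Cy(0)+Dy(1)=0$, and $L_{C,D}(Q)$ is the operator in $L^2([0,1];\mathbb{C}^2)$ acting by $Ly=-iBy'+Q(x)y$ on $\{y\in W^1_2([0,1];\mathbb{C}^2): Cy(0)+Dy(1)=0\}$. Root functions are eigenfunctions and associated functions; the system of root functions is the union, over all eigenvalues $\lambda$, of bases of the root subspaces $\operatorname{span}\{\ker(L_{C,D}(Q)-\lambda)^k: k\in\mathbb{N}\}$. A system is complete if its closed linear span is the whole space, and minimal if no element belongs to the closed linear span of the others. *)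

theory Defs
  imports "HOL-Analysis.Analysis"
begin

section \<open>The Hilbert space \<open>L\<^sup>2([0,1]; \<complex>\<^sup>2)\<close>\<close>

definition square_integrable :: "(real \<Rightarrow> complex^2) \<Rightarrow> bool" where
  "square_integrable f \<longleftrightarrow>
     f \<in> borel_measurable (lebesgue_on {0..1}) \<and>
     integrable (lebesgue_on {0..1}) (\<lambda>x. (norm (f x))\<^sup>2)"

definition L2_eq :: "(real \<Rightarrow> complex^2) \<Rightarrow> (real \<Rightarrow> complex^2) \<Rightarrow> bool" where
  "L2_eq f g \<longleftrightarrow> square_integrable f \<and> square_integrable g \<and>
     (AE x in lebesgue_on {0..1}. f x = g x)"

lemma square_integrable_add:
  assumes "square_integrable f" "square_integrable g"
  shows "square_integrable (\<lambda>x. f x + g x)"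
  unfolding square_integrable_def
proof
  show m: "(\<lambda>x. f x + g x) \<in> borel_measurable (lebesgue_on {0..1})"
    using assms by (auto simp: square_integrable_def)
  show "integrable (lebesgue_on {0..1}) (\<lambda>x. (norm (f x + g x))\<^sup>2)"
  proof (rule Bochner_Integration.integrable_bound)
    show "integrable (lebesgue_on {0..1}) (\<lambda>x. 2 * (norm (f x))\<^sup>2 + 2 * (norm (g x))\<^sup>2)"
      using assms by (auto simp: square_integrable_def)
    show "(\<lambda>x. (norm (f x + g x))\<^sup>2) \<in> borel_measurable (lebesgue_on {0..1})"
      using m by measurable
    have "(norm (u + v))\<^sup>2 \<le> 2 * (norm u)\<^sup>2 + 2 * (norm v)\<^sup>2" for u v :: "complex^2"
    proof -
      have "(norm (u + v))\<^sup>2 \<le> (norm u + norm v)\<^sup>2"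
        by (intro power_mono norm_triangle_ineq norm_ge_zero)
      also have "\<dots> \<le> 2 * (norm u)\<^sup>2 + 2 * (norm v)\<^sup>2"
        using zero_le_power2 [of "norm u - norm v"] by (simp add: power2_eq_square algebra_simps)
      finally show ?thesis .
    qed
    then show "AE x in lebesgue_on {0..1}. norm ((norm (f x + g x))\<^sup>2)
                 \<le> norm (2 * (norm (f x))\<^sup>2 + 2 * (norm (g x))\<^sup>2)"
      by auto
  qed
qed

lemma norm_vector_scalar_mult:
  fixes c :: complex and v :: "complex^2"
  shows "norm (c *s v) = norm c * norm v"
  by (simp add: norm_vec_def L2_set_right_distrib norm_mult)

lemma borel_measurable_vector_scalar_mult:
  fixes c :: complex and f :: "'a \<Rightarrow> complex^2"
  assumes "f \<in> borel_measurable M"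
  shows "(\<lambda>x. c *s f x) \<in> borel_measurable M"
proof -
  have "linear ((*s) c :: complex^2 \<Rightarrow> complex^2)"
    by (rule linearI) (auto simp: vec_eq_iff algebra_simps)
  then have "continuous_on UNIV ((*s) c :: complex^2 \<Rightarrow> complex^2)"
    by (simp add: linear_continuous_on linear_conv_bounded_linear)
  then show ?thesis
    using assms borel_measurable_continuous_onI measurable_compose by blast
qed

lemma square_integrable_scaleC:
  "square_integrable f \<Longrightarrow> square_integrable (\<lambda>x. c *s f x)"
  by (auto simp: square_integrable_def borel_measurable_vector_scalar_mult
      norm_vector_scalar_mult power_mult_distrib)

lemma square_integrable_scaleR:
  "square_integrable f \<Longrightarrow> square_integrable (\<lambda>x. r *\<^sub>R f x)"
  by (auto simp: square_integrable_def power_mult_distrib)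

lemma integrable_inner_square_integrable:
  assumes "square_integrable f" "square_integrable g"
  shows "integrable (lebesgue_on {0..1}) (\<lambda>x. f x \<bullet> g x)"
proof (rule Bochner_Integration.integrable_bound)
  show "integrable (lebesgue_on {0..1}) (\<lambda>x. (norm (f x))\<^sup>2 + (norm (g x))\<^sup>2)"
    using assms by (auto simp: square_integrable_def)
  show "(\<lambda>x. f x \<bullet> g x) \<in> borel_measurable (lebesgue_on {0..1})"
    using assms by (auto simp: square_integrable_def)
  have "\<bar>u \<bullet> v\<bar> \<le> (norm u)\<^sup>2 + (norm v)\<^sup>2" for u v :: "complex^2"
  proof -
    have "\<bar>u \<bullet> v\<bar> \<le> norm u * norm v" by (rule Cauchy_Schwarz_ineq2)
    also have "\<dots> \<le> (norm u)\<^sup>2 + (norm v)\<^sup>2"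
      using zero_le_power2 [of "norm u - norm v"] mult_nonneg_nonneg [of "norm u" "norm v"]
      by (simp add: power2_eq_square algebra_simps del: mult_nonneg_nonneg)
    finally show ?thesis .
  qed
  then show "AE x in lebesgue_on {0..1}. norm (f x \<bullet> g x) \<le> norm ((norm (f x))\<^sup>2 + (norm (g x))\<^sup>2)"
    by auto
qed

quotient_type L2_C2 = "real \<Rightarrow> complex^2" / partial: L2_eq
proof (rule part_equivpI)
  have "L2_eq (\<lambda>_. 0) (\<lambda>_. 0)"
    by (simp add: L2_eq_def square_integrable_def)
  then show "\<exists>f. L2_eq f f" by blast
  show "symp L2_eq"
    by (rule sympI) (auto simp: L2_eq_def eq_commute)
  show "transp L2_eq"
    by (rule transpI) (auto simp: L2_eq_def)
qed

text \<open>
  The real inner product below is the real part of the Hermitian one; it induces the usual norm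
  \<open>(\<integral>\<^sub>0\<^sup>1 \<bar>y\<^sub>1\<bar>\<^sup>2 + \<bar>y\<^sub>2\<bar>\<^sup>2)\<^sup>1\<^sup>/\<^sup>2\<close> and hence the usual topology.
  The complex vector space structure is \<open>scaleC_L2\<close>.
\<close>

instantiation L2_C2 :: real_vector
begin

lift_definition zero_L2_C2 :: L2_C2 is "\<lambda>_. 0"
  by (simp add: L2_eq_def square_integrable_def)

lift_definition plus_L2_C2 :: "L2_C2 \<Rightarrow> L2_C2 \<Rightarrow> L2_C2" is "\<lambda>f g x. f x + g x"
  by (auto simp: L2_eq_def square_integrable_add)

lift_definition scaleR_L2_C2 :: "real \<Rightarrow> L2_C2 \<Rightarrow> L2_C2" is "\<lambda>r f x. r *\<^sub>R f x"
  by (auto simp: L2_eq_def square_integrable_scaleR)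

definition uminus_L2_C2 :: "L2_C2 \<Rightarrow> L2_C2" where
  "uminus_L2_C2 u = (-1) *\<^sub>R u"

definition minus_L2_C2 :: "L2_C2 \<Rightarrow> L2_C2 \<Rightarrow> L2_C2" where
  "minus_L2_C2 u v = u + (- v)"

instance
proof
  fix u v w :: L2_C2 and r s :: real
  show "u + v + w = u + (v + w)"
    by transfer (auto simp: L2_eq_def square_integrable_add add.assoc)
  show "u + v = v + u"
    by transfer (auto simp: L2_eq_def square_integrable_add add.commute)
  show zero: "0 + u = u" for u :: L2_C2
    by transfer (auto simp: L2_eq_def)
  show "- u + u = 0"
    unfolding uminus_L2_C2_def
    by transfer (auto simp: L2_eq_def square_integrable_add square_integrable_def)
  show "u - v = u + - v"
    by (rule minus_L2_C2_def)
  show "r *\<^sub>R (u + v) = r *\<^sub>R u + r *\<^sub>R v"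
    by transfer (auto simp: L2_eq_def square_integrable_add square_integrable_scaleR algebra_simps)
  show "(r + s) *\<^sub>R u = r *\<^sub>R u + s *\<^sub>R u"
    by transfer (auto simp: L2_eq_def square_integrable_add square_integrable_scaleR algebra_simps
        intro!: square_integrable_add)
  show "r *\<^sub>R s *\<^sub>R u = (r * s) *\<^sub>R u"
    by transfer (auto simp: L2_eq_def square_integrable_scaleR)
  show "1 *\<^sub>R u = u"
    by transfer (auto simp: L2_eq_def)
qed

end

instantiation L2_C2 :: real_inner
begin

lift_definition inner_L2_C2 :: "L2_C2 \<Rightarrow> L2_C2 \<Rightarrow> real"
  is "\<lambda>f g. LINT x|lebesgue_on {0..1}. f x \<bullet> g x"
  by (rule integral_cong_AE) (auto simp: L2_eq_def square_integrable_def)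

definition norm_L2_C2 :: "L2_C2 \<Rightarrow> real" where
  "norm_L2_C2 u = sqrt (u \<bullet> u)"

definition sgn_L2_C2 :: "L2_C2 \<Rightarrow> L2_C2" where
  "sgn_L2_C2 u = inverse (norm u) *\<^sub>R u"

definition dist_L2_C2 :: "L2_C2 \<Rightarrow> L2_C2 \<Rightarrow> real" where
  "dist_L2_C2 u v = norm (u - v)"

definition uniformity_L2_C2 :: "(L2_C2 \<times> L2_C2) filter" where
  "uniformity_L2_C2 = (INF e\<in>{0<..}. principal {(x, y). dist x y < e})"

definition open_L2_C2 :: "L2_C2 set \<Rightarrow> bool" where
  "open_L2_C2 U \<longleftrightarrow> (\<forall>x\<in>U. eventually (\<lambda>(x', y). x' = x \<longrightarrow> y \<in> U) uniformity)"

instance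
proof
  fix u v w :: L2_C2 and r :: real
  show "sgn u = u /\<^sub>R norm u"
    by (rule sgn_L2_C2_def)
  show "dist u v = norm (u - v)"
    by (rule dist_L2_C2_def)
  show "(uniformity :: (L2_C2 \<times> L2_C2) filter) = (INF e\<in>{0<..}. principal {(x, y). dist x y < e})"
    by (rule uniformity_L2_C2_def)
  show "open U \<longleftrightarrow> (\<forall>x\<in>U. \<forall>\<^sub>F (x', y) in uniformity. x' = x \<longrightarrow> y \<in> U)" for U :: "L2_C2 set"
    by (rule open_L2_C2_def)
  show "u \<bullet> v = v \<bullet> u"
    by transfer (simp add: inner_commute)
  show "(u + v) \<bullet> w = u \<bullet> w + v \<bullet> w"
    by transfer (auto simp: L2_eq_def inner_add_left integrable_inner_square_integrable)
  show "(r *\<^sub>R u) \<bullet> v = r * (u \<bullet> v)"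
    by transfer simp
  show "0 \<le> u \<bullet> u"
    by transfer simp
  show "u \<bullet> u = 0 \<longleftrightarrow> u = 0"
  proof transfer
    fix f :: "real \<Rightarrow> complex^2"
    assume "L2_eq f f"
    then have f: "square_integrable f" by (simp add: L2_eq_def)
    have "(LINT x|lebesgue_on {0..1}. f x \<bullet> f x) = 0
            \<longleftrightarrow> (AE x in lebesgue_on {0..1}. f x \<bullet> f x = 0)"
      by (rule integral_nonneg_eq_0_iff_AE) (auto intro: integrable_inner_square_integrable f)
    then show "(LINT x|lebesgue_on {0..1}. f x \<bullet> f x) = 0 \<longleftrightarrow> L2_eq f (\<lambda>_. 0)"
      using f by (simp add: L2_eq_def) (simp add: square_integrable_def)
  qed
  show "norm u = sqrt (u \<bullet> u)"
    by (rule norm_L2_C2_def)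
qed

end

lift_definition scaleC_L2 :: "complex \<Rightarrow> L2_C2 \<Rightarrow> L2_C2" is "\<lambda>c f x. c *s f x"
  by (auto simp: L2_eq_def square_integrable_scaleC)

interpretation L2: vector_space scaleC_L2
proof
  fix a b :: complex and u v :: L2_C2
  show "scaleC_L2 a (u + v) = scaleC_L2 a u + scaleC_L2 a v"
    by transfer (auto simp: L2_eq_def vector_add_ldistrib intro!: square_integrable_add square_integrable_scaleC)
  show "scaleC_L2 (a + b) u = scaleC_L2 a u + scaleC_L2 b u"
    by transfer (auto simp: L2_eq_def vector_sadd_rdistrib
        intro!: square_integrable_add square_integrable_scaleC)
  show "scaleC_L2 a (scaleC_L2 b u) = scaleC_L2 (a * b) u"
    by transfer (auto simp: L2_eq_def vector_smult_assoc intro!: square_integrable_scaleC)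
  show "scaleC_L2 1 u = u"
    by transfer (auto simp: L2_eq_def)
qed


section \<open>Linear operators in \<open>L\<^sup>2([0,1]; \<complex>\<^sup>2)\<close> and their root functions\<close>

text \<open>
  An unbounded operator \<open>T\<close> is represented by its graph, the set of pairs \<open>(u, T u)\<close> with \<open>u\<close> in
  the domain of \<open>T\<close>; powers of operators, with their natural domains, are then powers of relations.
\<close>

type_synonym L2_operator = "(L2_C2 \<times> L2_C2) set"

definition shift_op :: "L2_operator \<Rightarrow> complex \<Rightarrow> L2_operator" where
  "shift_op T \<mu> = {(u, v - scaleC_L2 \<mu> u) | u v. (u, v) \<in> T}"

definition op_kernel :: "L2_operator \<Rightarrow> L2_C2 set" where
  "op_kernel T = {u. (u, 0) \<in> T}"

definition eigenvalue :: "L2_operator \<Rightarrow> complex \<Rightarrow> bool" where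
  "eigenvalue T \<mu> \<longleftrightarrow> (\<exists>u \<in> op_kernel (shift_op T \<mu>). u \<noteq> 0)"

definition root_subspace :: "L2_operator \<Rightarrow> complex \<Rightarrow> L2_C2 set" where
  "root_subspace T \<mu> = L2.span (\<Union>k. op_kernel (shift_op T \<mu> ^^ k))"

definition is_basis :: "L2_C2 set \<Rightarrow> L2_C2 set \<Rightarrow> bool" where
  "is_basis V X \<longleftrightarrow> L2.independent X \<and> L2.span X = V"

definition root_function_system :: "L2_operator \<Rightarrow> L2_C2 set \<Rightarrow> bool" where
  "root_function_system T S \<longleftrightarrow>
     (\<exists>X. (\<forall>\<mu>. eigenvalue T \<mu> \<longrightarrow> is_basis (root_subspace T \<mu>) (X \<mu>)) \<and>
          S = (\<Union>\<mu>\<in>{\<mu>. eigenvalue T \<mu>}. X \<mu>))"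

definition complete_system :: "L2_C2 set \<Rightarrow> bool" where
  "complete_system S \<longleftrightarrow> closure (L2.span S) = UNIV"

definition minimal_system :: "L2_C2 set \<Rightarrow> bool" where
  "minimal_system S \<longleftrightarrow> (\<forall>u\<in>S. u \<notin> closure (L2.span (S - {u})))"


section \<open>The boundary value problem\<close>

text \<open>
  \<open>W12 y y'\<close> says that \<open>y\<close> belongs, on \<open>[0,1]\<close>, to \<open>W\<^sup>1\<^sub>2([0,1]; \<complex>\<^sup>2)\<close> (absolutely continuous with
  square integrable derivative) and that \<open>y'\<close> is a version of its derivative.  Since \<open>y\<close> is the
  absolutely continuous representative, its boundary values are meaningful.
\<close>

definition W12 :: "(real \<Rightarrow> complex^2) \<Rightarrow> (real \<Rightarrow> complex^2) \<Rightarrow> bool" where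
  "W12 y y' \<longleftrightarrow> square_integrable y' \<and>
     (\<forall>x\<in>{0..1}. y x = y 0 + (LINT t|lebesgue_on {0..x}. y' t))"

definition matB :: "real \<Rightarrow> real \<Rightarrow> complex^2^2" where
  "matB b\<^sub>1 b\<^sub>2 = vector [vector [inverse (complex_of_real b\<^sub>1), 0],
                       vector [0, inverse (complex_of_real b\<^sub>2)]]"

definition matQ :: "(real \<Rightarrow> complex) \<Rightarrow> (real \<Rightarrow> complex) \<Rightarrow> real \<Rightarrow> complex^2^2" where
  "matQ Q\<^sub>1\<^sub>2 Q\<^sub>2\<^sub>1 x = vector [vector [0, Q\<^sub>1\<^sub>2 x], vector [Q\<^sub>2\<^sub>1 x, 0]]"

text \<open>
  The indices of a vector in \<open>complex^4\<close> are \<open>1, 2, 3, 4 :: 4\<close>, where \<open>4 = 0\<close>.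
\<close>

definition matC :: "complex^4^2 \<Rightarrow> complex^2^2" where
  "matC a = vector [vector [a $ 1 $ 1, a $ 1 $ 2], vector [a $ 2 $ 1, a $ 2 $ 2]]"

definition matD :: "complex^4^2 \<Rightarrow> complex^2^2" where
  "matD a = vector [vector [a $ 1 $ 3, a $ 1 $ 4], vector [a $ 2 $ 3, a $ 2 $ 4]]"

definition J :: "complex^4^2 \<Rightarrow> 4 \<Rightarrow> 4 \<Rightarrow> complex" where
  "J a j k = det (vector [vector [a $ 1 $ j, a $ 1 $ k], vector [a $ 2 $ j, a $ 2 $ k]] :: complex^2^2)"

text \<open>
  The graph of the operator acting by \<open>L y = - \<i> B y' + Q y\<close> on
  \<open>{y \<in> W\<^sup>1\<^sub>2. C y(0) + D y(1) = 0}\<close>.  It is used for bounded measurable \<open>Q\<close> only, so that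
  \<open>L y\<close> is square integrable and \<open>abs_L2_C2\<close>, which takes the class of a square integrable
  function, is applied where it is meaningful.
\<close>

definition L_op :: "complex^2^2 \<Rightarrow> (real \<Rightarrow> complex^2^2) \<Rightarrow> complex^2^2 \<Rightarrow> complex^2^2 \<Rightarrow> L2_operator" where
  "L_op B Q C D =
     {(abs_L2_C2 y, abs_L2_C2 (\<lambda>x. (- \<i>) *s (B *v y' x) + Q x *v y x)) | y y'.
        W12 y y' \<and> C *v y 0 + D *v y 1 = 0}"

end

theory Submission
  imports Defs "HOL-Complex_Analysis.Complex_Analysis" "HOL-Real_Asymp.Real_Asymp"
begin

text \<open>
  Let \<open>R \<zeta>\<close> be the resolvent, obtained from the solution \<open>Y \<zeta> 0 g\<close> of the initial value problem by
  Cramer's rule; its denominator is the characteristic determinant \<open>Del\<close>. On the rays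
  \<open>\<bar>Re \<zeta>\<bar> = \<bar>Im \<zeta>\<bar>\<close> the two components of the system grow and decay exponentially, and the two
  nondegeneracy conditions give, in the upper and in the lower half plane, an a priori bound of \<open>R \<zeta> g\<close>
  that is uniform along the rays: if \<open>J a 3 2\<close> or \<open>J a 1 4\<close> vanishes, the first-order terms in
  \<open>1 / \<zeta>\<close> of the solutions at the end points, which carry the boundary values of \<open>Q\<close>, take its place.

  Completeness: let the bounded functional \<open>\<psi>\<close> annihilate all root functions. Then \<open>\<psi> (R \<zeta> g)\<close> has no
  poles. It is a quotient of entire functions of exponential type, hence itself of exponential type, and
  it is bounded on the rays. By Phragmen-Lindelof in the four sectors it is constant. Comparing two
  values of \<open>\<zeta>\<close> in \<open>y = R \<zeta> (L y - \<zeta> y)\<close> gives \<open>\<psi> (R \<zeta> y) = 0\<close> for all \<open>y\<close> in a dense set, so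
  \<open>\<psi> (R \<zeta> g)\<close> vanishes for every \<open>g\<close> and therefore \<open>\<psi> = 0\<close>.

  Minimality: the contour integral of \<open>R \<zeta>\<close> around an eigenvalue \<open>\<mu>\<close> is, up to a factor, the identity on
  the root subspace of \<open>\<mu>\<close>, which is finite dimensional, and zero on all other root subspaces.
\<close>

text \<open>Since \<open>$\<close> also denotes coefficients of power series, terms with many vector components have
  exponentially many parses.\<close>
no_notation fps_nth (infixl "$" 75)

text \<open>Each nondegeneracy condition is a condition on a determinant. Let \<open>w\<close> be
  the sum of the complex rates of growth and decay. To leading order the growing component has
  \<open>u 0 = - P 0 * v 0 / w\<close> and the decaying one \<open>v 1 = R 1 * u 1 / w\<close>;
  inserting this into the boundary conditions leaves a linear system for \<open>u 1\<close> and
  \<open>v 0\<close> with determinant \<open>A + B / w + D / w^2\<close>. Up to unimodular factors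
  \<open>A\<close> and \<open>B\<close> are the two quantities of the condition. If
  \<open>A = 0\<close>, the determinant has only the size of \<open>1 / w\<close>, so the errors of
  the end values must be \<open>o(1 / w)\<close> relative to the solution; continuity of
  \<open>Q\<close> is just enough for this. The price is that the estimate of
  \<open>R \<zeta> g\<close> carries no decay in \<zeta>. Therefore the entire function obtained is
  only seen to be constant, and it takes two values of \<zeta> to conclude that it is 0.

  The rays are the diagonals for two reasons: there
  \<open>cmod \<zeta> \<le> 2 * \<bar>Im \<zeta>\<bar>\<close>, which makes \<open>w\<close>
  comparable with both rates, and a right angle has critical order 2, well above the order 1 of the
  functions involved.\<close>

section \<open>Entire functions of exponential type\<close>

text \<open>\<open>D / M\<close> has a logarithm with negative real part. The Schwarz lemma after a
  map to the unit disc is Harnack's inequality for it: at half the radius the real part is at least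
  3 times its value at the centre, whence the cube.\<close>

lemma harnack_lower_bound:
  fixes D :: "complex \<Rightarrow> complex"
  assumes hol: "D holomorphic_on ball 0 r" and nz: "\<And>z. z \<in> ball 0 r \<Longrightarrow> D z \<noteq> 0"
    and le: "\<And>z. z \<in> ball 0 r \<Longrightarrow> cmod (D z) < M" and r: "r > 0" and z: "cmod z \<le> r / 2"
  shows "cmod (D 0) ^ 3 / M\<^sup>2 \<le> cmod (D z)"
proof -
  have M: "M > 0"
    using le[of 0] r by (meson centre_in_ball norm_ge_zero order_le_less_trans)
  define d where "d = (\<lambda>w. D (of_real r * w) / of_real M)"
  have in_ball: "of_real r * w \<in> ball 0 r" if "w \<in> ball 0 1" for w :: complex
    using that r by (simp add: norm_mult)
  have "d holomorphic_on ball 0 1"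
    unfolding d_def using M
    by (intro holomorphic_intros holomorphic_on_compose_gen[OF _ hol, unfolded o_def] in_ball image_subsetI) auto
  moreover have "d w \<noteq> 0" if "w \<in> ball 0 1" for w
    using nz[OF in_ball[OF that]] M by (simp add: d_def)
  ultimately obtain g where g: "g holomorphic_on ball 0 1" "\<And>w. w \<in> ball 0 1 \<Longrightarrow> d w = exp (g w)"
    using contractible_imp_holomorphic_log[of d "ball 0 1"] by (metis convex_ball convex_imp_contractible)
  have d1: "cmod (d w) < 1" if "w \<in> ball 0 1" for w
    using le[OF in_ball[OF that]] M by (simp add: d_def norm_divide)
  have neg: "Re (g w) < 0" if "w \<in> ball 0 1" for w
    using d1[OF that] g(2)[OF that] by (simp add: norm_exp_eq_Re)
  \<comment> \<open>With \<open>c = g 0\<close>, the map sending \<open>w\<close> to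
    \<open>(w - c) / (w + cnj c)\<close> takes the left half plane to the unit disc and
    \<open>c\<close> to 0.\<close>
  define \<phi> where "\<phi> = (\<lambda>w. (g w - g 0) / (g w + cnj (g 0)))"
  have den: "g w + cnj (g 0) \<noteq> 0" if "w \<in> ball 0 1" for w
  proof
    assume "g w + cnj (g 0) = 0"
    then have "Re (g w + cnj (g 0)) = 0" by simp
    then show False using neg[OF that] neg[of 0] by simp
  qed
  have phi1: "cmod (\<phi> w) < 1" if "w \<in> ball 0 1" for w
  proof -
    have "(cmod (g w - g 0))\<^sup>2 < (cmod (g w + cnj (g 0)))\<^sup>2"
    proof -
      have "Re (g w) * Re (g 0) > 0"
        using neg[OF that] neg[of 0] by (simp add: mult_neg_neg)
      then show ?thesis
        unfolding cmod_power2 by (simp add: power2_eq_square algebra_simps)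
    qed
    then have "cmod (g w - g 0) < cmod (g w + cnj (g 0))"
      by (meson norm_ge_zero power_less_imp_less_base)
    then show ?thesis using den[OF that]
      by (simp add: \<phi>_def norm_divide)
  qed
  define w where "w = z / of_real r"
  have w: "cmod w \<le> 1/2" using z r by (simp add: w_def norm_divide field_simps)
  then have wb: "w \<in> ball 0 1" by simp
  have "cmod (\<phi> w) \<le> cmod w"
  proof (rule Schwarz_Lemma(1))
    show "\<phi> holomorphic_on ball 0 1"
      unfolding \<phi>_def by (intro holomorphic_intros g den)
  qed (use phi1 wb in \<open>auto simp: \<phi>_def\<close>)
  then have phi: "cmod (\<phi> w) \<le> 1/2" using w by simp
  have "cmod (g w - g 0) = cmod (\<phi> w) * cmod (g w + cnj (g 0))"
    using den[OF wb] by (simp add: \<phi>_def norm_divide)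
  then have half: "cmod (g w - g 0) \<le> 1/2 * cmod (g w + cnj (g 0))"
    using mult_right_mono[OF phi, of "cmod (g w + cnj (g 0))"] by simp
  define c where "c = g w - \<i> * Im (g 0)"
  have c1: "g w - g 0 = c - of_real (Re (g 0))" and c2: "g w + cnj (g 0) = c + of_real (Re (g 0))"
    by (auto simp: c_def complex_eq_iff)
  have "cmod c \<le> cmod (c - of_real (Re (g 0))) + \<bar>Re (g 0)\<bar>"
    by (metis diff_add_cancel norm_of_real norm_triangle_ineq)
  also have "\<dots> \<le> 1/2 * (cmod c + \<bar>Re (g 0)\<bar>) + \<bar>Re (g 0)\<bar>"
    using half norm_triangle_ineq[of c "of_real (Re (g 0))"] unfolding c1 c2
    by (intro add_right_mono) (auto intro: order_trans)
  finally have "cmod c \<le> 3 * \<bar>Re (g 0)\<bar>" by argo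
  moreover have "Re c = Re (g w)" by (simp add: c_def)
  ultimately have "Re (g w) \<ge> 3 * Re (g 0)"
    using abs_Re_le_cmod[of c] neg[of 0] by simp
  then have "exp (Re (g 0)) ^ 3 \<le> exp (Re (g w))"
    by (simp flip: exp_of_nat_mult)
  then have "cmod (d 0) ^ 3 \<le> cmod (d w)"
    using g(2)[OF wb] g(2)[of 0] by (simp add: norm_exp_eq_Re)
  then show ?thesis
    using M r by (simp add: d_def w_def norm_divide field_simps power2_eq_square power3_eq_cube)
qed

lemma entire_divide_zero:
  fixes f :: "complex \<Rightarrow> complex"
  assumes "f holomorphic_on UNIV" "f a = 0"
  obtains h where "h holomorphic_on UNIV" "\<And>z. f z = (z - a) * h z"
proof
  show "(\<lambda>z. if z = a then deriv f a else (f z - f a) / (z - a)) holomorphic_on UNIV"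
    by (rule pole_lemma) (use assms in auto)
qed (use assms in auto)

text \<open>On the circle \<open>R^2 = w * cnj w\<close>. So the Blaschke factor of \<open>a\<close>
  is unimodular there, and dividing by it does not affect moduli on the circle.\<close>

lemma norm_blaschke_factor_sphere:
  assumes "cmod w = R"
  shows "cmod ((of_real R)\<^sup>2 - cnj a * w) = R * cmod (w - a)"
proof -
  have "(of_real R)\<^sup>2 - cnj a * w = w * cnj (w - a)"
    using assms complex_norm_square[of w] by (simp add: algebra_simps)
  then show ?thesis
    using assms by (simp only: norm_mult complex_mod_cnj)
qed

text \<open>Zeros of \<open>D\<close> in the half disc are divided out by Blaschke factors; each of them at least
  doubles the value at the origin, which bounds their number.\<close>
lemma quotient_bound_sphere:
  fixes D F :: "complex \<Rightarrow> complex"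
  assumes "D holomorphic_on UNIV" "F holomorphic_on UNIV" and R: "R > 0"
    and "D 0 \<noteq> 0" and "\<And>w. cmod w = R \<Longrightarrow> cmod (D w) < M"
    and "\<And>w. cmod w = R \<Longrightarrow> cmod (F w * D w) \<le> N"
    and "M < cmod (D 0) * 2 ^ n" and z: "cmod z \<le> R / 4"
  shows "cmod (F z) \<le> N * M\<^sup>2 / cmod (D 0) ^ 3"
  using assms
proof (induction n arbitrary: D)
  \<comment> \<open>Here the hypothesis on \<open>n\<close> reads \<open>M < cmod (D 0)\<close>,
    against the maximum principle; hence fewer than \<open>n\<close> zeros can be divided
    out.\<close>
  case 0
  have "cmod (D 0) \<le> M"
  proof (rule maximum_modulus_frontier[of D "cball 0 R"])
    show "cmod (D w) \<le> M" if "w \<in> frontier (cball 0 R)" for w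
      using that 0(5)[of w] by simp
  qed (use R 0(1) in \<open>auto intro: holomorphic_on_subset holomorphic_on_imp_continuous_on\<close>)
  then show ?case using 0(7) by simp
next
  case (Suc n)
  note hD = \<open>D holomorphic_on UNIV\<close> and hF = \<open>F holomorphic_on UNIV\<close>
  show ?case
  proof (cases "\<exists>a \<in> ball 0 (R/2). D a = 0")
    case True
    then obtain a where a: "cmod a < R / 2" "D a = 0" by auto
    obtain h where h: "h holomorphic_on UNIV" "\<And>z. D z = (z - a) * h z"
      by (rule entire_divide_zero[OF hD a(2)]) (use that in auto)
    \<comment> \<open>This is \<open>D\<close> divided by the Blaschke factor
      \<open>R * (w - a) / (R^2 - cnj a * w)\<close>.\<close>
    define E where "E = (\<lambda>w. h w * ((of_real R)\<^sup>2 - cnj a * w) / of_real R)"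
    have E_sphere: "cmod (E w) = cmod (D w)" if "cmod w = R" for w
      using R norm_blaschke_factor_sphere[OF that, of a] by (simp add: E_def h(2) norm_mult norm_divide)
    have E0: "cmod (E 0) = cmod (h 0) * R" 
      using R by (simp add: E_def norm_mult norm_divide power2_eq_square norm_power)
    have D0: "cmod (D 0) = cmod a * cmod (h 0)" by (simp add: h(2) norm_mult)
    have "cmod (D 0) * 2 \<le> cmod (E 0)"
      unfolding E0 D0 using a(1) mult_right_mono[of "2 * cmod a" R "cmod (h 0)"] by (simp add: algebra_simps)
    then have E2: "cmod (D 0) * 2 * 2 ^ n \<le> cmod (E 0) * 2 ^ n"
      by (rule mult_right_mono) simp
    have "h 0 \<noteq> 0"
      using Suc.prems(4) h(2)[of 0] by auto
    have "cmod (F z) \<le> N * M\<^sup>2 / cmod (E 0) ^ 3"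
    proof (rule Suc.IH)
      show "E holomorphic_on UNIV"
        unfolding E_def by (intro holomorphic_intros h) (use R in auto)
      show "E 0 \<noteq> 0" using \<open>h 0 \<noteq> 0\<close> R E0 by auto
      show "cmod (F w * E w) \<le> N" if "cmod w = R" for w
        using Suc.prems(6)[OF that] E_sphere[OF that] by (simp add: norm_mult)
      show "M < cmod (E 0) * 2 ^ n"
        by (rule order.strict_trans2[OF _ E2]) (use Suc.prems(7) in \<open>simp add: mult.assoc\<close>)
    qed (use Suc.prems E_sphere in auto)
    also have "\<dots> \<le> N * M\<^sup>2 / cmod (D 0) ^ 3"
    proof (rule divide_left_mono)
      have "0 \<le> N"
        using Suc.prems(6)[of "of_real R"] R
        by (metis abs_of_pos norm_ge_zero norm_of_real order_trans)
      then show "0 \<le> N * M\<^sup>2" by simp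
      have "cmod (D 0) \<le> cmod (E 0)" using \<open>cmod (D 0) * 2 \<le> cmod (E 0)\<close> norm_ge_zero[of "D 0"] by linarith
      then show "cmod (D 0) ^ 3 \<le> cmod (E 0) ^ 3" by (simp add: power_mono)
      show "0 < cmod (E 0) ^ 3 * cmod (D 0) ^ 3"
        using Suc.prems(4) \<open>h 0 \<noteq> 0\<close> R by (auto simp: E0 simp flip: power_mult_distrib)
    qed
    finally show ?thesis .
  next
    \<comment> \<open>With no zero left in the half disc, Harnack's inequality bounds
      \<open>D\<close> from below on the radius \<open>R / 4\<close>, and the maximum principle
      bounds \<open>F * D\<close> by \<open>N\<close>.\<close>
    case False
    have bD: "cmod (D w) < M" if w: "w \<in> cball 0 R" for w
    proof -
      obtain m where m: "m \<in> sphere 0 R" "\<And>w. w \<in> sphere 0 R \<Longrightarrow> cmod (D w) \<le> cmod (D m)"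
      proof -
        have "sphere (0::complex) R \<noteq> {}" using R by simp
        moreover have "continuous_on (sphere 0 R) (\<lambda>w. cmod (D w))"
          by (intro continuous_intros holomorphic_on_imp_continuous_on holomorphic_on_subset[OF hD]) auto
        ultimately show ?thesis
          using continuous_attains_sup[of "sphere 0 R" "\<lambda>w. cmod (D w)"] that by auto
      qed
      have "cmod (D w) \<le> cmod (D m)"
        by (rule maximum_modulus_frontier[of D "cball 0 R"])
          (use R hD m w in \<open>auto intro: holomorphic_on_subset holomorphic_on_imp_continuous_on\<close>)
      also have "\<dots> < M" using Suc.prems(5)[of m] m(1) by simp
      finally show ?thesis .
    qed
    have "cmod (D 0) ^ 3 / M\<^sup>2 \<le> cmod (D z)"
      by (rule harnack_lower_bound[of D "R/2"])
        (use R False hD z bD in \<open>auto intro: holomorphic_on_subset\<close>)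
    moreover have "cmod (F z * D z) \<le> N"
    proof (rule maximum_modulus_frontier[of "\<lambda>z. F z * D z" "cball 0 R"])
      show "cmod (F w * D w) \<le> N" if "w \<in> frontier (cball 0 R)" for w
        using that Suc.prems(6)[of w] by simp
    qed (use R hD hF z in \<open>auto intro!: holomorphic_intros intro: holomorphic_on_subset holomorphic_on_imp_continuous_on continuous_intros\<close>)
    ultimately have "cmod (F z) * (cmod (D 0) ^ 3 / M\<^sup>2) \<le> N"
      by (metis mult_left_mono norm_ge_zero norm_mult order_trans)
    moreover have "M > 0" using bD[of 0] R by (metis centre_in_cball less_eq_real_def norm_ge_zero order_le_less_trans)
    ultimately show ?thesis
      using Suc.prems(4) by (simp add: field_simps)
  qed
qed

text \<open>\<open>F\<close> is the quotient of \<open>F * D\<close> by \<open>D\<close> and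
  inherits their growth. The circles are centred at \<open>z0\<close>, since \<open>D\<close> may
  vanish at the origin. Their radius \<open>4 * cmod z\<close> and the third power of
  \<open>M\<close> account for the exponent \<open>12 * a\<close>.\<close>

lemma exponential_type_quotient:
  fixes D F :: "complex \<Rightarrow> complex"
  assumes hD: "D holomorphic_on UNIV" and hF: "F holomorphic_on UNIV" and nz: "D z0 \<noteq> 0"
    and bD: "\<And>w. cmod (D w) \<le> A * exp (a * cmod w)"
    and bFD: "\<And>w. cmod (F w * D w) \<le> A * exp (a * cmod w)"
    and a: "a \<ge> 0"
  shows "\<exists>C c. c \<ge> 0 \<and> (\<forall>w. cmod (F w) \<le> C * exp (c * cmod w))"
proof -
  have A: "A > 0"
    using bD[of z0] nz by (metis exp_gt_zero norm_le_zero_iff not_less order_trans mult_nonpos_nonneg less_imp_le)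
  define B where "B = A * exp (a * cmod z0) + 1"
  have B: "A * exp (a * cmod z0) < B" "B > 0"
    using A by (auto simp: B_def add_nonneg_pos)
  define C where "C = B ^ 3 / cmod (D z0) ^ 3"
  have pre: "cmod (F (z0 + z)) \<le> C * exp (12 * a * cmod z)" if "z \<noteq> 0" for z
  proof -
    define R where "R = 4 * cmod z"
    have R: "R > 0" using that by (simp add: R_def)
    define M where "M = B * exp (a * R)"
    have sph: "A * exp (a * cmod (z0 + w)) < M" if "cmod w = R" for w
    proof -
      have "exp (a * cmod (z0 + w)) \<le> exp (a * cmod z0) * exp (a * R)"
        using norm_triangle_ineq[of z0 w] a that
        by (simp flip: exp_add distrib_left add: mult_left_mono)
      then have "A * exp (a * cmod (z0 + w)) \<le> (A * exp (a * cmod z0)) * exp (a * R)"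
        using A by (simp add: mult.assoc)
      also have "\<dots> < M" unfolding M_def using B(1) by simp
      finally show ?thesis .
    qed
    obtain n where n: "M / cmod (D z0) < 2 ^ n"
      using real_arch_pow[of 2] by auto
    have "cmod (F (z0 + z)) \<le> M * M\<^sup>2 / cmod (D (z0 + 0)) ^ 3"
    proof (rule quotient_bound_sphere[where D = "\<lambda>z. D (z0 + z)" and F = "\<lambda>z. F (z0 + z)" and R = R and n = n])
      show "(\<lambda>z. D (z0 + z)) holomorphic_on UNIV"
        by (rule holomorphic_on_compose_gen[OF _ hD, unfolded o_def]) (auto intro!: holomorphic_intros)
      show "(\<lambda>z. F (z0 + z)) holomorphic_on UNIV"
        by (rule holomorphic_on_compose_gen[OF _ hF, unfolded o_def]) (auto intro!: holomorphic_intros)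
      show "cmod (D (z0 + w)) < M" if "cmod w = R" for w
        using order_le_less_trans[OF bD sph[OF that]] .
      show "cmod (F (z0 + w) * D (z0 + w)) \<le> M" if "cmod w = R" for w
        using order_le_less_trans[OF bFD sph[OF that]] by simp
      show "M < cmod (D (z0 + 0)) * 2 ^ n"
        using n nz by (simp add: field_simps)
    qed (use R nz in \<open>auto simp: R_def\<close>)
    also have "\<dots> = C * exp (12 * a * cmod z)"
      by (simp add: C_def M_def R_def power2_eq_square power3_eq_cube flip: exp_add)
    finally show ?thesis .
  qed
  have C: "C > 0" using B nz by (simp add: C_def)
  define E where "E = (C + cmod (F z0)) * exp (12 * a * cmod z0)"
  have "cmod (F w) \<le> E * exp (12 * a * cmod w)" for w
  proof -
    have "cmod (F w) \<le> (C + cmod (F z0)) * exp (12 * a * cmod (w - z0))"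
    proof (cases "w = z0")
      case False
      have "cmod (F w) \<le> C * exp (12 * a * cmod (w - z0))"
        using pre[of "w - z0"] False by simp
      also have "\<dots> \<le> (C + cmod (F z0)) * exp (12 * a * cmod (w - z0))"
        by (rule mult_right_mono) auto
      finally show ?thesis .
    qed (use C in auto)
    also have "\<dots> \<le> (C + cmod (F z0)) * (exp (12 * a * cmod z0) * exp (12 * a * cmod w))"
    proof (rule mult_left_mono)
      show "exp (12 * a * cmod (w - z0)) \<le> exp (12 * a * cmod z0) * exp (12 * a * cmod w)"
      using norm_triangle_ineq4[of w z0] a mult_left_mono[of "cmod (w - z0)" "cmod z0 + cmod w" "12 * a"]
        by (simp flip: exp_add distrib_left)
    qed (use C in auto)
    finally show ?thesis unfolding E_def by (simp add: mult.assoc)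
  qed
  then show ?thesis using a by (intro exI[of _ E] exI[of _ "12*a"]) auto
qed

section \<open>The Phragmen-Lindelof principle for a right angle\<close>

text \<open>In the sector the argument of \<open>csqrt w ^ 3\<close> is at most
  \<open>3 * pi / 8\<close> in modulus, so a bound with \<open>cos (3 * pi / 8)\<close> holds;
  \<open>1 / 5\<close> is a smaller constant, accessible by algebra in the coordinates of the
  root.\<close>

lemma Re_csqrt_cube_lower_bound:
  assumes "Re w \<ge> \<bar>Im w\<bar>" "w \<noteq> 0"
  shows "cmod w powr (3/2) / 5 \<le> Re (csqrt w ^ 3)"
proof -
  define x y where "x = Re (csqrt w)" and "y = Im (csqrt w)"
  have w: "w = (csqrt w)\<^sup>2" by simp
  have Re_w: "Re w = x\<^sup>2 - y\<^sup>2" and Im_w: "Im w = 2 * x * y"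
    by (subst w, simp add: x_def y_def power2_eq_square)+
  have x0: "x \<ge> 0" using csqrt_principal[of w] by (auto simp: x_def)
  have le: "2 * x * \<bar>y\<bar> \<le> x\<^sup>2 - y\<^sup>2"
    using assms x0 by (simp add: Re_w Im_w abs_mult)
  have y: "y\<^sup>2 \<le> x\<^sup>2 / 5"
  proof (rule ccontr)
    assume "\<not> ?thesis"
    then have *: "x\<^sup>2 < 5 * y\<^sup>2" by simp
    then have "4 * x\<^sup>2 < 25 * y\<^sup>2"
      using zero_le_power2[of y] by linarith
    then have "x\<^sup>2 < (5/2 * \<bar>y\<bar>)\<^sup>2"
      unfolding power_mult_distrib power2_abs power_divide by simp
    then have "x < 5/2 * \<bar>y\<bar>" by (rule power_less_imp_less_base) simp
    then have "2/5 * (x * x) \<le> x * \<bar>y\<bar>" using mult_left_mono[of "2/5 * x" "\<bar>y\<bar>" x] x0 by simp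
    then show False using le * by (simp add: power2_eq_square)
  qed
  have "cmod w = x\<^sup>2 + y\<^sup>2"
    by (simp only: x_def y_def flip: cmod_power2 norm_power) simp
  then have nw: "cmod w \<le> 6/5 * x\<^sup>2" using y by simp
  have "cmod w powr (3/2) = sqrt (cmod w) ^ 3"
  proof -
    have "sqrt (cmod w) ^ 3 = (cmod w powr (1/2)) powr 3"
      using assms(2) by (simp add: powr_half_sqrt powr_numeral)
    then show ?thesis by (simp add: powr_powr)
  qed
  also have "\<dots> \<le> (6/5 * x) ^ 3"
  proof (rule power_mono)
    have "cmod w \<le> 36/25 * x\<^sup>2" using nw zero_le_power2[of x] by linarith
    then have "sqrt (cmod w) \<le> sqrt ((6/5 * x)\<^sup>2)"
      by (intro real_sqrt_le_mono) (simp add: power_mult_distrib power_divide)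
    then show "sqrt (cmod w) \<le> 6/5 * x" using x0 by simp
  qed simp
  finally have 1: "cmod w powr (3/2) \<le> 216/125 * x ^ 3" by (simp add: power_mult_distrib power3_eq_cube)
  have "Re (csqrt w ^ 3) = x ^ 3 - 3 * x * y\<^sup>2"
    by (simp add: x_def y_def power3_eq_cube power2_eq_square algebra_simps)
  moreover have "x * y\<^sup>2 \<le> x * (x\<^sup>2 / 5)" using y x0 by (rule mult_left_mono)
  ultimately have "Re (csqrt w ^ 3) \<ge> 2/5 * x ^ 3" by (simp add: power2_eq_square power3_eq_cube)
  moreover have "x ^ 3 \<ge> 0" using x0 by simp
  ultimately show ?thesis using 1 by linarith
qed

text \<open>A factor \<open>exp (- e * (w + 1) powr (3/2))\<close> has modulus at most 1 in the
  sector and beats growth of order 1 on large arcs, as \<open>3/2 > 1\<close>; the real part of the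
  power is positive because \<open>3/2\<close> is below the critical order 2. Finally
  \<open>e\<close> tends to 0.\<close>

lemma Phragmen_Lindelof_quadrant:
  fixes f :: "complex \<Rightarrow> complex"
  assumes hol: "f holomorphic_on UNIV" and exp_type: "\<And>z. cmod (f z) \<le> A * exp (a * cmod z)"
    and diag: "\<And>z. \<bar>Re z\<bar> = \<bar>Im z\<bar> \<Longrightarrow> cmod (f z) \<le> K" and z: "\<bar>Im z\<bar> \<le> Re z"
  shows "cmod (f z) \<le> K"
proof -
  have A: "A \<ge> 0"
    using exp_type[of 0] by (metis exp_zero mult_1_right mult_zero_right norm_ge_zero norm_zero order_trans)
  have K: "K \<ge> 0" using diag[of 0] by (metis norm_ge_zero order_trans zero_complex.sel)
  \<comment> \<open>The shift by 1 keeps the cut of \<open>csqrt\<close> and its branch point away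
    from the closed sector, vertex included.\<close>
  define s where "s = (\<lambda>w::complex. csqrt (w + 1) ^ 3)"
  have s_lower: "cmod (w + 1) powr (3/2) / 5 \<le> Re (s w)" if "\<bar>Im w\<bar> \<le> Re w" for w
    unfolding s_def by (rule Re_csqrt_cube_lower_bound) (use that in \<open>auto simp: complex_eq_iff\<close>)
  have s_nonneg: "0 \<le> Re (s w)" if "\<bar>Im w\<bar> \<le> Re w" for w
    using s_lower[OF that] by (meson divide_nonneg_pos order_trans powr_ge_zero zero_less_numeral)
  have main: "cmod (f z * exp (- (of_real e * s z))) \<le> K + \<delta>" if e: "e > 0" and "\<delta> > 0" for e \<delta> :: real
  proof -
    define g where "g = (\<lambda>w. f w * exp (- (of_real e * s w)))"
    have norm_g: "cmod (g w) = cmod (f w) * exp (- (e * Re (s w)))" for w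
      by (simp add: g_def norm_mult norm_exp_eq_Re)
    have "((\<lambda>R::real. A * exp (a * R - e * (R powr (3/2) / 5))) \<longlongrightarrow> A * 0) at_top"
      using e by (intro tendsto_mult tendsto_const) real_asymp
    then have "\<forall>\<^sub>F R in at_top. A * exp (a * R - e * (R powr (3/2) / 5)) < K + \<delta>" 
      by (rule order_tendstoD) (use \<open>\<delta> > 0\<close> K in simp)
    then have "\<forall>\<^sub>F R in at_top. A * exp (a * R - e * (R powr (3/2) / 5)) < K + \<delta> \<and> R > cmod z"
      by (intro eventually_conj eventually_gt_at_top)
    then obtain R where R: "A * exp (a * R - e * (R powr (3/2) / 5)) < K + \<delta>" "R > cmod z"
      using eventually_happens'[OF trivial_limit_at_top_linorder] by fast
    define S where "S = cball 0 R \<inter> {w. \<bar>Im w\<bar> \<le> Re w}"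
    have clS: "closed S"
      unfolding S_def by (intro closed_Int closed_cball closed_Collect_le continuous_intros)
    have avoid: "w + 1 \<notin> \<real>\<^sub>\<le>\<^sub>0" if "\<bar>Im w\<bar> \<le> Re w" for w :: complex
      using that by (auto simp: complex_nonpos_Reals_iff)
    have holg: "g holomorphic_on {w. \<bar>Im w\<bar> \<le> Re w}"
      unfolding g_def s_def
      by (intro holomorphic_intros holomorphic_on_subset[OF hol]) (use avoid in auto)
    have "cmod (g z) \<le> K + \<delta>"
    proof (rule maximum_modulus_frontier[of g S])
      show "g holomorphic_on interior S"
        by (rule holomorphic_on_subset[OF holg]) (use interior_subset in \<open>auto simp: S_def\<close>)
      show "continuous_on (closure S) g"
        using clS by (intro holomorphic_on_imp_continuous_on holomorphic_on_subset[OF holg]) (auto simp: S_def)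
      show "bounded S" unfolding S_def by (rule bounded_Int) simp
      show "z \<in> S" using z R(2) by (simp add: S_def)
      fix w assume "w \<in> frontier S"
      then have wS: "w \<in> S" and wi: "w \<notin> interior S"
        using clS by (auto simp: frontier_def)
      have "cmod w = R \<or> \<bar>Im w\<bar> = Re w"
      proof (rule ccontr)
        assume "\<not> ?thesis"
        then have "w \<in> ball 0 R \<inter> {w. \<bar>Im w\<bar> < Re w}" using wS by (auto simp: S_def)
        moreover have "open (ball 0 R \<inter> {w. \<bar>Im w\<bar> < Re w})"
          by (intro open_Int open_ball open_Collect_less continuous_intros)
        moreover have "ball 0 R \<inter> {w. \<bar>Im w\<bar> < Re w} \<subseteq> S" by (auto simp: S_def)
        ultimately show False using wi by (meson interiorI)
      qed
      then show "cmod (g w) \<le> K + \<delta>"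
      proof
        assume "\<bar>Im w\<bar> = Re w"
        then have "cmod (f w) \<le> K" by (intro diag) simp
        moreover have "exp (- (e * Re (s w))) \<le> 1" using e s_nonneg[of w] wS by (simp add: S_def)
        ultimately show ?thesis unfolding norm_g
          using mult_mono[of "cmod (f w)" K "exp (- (e * Re (s w)))" 1] K \<open>\<delta> > 0\<close> by simp
      next
        assume wR: "cmod w = R"
        have "R \<le> cmod (w + 1)"
        proof -
          have "0 \<le> Re w" using wS by (auto simp: S_def)
          then have "(cmod w)\<^sup>2 \<le> (cmod (w + 1))\<^sup>2"
            unfolding cmod_power2 by (simp add: power2_eq_square algebra_simps)
          then show ?thesis using wR by (simp add: power2_le_iff_abs_le)
        qed
        then have "R powr (3/2) \<le> cmod (w + 1) powr (3/2)"
          using wR by (intro powr_mono2) auto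
        then have "R powr (3/2) / 5 \<le> Re (s w)" using s_lower[of w] wS by (simp add: S_def)
        then have "exp (- (e * Re (s w))) \<le> exp (- (e * (R powr (3/2) / 5)))"
          using e by simp
        then have "cmod (g w) \<le> A * exp (a * R) * exp (- (e * (R powr (3/2) / 5)))"
          unfolding norm_g using exp_type[of w] wR A by (intro mult_mono) auto
        also have "\<dots> \<le> K + \<delta>" using R(1) by (simp add: mult.assoc flip: exp_add)
        finally show ?thesis .
      qed
    qed
    then show ?thesis by (simp add: g_def)
  qed
  have main0: "cmod (f z * exp (- (of_real e * s z))) \<le> K" if "e > 0" for e
    using main[OF that] by (rule field_le_epsilon)
  have "((\<lambda>e. cmod (f z * exp (- (of_real e * s z)))) \<longlongrightarrow> cmod (f z * exp (- (of_real 0 * s z)))) (at_right 0)"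
    by (intro tendsto_intros)
  then have "((\<lambda>e. cmod (f z * exp (- (of_real e * s z)))) \<longlongrightarrow> cmod (f z)) (at_right 0)" by simp
  then show ?thesis
    by (rule tendsto_upperbound) (auto simp: eventually_at_filter intro!: always_eventually main0)
qed

theorem exponential_type_bounded_on_diagonals_constant:
  fixes f :: "complex \<Rightarrow> complex"
  assumes hol: "f holomorphic_on UNIV" and exp_type: "\<And>z. cmod (f z) \<le> A * exp (a * cmod z)"
    and diag: "\<And>z. \<bar>Re z\<bar> = \<bar>Im z\<bar> \<Longrightarrow> cmod (f z) \<le> K"
  shows "f z = f 0"
proof -
  have "cmod (f w) \<le> K" for w
  proof -
    have rot: "cmod (f (u * v)) \<le> K" if "cmod u = 1" "\<And>z. \<bar>Re z\<bar> = \<bar>Im z\<bar> \<Longrightarrow> \<bar>Re (u * z)\<bar> = \<bar>Im (u * z)\<bar>"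
        "\<bar>Im v\<bar> \<le> Re v" for u v
    proof (rule Phragmen_Lindelof_quadrant[of "\<lambda>z. f (u * z)" A a K v])
      show "(\<lambda>z. f (u * z)) holomorphic_on UNIV"
        by (rule holomorphic_on_compose_gen[OF _ hol, unfolded o_def]) (auto intro!: holomorphic_intros)
      show "cmod (f (u * z)) \<le> A * exp (a * cmod z)" for z
        using exp_type[of "u * z"] that(1) by (simp add: norm_mult)
    qed (use that diag in auto)
    consider "\<bar>Im w\<bar> \<le> Re w" | "\<bar>Im w\<bar> \<le> - Re w" | "\<bar>Re w\<bar> \<le> Im w" | "\<bar>Re w\<bar> \<le> - Im w"
      by linarith
    then show ?thesis
    proof cases
      case 1 then show ?thesis using rot[of 1 w] by simp
    next
      case 2 then show ?thesis using rot[of "-1" "-w"] by simp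
    next
      case 3 then show ?thesis using rot[of "\<i>" "- \<i> * w"] by simp
    next
      case 4 then show ?thesis using rot[of "-\<i>" "\<i> * w"] by simp
    qed
  qed
  then have "f constant_on UNIV"
    by (intro Liouville_theorem[OF hol]) (auto simp: bounded_iff)
  then show ?thesis by (auto simp: constant_on_def)
qed

section \<open>Two-dimensional systems with exponential dichotomy\<close>

lemma norm_exp_of_real_mult: "cmod (exp (\<alpha> * of_real x)) = exp (Re \<alpha> * x)"
  by (simp add: norm_exp_eq_Re)

text \<open>Solutions grow to the right, so the equation is integrated towards the left, where the
  kernel decays and each integration gains \<open>1 / s\<close>. A majorant of the forcing that is
  linear in \<open>t\<close> retains smallness near 0: at \<open>x = 0\<close> the slope costs only
  \<open>B / s^2\<close>.\<close>

lemma linear_growth_backward_estimate: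
  fixes z e :: "real \<Rightarrow> complex"
  assumes der: "\<And>t. t \<in> {0..1} \<Longrightarrow> (z has_vector_derivative \<alpha> * z t + e t) (at t within {0..1})"
    and e: "\<And>t. t \<in> {0..1} \<Longrightarrow> cmod (e t) \<le> A + B * t"
    and AB: "0 \<le> A" "0 \<le> B" and s: "0 < s" "s \<le> Re \<alpha>" and x: "x \<in> {0..1}"
  shows "cmod (z x - exp (- \<alpha> * (1 - x)) * z 1) \<le> (A + B * x) / s + B / s\<^sup>2"
proof -
  define h where "h = (\<lambda>t. exp (- \<alpha> * of_real t) * z t)"
  define a0 where "a0 = A / Re \<alpha> + B / (Re \<alpha>)\<^sup>2"
  define b0 where "b0 = B / Re \<alpha>"
  \<comment> \<open>An antiderivative of \<open>(A + B * t) * exp (- Re \<alpha> * t)\<close>; its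
    value at 1 is not positive and is dropped.\<close>
  define \<phi> where "\<phi> = (\<lambda>t. - (a0 + b0 * t) * exp (- Re \<alpha> * t))"
  have sig: "Re \<alpha> > 0" using s by simp
  have ab0: "a0 \<ge> 0" "b0 \<ge> 0" using sig AB by (simp_all add: a0_def b0_def)
  have dh: "(h has_vector_derivative exp (- \<alpha> * of_real t) * e t) (at t within {0..1})" if "t \<in> {0..1}" for t
  proof -
    have "((\<lambda>t. exp (- \<alpha> * of_real t)) has_vector_derivative - \<alpha> * exp (- \<alpha> * of_real t)) (at t within {0..1})"
      by (rule has_vector_derivative_real_field) (auto intro!: derivative_eq_intros)
    from has_vector_derivative_mult[OF this der[OF that]] show ?thesis
      unfolding h_def by (rule has_vector_derivative_eq_rhs) (simp add: algebra_simps)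
  qed
  have dphi: "(\<phi> has_vector_derivative (A + B * t) * exp (- Re \<alpha> * t)) (at t)" for t
    unfolding has_real_derivative_iff_has_vector_derivative[symmetric] \<phi>_def
  proof -
    have "((\<lambda>t. - (a0 + b0 * t) * exp (- Re \<alpha> * t)) has_real_derivative
        (Re \<alpha> * (a0 + b0 * t) - b0) * exp (- Re \<alpha> * t)) (at t)"
      by (auto intro!: derivative_eq_intros simp: algebra_simps)
    moreover have "Re \<alpha> * (a0 + b0 * t) - b0 = A + B * t"
      using sig by (simp add: a0_def b0_def field_simps power2_eq_square)
    ultimately show "((\<lambda>t. - (a0 + b0 * t) * exp (- Re \<alpha> * t)) has_real_derivative (A + B * t) * exp (- Re \<alpha> * t)) (at t)"
      by simp
  qed
  have conth: "continuous_on {0..1} h"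
    by (rule continuous_on_vector_derivative[where f' = "\<lambda>t. exp (- \<alpha> * of_real t) * e t"]) (rule dh)
  have contphi: "continuous_on UNIV \<phi>"
    by (rule continuous_on_vector_derivative[where f' = "\<lambda>t. (A + B * t) * exp (- Re \<alpha> * t)"])
      (rule has_vector_derivative_at_within[OF dphi])
  have bnd: "norm (h 1 - h x) \<le> \<phi> 1 - \<phi> x"
  proof (cases "x = 1")
    case False
    then have x1: "x < 1" using x by simp
    show ?thesis
    proof (rule differentiable_bound_general[OF x1,
          where f' = "\<lambda>t. exp (- \<alpha> * of_real t) * e t" and \<phi>' = "\<lambda>t. (A + B * t) * exp (- Re \<alpha> * t)"])
      show "continuous_on {x..1} h"
        using conth x by (rule_tac continuous_on_subset) auto
      show "continuous_on {x..1} \<phi>"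
        using contphi by (rule continuous_on_subset) simp
      fix t assume t: "x < t" "t < 1"
      show "(h has_vector_derivative exp (- \<alpha> * of_real t) * e t) (at t)"
      proof -
        have "at t within {0..1} = at t"
          using t x by (intro at_within_interior) auto
        then show ?thesis using dh[of t] t x by simp
      qed
      show "(\<phi> has_vector_derivative (A + B * t) * exp (- Re \<alpha> * t)) (at t)" by (rule dphi)
      show "norm (exp (- \<alpha> * of_real t) * e t) \<le> (A + B * t) * exp (- Re \<alpha> * t)"
        using e[of t] t x by (simp add: norm_mult norm_exp_eq_Re mult.commute)
    qed
  qed simp
  have "exp (\<alpha> * of_real x) * (h 1 - h x) = - (z x - exp (- \<alpha> * (1 - x)) * z 1)"
    by (simp add: h_def right_diff_distrib algebra_simps flip: exp_add mult.assoc)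
  then have "cmod (z x - exp (- \<alpha> * (1 - x)) * z 1) = exp (Re \<alpha> * x) * norm (h 1 - h x)"
    by (metis (no_types) norm_minus_cancel norm_mult norm_exp_of_real_mult)
  also have "\<dots> \<le> exp (Re \<alpha> * x) * (\<phi> 1 - \<phi> x)"
    using bnd by simp
  also have "\<dots> \<le> exp (Re \<alpha> * x) * (- \<phi> x)"
  proof (rule mult_left_mono)
    have "0 \<le> (a0 + b0) * exp (- Re \<alpha>)" using ab0 by simp
    then have "\<phi> 1 \<le> 0" by (simp add: \<phi>_def algebra_simps)
    then show "\<phi> 1 - \<phi> x \<le> - \<phi> x" by simp
  qed simp
  also have "\<dots> = (exp (Re \<alpha> * x) * exp (- (Re \<alpha> * x))) * (a0 + b0 * x)"
    by (simp add: \<phi>_def algebra_simps)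
  also have "\<dots> = a0 + b0 * x"
    by (simp flip: exp_add)
  also have "\<dots> = (A + B * x) / Re \<alpha> + B / (Re \<alpha>)\<^sup>2"
    by (simp add: a0_def b0_def add_divide_distrib)
  also have "\<dots> \<le> (A + B * x) / s + B / s\<^sup>2"
    using s AB x by (intro add_mono divide_left_mono power_mono mult_pos_pos) auto
  finally show ?thesis .
qed

lemma reflect_has_vector_derivative:
  fixes f :: "real \<Rightarrow> 'a::real_normed_vector"
  assumes "(f has_vector_derivative f') (at (1 - x) within {0..1})"
  shows "((\<lambda>t. f (1 - t)) has_vector_derivative - f') (at x within {0..1})"
proof -
  have "((f \<circ> (\<lambda>t. 1 - t)) has_vector_derivative (-1) *\<^sub>R f') (at x within {0..1})"
  proof (rule vector_diff_chain_within)
    show "((\<lambda>t. 1 - t) has_vector_derivative - 1) (at x within {0..1::real})"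
      by (auto intro!: derivative_eq_intros)
    have "(\<lambda>t. 1 - t) ` {0..1} = {0..1::real}"
      by (auto intro!: image_eqI[of _ _ "1 - _"])
    then show "(f has_vector_derivative f') (at (1 - x) within (\<lambda>t. 1 - t) ` {0..1})"
      using assms by simp
  qed
  then show ?thesis by (simp add: o_def)
qed

text \<open>Continuity gives no rate at 0. The slope \<open>2 * M / d\<close> covers the points
  \<open>t \<ge> d\<close>, where only boundedness is used; in the estimates this slope contributes
  at a higher order in \<open>1 / s\<close>.\<close>

lemma modulus_of_continuity_at_0:
  fixes P :: "real \<Rightarrow> complex"
  assumes "continuous_on {0..1} P" "\<epsilon> > 0"
  obtains N where "N \<ge> 0" "\<And>t. t \<in> {0..1} \<Longrightarrow> cmod (P t - P 0) \<le> \<epsilon> + N * t"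
proof -
  obtain M where M: "\<And>t. t \<in> {0..1} \<Longrightarrow> cmod (P t) \<le> M"
    using compact_imp_bounded[OF compact_continuous_image[OF assms(1) compact_Icc]]
    unfolding bounded_iff by blast
  obtain d where d: "d > 0" "\<And>t. t \<in> {0..1} \<Longrightarrow> dist t 0 < d \<Longrightarrow> dist (P t) (P 0) < \<epsilon>"
    using assms unfolding continuous_on_iff by (metis atLeastAtMost_iff order_refl zero_le_one)
  have M0: "M \<ge> 0" using M[of 0] by (meson atLeastAtMost_iff norm_ge_zero order_refl order_trans zero_le_one)
  show ?thesis
  proof
    show "2 * M / d \<ge> 0" using M0 d by simp
    fix t :: real assume t: "t \<in> {0..1}"
    show "cmod (P t - P 0) \<le> \<epsilon> + 2 * M / d * t"
    proof (cases "t < d")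
      case True
      then have "cmod (P t - P 0) \<le> \<epsilon>" using d(2)[OF t] t by (simp add: dist_norm)
      moreover have "0 \<le> 2 * M / d * t" using M0 d(1) t by simp
      ultimately show ?thesis by linarith
    next
      case False
      have "cmod (P t - P 0) \<le> 2 * M" using norm_triangle_ineq4[of "P t" "P 0"] M[OF t] M[of 0] by simp
      also have "\<dots> \<le> 2 * M / d * t" using False d(1) M0 mult_left_mono[of d t "2*M"] by (simp add: field_simps)
      finally show ?thesis using assms(2) by simp
    qed
  qed
qed

section \<open>Systems with one growing and one decaying component\<close>

text \<open>The common form of the problem in both half planes: for positive
  \<open>Re \<alpha>\<close> and \<open>Re \<gamma>\<close>, \<open>u\<close> is the growing and
  \<open>v\<close> the decaying component. They are the components 1 and 2 in the upper half plane,
  2 and 1 in the lower one.\<close>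

definition dichotomic :: "complex \<Rightarrow> complex \<Rightarrow> (real \<Rightarrow> complex) \<Rightarrow> (real \<Rightarrow> complex) \<Rightarrow>
    (real \<Rightarrow> complex) \<Rightarrow> (real \<Rightarrow> complex) \<Rightarrow> (real \<Rightarrow> complex) \<Rightarrow> (real \<Rightarrow> complex) \<Rightarrow> bool" where
  "dichotomic \<alpha> \<gamma> P R g h u v \<longleftrightarrow> (\<forall>t\<in>{0..1}.
     (u has_vector_derivative \<alpha> * u t + (P t * v t + g t)) (at t within {0..1}) \<and>
     (v has_vector_derivative - \<gamma> * v t + (R t * u t + h t)) (at t within {0..1}))"

text \<open>Reversing the interval exchanges growth and decay. Thus every estimate of
  \<open>u\<close> from the right end or at the left end is also one of \<open>v\<close> from the
  left end or at the right end.\<close>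

lemma dichotomic_reflect:
  assumes "dichotomic \<alpha> \<gamma> P R g h u v"
  shows "dichotomic \<gamma> \<alpha> (\<lambda>t. - R (1 - t)) (\<lambda>t. - P (1 - t)) (\<lambda>t. - h (1 - t)) (\<lambda>t. - g (1 - t))
           (\<lambda>t. v (1 - t)) (\<lambda>t. u (1 - t))"
  unfolding dichotomic_def
proof (intro ballI conjI)
  fix t :: real assume "t \<in> {0..1}"
  then have t: "1 - t \<in> {0..1}" by simp
  show "((\<lambda>t. v (1 - t)) has_vector_derivative \<gamma> * v (1 - t) + (- R (1 - t) * u (1 - t) + - h (1 - t))) (at t within {0..1})"
    using reflect_has_vector_derivative[of v _ t] assms t unfolding dichotomic_def
    by (rule_tac has_vector_derivative_eq_rhs) (blast, simp)
  show "((\<lambda>t. u (1 - t)) has_vector_derivative - \<alpha> * u (1 - t) + (- P (1 - t) * v (1 - t) + - g (1 - t))) (at t within {0..1})"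
    using reflect_has_vector_derivative[of u _ t] assms t unfolding dichotomic_def
    by (rule_tac has_vector_derivative_eq_rhs) (blast, simp)
qed

lemma dichotomic_continuous:
  assumes "dichotomic \<alpha> \<gamma> P R g h u v"
  shows "continuous_on {0..1} u" "continuous_on {0..1} v"
  using assms continuous_on_vector_derivative[of "{0..1}" u "\<lambda>t. \<alpha> * u t + (P t * v t + g t)"]
    continuous_on_vector_derivative[of "{0..1}" v "\<lambda>t. - \<gamma> * v t + (R t * u t + h t)"]
  by (auto simp: dichotomic_def)

text \<open>Coupling and inhomogeneity act together as a bounded forcing, with slope 0 in the
  backward estimate, and so cost only a factor \<open>1 / s\<close> relative to the free
  exponential.\<close>

lemma dichotomic_free_decay:
  assumes d: "dichotomic \<alpha> \<gamma> P R g h u v"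
    and PR: "\<And>t. t \<in> {0..1} \<Longrightarrow> cmod (P t) \<le> M"
    and gh: "\<And>t. t \<in> {0..1} \<Longrightarrow> cmod (g t) \<le> G"
    and V: "\<And>t. t \<in> {0..1} \<Longrightarrow> cmod (v t) \<le> V"
    and s: "0 < s" "s \<le> Re \<alpha>" and x: "x \<in> {0..1}"
  shows "cmod (u x - exp (- \<alpha> * (1 - x)) * u 1) \<le> (M * V + G) / s"
proof -
  have M: "0 \<le> M" and V0: "0 \<le> V" and G: "0 \<le> G"
    using PR[OF x] V[OF x] gh[OF x] by (meson norm_ge_zero order_trans)+
  have "cmod (u x - exp (- \<alpha> * (1 - x)) * u 1) \<le> ((M * V + G) + 0 * x) / s + 0 / s\<^sup>2"
  proof (rule linear_growth_backward_estimate[where z = u and e = "\<lambda>t. P t * v t + g t"])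
    show "cmod (P t * v t + g t) \<le> M * V + G + 0 * t" if "t \<in> {0..1}" for t
      using norm_triangle_ineq[of "P t * v t" "g t"] gh[OF that]
        mult_mono[OF PR[OF that] V[OF that] M norm_ge_zero] by (simp add: norm_mult)
  qed (use d x s M V0 G in \<open>auto simp: dichotomic_def\<close>)
  then show ?thesis by simp
qed

lemma norm_exp_decay_le_1:
  assumes "0 \<le> Re \<alpha>" "x \<le> 1"
  shows "cmod (exp (- \<alpha> * (1 - of_real x))) \<le> 1"
  using assms by (simp add: norm_exp_eq_Re)

text \<open>\<open>u 1\<close> and \<open>v 0\<close> are the end values that are carried in a
  decaying direction. Because \<open>M / s \<le> 1 / 4\<close>, the mutual coupling of the two
  suprema is absorbed.\<close>

lemma dichotomic_bound:
  assumes d: "dichotomic \<alpha> \<gamma> P R g h u v"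
    and P: "\<And>t. t \<in> {0..1} \<Longrightarrow> cmod (P t) \<le> M" and R: "\<And>t. t \<in> {0..1} \<Longrightarrow> cmod (R t) \<le> M"
    and g: "\<And>t. t \<in> {0..1} \<Longrightarrow> cmod (g t) \<le> G" and h: "\<And>t. t \<in> {0..1} \<Longrightarrow> cmod (h t) \<le> G"
    and s: "0 < s" "s \<le> Re \<alpha>" "s \<le> Re \<gamma>" "4 * M \<le> s" and x: "x \<in> {0..1}"
  shows "cmod (u x) \<le> 2 * (cmod (u 1) + cmod (v 0)) + 4 * G / s"
    and "cmod (v x) \<le> 2 * (cmod (u 1) + cmod (v 0)) + 4 * G / s"
proof -
  obtain xu where xu: "xu \<in> {0..1}" "\<And>t. t \<in> {0..1} \<Longrightarrow> cmod (u t) \<le> cmod (u xu)"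
    using continuous_attains_sup[OF compact_Icc _ continuous_on_norm[OF dichotomic_continuous(1)[OF d]]]
    by fastforce
  obtain xv where xv: "xv \<in> {0..1}" "\<And>t. t \<in> {0..1} \<Longrightarrow> cmod (v t) \<le> cmod (v xv)"
    using continuous_attains_sup[OF compact_Icc _ continuous_on_norm[OF dichotomic_continuous(2)[OF d]]]
    by fastforce
  define U V where "U = cmod (u xu)" and "V = cmod (v xv)"
  have "cmod (u xu) \<le> cmod (exp (- \<alpha> * (1 - xu)) * u 1) + (M * V + G) / s"
    using dichotomic_free_decay[OF d P g _ s(1,2) xu(1), of V] xv(2)
      norm_triangle_sub[of "u xu" "exp (- \<alpha> * (1 - xu)) * u 1"] unfolding V_def by fastforce
  also have "cmod (exp (- \<alpha> * (1 - xu)) * u 1) \<le> cmod (u 1)"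
    unfolding norm_mult using norm_exp_decay_le_1[of \<alpha> xu] s xu(1) by (intro mult_left_le_one_le) auto
  finally have 1: "U \<le> cmod (u 1) + (M * V + G) / s" by (simp add: U_def)
  have "cmod (v xv - exp (- \<gamma> * (1 - (1 - xv))) * v 0) \<le> (M * U + G) / s"
    using dichotomic_free_decay[OF dichotomic_reflect[OF d] _ _ _ s(1,3), of M G U "1 - xv"] R h xu(2) xv(1)
    unfolding U_def by simp
  then have "cmod (v xv) \<le> cmod (exp (- \<gamma> * (1 - of_real (1 - xv))) * v 0) + (M * U + G) / s"
    using norm_triangle_sub[of "v xv" "exp (- \<gamma> * (1 - (1 - xv))) * v 0"] by simp
  also have "cmod (exp (- \<gamma> * (1 - of_real (1 - xv))) * v 0) \<le> cmod (v 0)"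
    unfolding norm_mult using norm_exp_decay_le_1[of \<gamma> "1 - xv"] s xv(1) by (intro mult_left_le_one_le) auto
  finally have 2: "V \<le> cmod (v 0) + (M * U + G) / s" by (simp add: V_def)
  have "M * (U + V) / s \<le> (U + V) / 4"
    using s mult_right_mono[OF s(4), of "U + V"] by (simp add: U_def V_def field_simps)
  with 1 2 have "U + V \<le> cmod (u 1) + cmod (v 0) + (U + V) / 4 + 2 * (G / s)"
    by (simp add: add_divide_distrib distrib_left)
  moreover have "0 \<le> G / s" using order_trans[OF norm_ge_zero g[OF x]] s(1) by simp
  moreover have "0 \<le> cmod (u 1)" "0 \<le> cmod (v 0)" "0 \<le> U" "0 \<le> V" by (auto simp: U_def V_def)
  ultimately have "U \<le> 2 * (cmod (u 1) + cmod (v 0)) + 4 * (G / s)" "V \<le> 2 * (cmod (u 1) + cmod (v 0)) + 4 * (G / s)"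
    by argo+
  then show "cmod (u x) \<le> 2 * (cmod (u 1) + cmod (v 0)) + 4 * G / s"
    and "cmod (v x) \<le> 2 * (cmod (u 1) + cmod (v 0)) + 4 * G / s"
    using xu(2)[OF x] xv(2)[OF x] unfolding U_def V_def by simp_all
qed

lemma exp_minus_le_inverse_square:
  assumes "0 < (s::real)" shows "exp (- s) \<le> 2 / s\<^sup>2"
proof -
  have "1 + s + s\<^sup>2 / 2 \<le> exp s" using exp_lower_Taylor_quadratic[of s] assms by simp
  then have "s\<^sup>2 / 2 \<le> exp s" using assms by simp
  then show ?thesis using assms by (simp add: exp_minus field_simps)
qed

text \<open>To leading order the forcing \<open>P v\<close> is \<open>P 0 * exp (- \<gamma> * t) * v 0\<close>, whose particular solution
  is subtracted from \<open>u\<close>.\<close>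
lemma dichotomic_left_value:
  assumes d: "dichotomic \<alpha> \<gamma> P R g h u v"
    and P: "\<And>t. t \<in> {0..1} \<Longrightarrow> cmod (P t) \<le> M" and R: "\<And>t. t \<in> {0..1} \<Longrightarrow> cmod (R t) \<le> M"
    and g: "\<And>t. t \<in> {0..1} \<Longrightarrow> cmod (g t) \<le> G" and h: "\<And>t. t \<in> {0..1} \<Longrightarrow> cmod (h t) \<le> G"
    and s: "1 \<le> s" "s \<le> Re \<alpha>" "s \<le> Re \<gamma>" "4 * M \<le> s"
    and mod: "\<And>t. t \<in> {0..1} \<Longrightarrow> cmod (P t - P 0) \<le> \<epsilon> + N * t" "0 \<le> \<epsilon>" "0 \<le> N"
    and W: "\<And>t. t \<in> {0..1} \<Longrightarrow> cmod (u t) \<le> W" "\<And>t. t \<in> {0..1} \<Longrightarrow> cmod (v t) \<le> W"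
  shows "cmod (u 0 + P 0 * v 0 / (\<alpha> + \<gamma>)) \<le> ((\<epsilon> + (M\<^sup>2 + N + 3) / s) * W + 2 * G) / s"
proof -
  have M: "0 \<le> M" and W0: "0 \<le> W" and G: "0 \<le> G"
    using P[of 0] W(1)[of 0] g[of 0] by (meson atLeastAtMost_iff norm_ge_zero order_refl order_trans zero_le_one)+
  have s0: "0 < s" using s by simp
  have w0: "\<alpha> + \<gamma> \<noteq> 0"
  proof
    assume "\<alpha> + \<gamma> = 0"
    then have "Re (\<alpha> + \<gamma>) = 0" by simp
    then show False using s by simp
  qed
  define c where "c = P 0 * v 0"
  define z where "z = (\<lambda>t. u t + c * exp (- \<gamma> * of_real t) / (\<alpha> + \<gamma>))"
  \<comment> \<open>What remains of the forcing is due to \<open>P - P 0\<close>, small near 0, to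
    the deviation of \<open>v\<close> from free decay, of order \<open>1 / s\<close>, and to
    \<open>g\<close>. The end value inherits this extra smallness.\<close>
  define e where "e = (\<lambda>t. P t * v t + g t - c * exp (- \<gamma> * of_real t))"
  have v_decay: "cmod (v t - exp (- \<gamma> * of_real t) * v 0) \<le> (M * W + G) / s" if "t \<in> {0..1}" for t
    using dichotomic_free_decay[OF dichotomic_reflect[OF d] _ _ _ s0 s(3), of M G W "1 - t"] R h W(1) that
    by simp
  define A where "A = \<epsilon> * W + M * ((M * W + G) / s) + G"
  have e_le: "cmod (e t) \<le> A + N * W * t" if t: "t \<in> {0..1}" for t
  proof -
    have "e t = (P t - P 0) * v t + P 0 * (v t - exp (- \<gamma> * of_real t) * v 0) + g t"
      by (simp add: e_def c_def algebra_simps)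
    also have "cmod \<dots> \<le> cmod (P t - P 0) * cmod (v t) + cmod (P 0) * cmod (v t - exp (- \<gamma> * of_real t) * v 0) + cmod (g t)"
      by (metis (no_types, lifting) add_mono_thms_linordered_semiring(3) norm_mult norm_triangle_ineq order_trans)
    also have "\<dots> \<le> (\<epsilon> + N * t) * W + M * ((M * W + G) / s) + G"
      using t mod by (intro add_mono mult_mono v_decay W P g M) auto
    finally show ?thesis by (simp add: A_def algebra_simps)
  qed
  have dz: "(z has_vector_derivative \<alpha> * z t + e t) (at t within {0..1})" if "t \<in> {0..1}" for t
  proof -
    have "((\<lambda>t. exp (- \<gamma> * of_real t)) has_vector_derivative - \<gamma> * exp (- \<gamma> * of_real t)) (at t within {0..1})"
      by (rule has_vector_derivative_real_field) (auto intro!: derivative_eq_intros)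
    then have "((\<lambda>t. c / (\<alpha> + \<gamma>) * exp (- \<gamma> * of_real t)) has_vector_derivative c / (\<alpha> + \<gamma>) * (- \<gamma> * exp (- \<gamma> * of_real t))) (at t within {0..1})"
      by (rule has_vector_derivative_mult_right)
    moreover have "(u has_vector_derivative \<alpha> * u t + (P t * v t + g t)) (at t within {0..1})"
      using d that by (simp add: dichotomic_def)
    ultimately have "((\<lambda>t. u t + c / (\<alpha> + \<gamma>) * exp (- \<gamma> * of_real t)) has_vector_derivative
        (\<alpha> * u t + (P t * v t + g t)) + c / (\<alpha> + \<gamma>) * (- \<gamma> * exp (- \<gamma> * of_real t))) (at t within {0..1})"
      by (intro has_vector_derivative_add)
    moreover have "(\<alpha> * u t + (P t * v t + g t)) + c / (\<alpha> + \<gamma>) * (- \<gamma> * exp (- \<gamma> * of_real t)) = \<alpha> * z t + e t"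
      using w0 by (simp add: z_def e_def field_simps)
    ultimately show ?thesis by (simp add: z_def)
  qed
  have "A \<ge> 0" using M W0 G s0 mod by (simp add: A_def)
  then have "cmod (z 0 - exp (- \<alpha> * (1 - of_real 0)) * z 1) \<le> (A + N * W * 0) / s + N * W / s\<^sup>2"
    using linear_growth_backward_estimate[of z \<alpha> e A "N * W" s 0] dz e_le mod W0 s0 s by auto
  then have "cmod (z 0) \<le> A / s + N * W / s\<^sup>2 + cmod (exp (- \<alpha>) * z 1)"
    using norm_triangle_sub[of "z 0" "exp (- \<alpha>) * z 1"] by simp
  \<comment> \<open>The influence of the right end is exponentially small; a bound of order
    \<open>1 / s^2\<close> is enough.\<close>
  also have "cmod (exp (- \<alpha>) * z 1) \<le> 2 / s\<^sup>2 * (W + W / 4)"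
    unfolding norm_mult
  proof (rule mult_mono)
    have "cmod (exp (- \<alpha>)) \<le> exp (- s)" using s by (simp add: norm_exp_eq_Re)
    also have "\<dots> \<le> 2 / s\<^sup>2" by (rule exp_minus_le_inverse_square[OF s0])
    finally show "cmod (exp (- \<alpha>)) \<le> 2 / s\<^sup>2" .
    have "s \<le> cmod (\<alpha> + \<gamma>)"
      using s complex_Re_le_cmod[of "\<alpha> + \<gamma>"] by simp
    moreover have "cmod c * cmod (exp (- \<gamma>)) \<le> M * W * 1"
      unfolding c_def norm_mult using P[of 0] W(2)[of 0] M W0 s
      by (intro mult_mono) (auto simp: norm_exp_eq_Re)
    ultimately have "cmod c * cmod (exp (- \<gamma>)) / cmod (\<alpha> + \<gamma>) \<le> M * W * 1 / s"
      using s0 M W0 by (intro frac_le) auto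
    also have "\<dots> \<le> W / 4" using s(4) s0 W0 mult_right_mono[OF s(4) W0] by (simp add: field_simps)
    finally have "cmod (c * exp (- \<gamma>) / (\<alpha> + \<gamma>)) \<le> W / 4" by (simp add: norm_mult norm_divide)
    then show "cmod (z 1) \<le> W + W / 4"
      unfolding z_def using norm_triangle_ineq[of "u 1" "c * exp (- \<gamma>) / (\<alpha> + \<gamma>)"] W(1)[of 1] by simp
  qed auto
  finally have "cmod (z 0) \<le> A / s + N * W / s\<^sup>2 + 2 / s\<^sup>2 * (W + W / 4)" by simp
  also have "\<dots> = (\<epsilon> * W + M\<^sup>2 * W / s + (M / s) * G + G + N * W / s + 5 / 2 * W / s) / s"
    using s0 by (simp add: A_def field_simps power2_eq_square)
  also have "\<dots> \<le> (\<epsilon> * W + M\<^sup>2 * W / s + 1 * G + G + N * W / s + 3 * W / s) / s"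
    using s0 W0 G s M by (intro divide_right_mono add_mono mult_right_mono) (auto simp: field_simps)
  also have "\<dots> = ((\<epsilon> + (M\<^sup>2 + N + 3) / s) * W + 2 * G) / s"
    using s0 by (simp add: field_simps)
  finally show ?thesis by (simp add: z_def c_def)
qed

section \<open>Boundary conditions and the a priori estimate\<close>

text \<open>The first nonzero coefficient dominates. If it is \<open>A\<close>, even a constant
  lower bound holds; it is weakened to order \<open>1 / cmod w\<close> so that both cases have the
  same form.\<close>

lemma leading_coefficient_lower_bound:
  fixes A B :: complex
  assumes "cmod A + cmod B \<noteq> 0"
  obtains k w0 where "0 < k" "0 < w0"
    "\<And>w. w0 \<le> cmod w \<Longrightarrow> k / cmod w \<le> cmod (A + B / w + D / w\<^sup>2)"
proof (cases "A = 0")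
  case False
  define w0 where "w0 = max 1 (2 * (cmod B + cmod D) / cmod A)"
  show ?thesis
  proof
    show "0 < cmod A / 2" using False by simp
    show "0 < w0" by (simp add: w0_def)
    fix w assume w: "w0 \<le> cmod w"
    then have w1: "1 \<le> cmod w" by (simp add: w0_def)
    have "cmod D / (cmod w)\<^sup>2 \<le> cmod D / cmod w"
      using w1 self_le_power[of "cmod w" 2] by (intro divide_left_mono mult_pos_pos) (auto intro: less_le_trans[of 0 1])
    moreover have "cmod B / cmod w + cmod D / cmod w \<le> cmod A / 2"
    proof -
      have "2 * (cmod B + cmod D) / cmod A \<le> cmod w" using w by (simp add: w0_def)
      then have "2 * (cmod B + cmod D) \<le> cmod w * cmod A" using False by (simp add: field_simps)
      then have "(cmod B + cmod D) / cmod w \<le> cmod A / 2" using w1 by (simp add: divide_le_eq mult.commute)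
      then show ?thesis by (simp add: add_divide_distrib)
    qed
    moreover have "cmod A \<le> cmod (A + B / w + D / w\<^sup>2) + cmod (B / w + D / w\<^sup>2)"
      by (metis add.assoc norm_triangle_sub add_diff_cancel_right' norm_minus_commute norm_triangle_ineq4)
    moreover have "cmod (B / w + D / w\<^sup>2) \<le> cmod B / cmod w + cmod D / (cmod w)\<^sup>2"
      by (metis norm_divide norm_power norm_triangle_ineq)
    ultimately have "cmod A / 2 \<le> cmod (A + B / w + D / w\<^sup>2)" by linarith
    moreover have "cmod A / 2 / cmod w \<le> cmod A / 2 / 1" using w1 by (intro divide_left_mono) auto
    ultimately show "cmod A / 2 / cmod w \<le> cmod (A + B / w + D / w\<^sup>2)" by linarith
  qed
next
  case True
  then have B: "B \<noteq> 0" using assms by auto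
  define w0 where "w0 = max 1 (2 * cmod D / cmod B)"
  show ?thesis
  proof
    show "0 < cmod B / 2" using B by simp
    show "0 < w0" by (simp add: w0_def)
    fix w assume w: "w0 \<le> cmod w"
    then have w1: "1 \<le> cmod w" by (simp add: w0_def)
    have "2 * cmod D / cmod B \<le> cmod w" using w by (simp add: w0_def)
    then have "2 * cmod D \<le> cmod w * cmod B" using B by (simp add: field_simps)
    then have "cmod D / cmod w \<le> cmod B / 2" using w1 by (simp add: divide_le_eq mult.commute)
    then have "cmod D / cmod w / cmod w \<le> cmod B / 2 / cmod w" by (rule divide_right_mono) simp
    then have "cmod D / (cmod w)\<^sup>2 \<le> cmod B / 2 / cmod w" by (simp add: power2_eq_square)
    moreover have "cmod B / cmod w \<le> cmod (B / w + D / w\<^sup>2) + cmod D / (cmod w)\<^sup>2"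
      by (metis add_diff_cancel_right' norm_divide norm_power norm_triangle_ineq4)
    ultimately have "cmod B / 2 / cmod w \<le> cmod (B / w + D / w\<^sup>2)" by simp
    then show "cmod B / 2 / cmod w \<le> cmod (A + B / w + D / w\<^sup>2)" using True by simp
  qed
qed

text \<open>Up to errors \<open>X\<close> and \<open>Y\<close> the boundary conditions form a linear
  system for \<open>u 1\<close> and \<open>v 0\<close>. Its determinant is at least
  \<open>k / cmod w\<close> and its right-hand side is of size
  \<open>(\<eta> * W + 2 * G) / s\<close>. Since \<open>cmod w \<le> H * s\<close>, the factors
  \<open>s\<close> cancel, and the small multiple of the common bound \<open>W\<close> is
  absorbed.\<close>

theorem dichotomic_boundary_estimate:
  fixes P R :: "real \<Rightarrow> complex" and c1 c2 c3 c4 d1 d2 d3 d4 :: complex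
  assumes contP: "continuous_on {0..1} P" and contR: "continuous_on {0..1} R"
    and nondeg: "cmod (c3 * d2 - c2 * d3) + cmod ((c1 * d3 - c3 * d1) * P 0 + (c4 * d2 - c2 * d4) * R 1) \<noteq> 0"
  obtains K s0 where "0 < K" "0 < s0"
    "\<And>\<alpha> \<gamma> s g h u v G x. \<lbrakk>dichotomic \<alpha> \<gamma> P R g h u v; s0 \<le> s; s \<le> Re \<alpha>; s \<le> Re \<gamma>; cmod (\<alpha> + \<gamma>) \<le> H * s;
       \<And>t. t \<in> {0..1} \<Longrightarrow> cmod (g t) \<le> G; \<And>t. t \<in> {0..1} \<Longrightarrow> cmod (h t) \<le> G;
       c1 * u 0 + c2 * v 0 + c3 * u 1 + c4 * v 1 = 0; d1 * u 0 + d2 * v 0 + d3 * u 1 + d4 * v 1 = 0;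
       x \<in> {0..1}\<rbrakk> \<Longrightarrow> cmod (u x) \<le> K * G \<and> cmod (v x) \<le> K * G"
proof -
  define D where "D = (c1 * d4 - c4 * d1) * P 0 * R 1"
  obtain k w0 where kw: "0 < k" "0 < w0" "\<And>w. w0 \<le> cmod w \<Longrightarrow> k / cmod w \<le>
      cmod ((c3 * d2 - c2 * d3) + ((c1 * d3 - c3 * d1) * P 0 + (c4 * d2 - c2 * d4) * R 1) / w + D / w\<^sup>2)"
    using leading_coefficient_lower_bound[OF nondeg] by blast
  obtain MP where MP: "\<And>t. t \<in> {0..1} \<Longrightarrow> cmod (P t) \<le> MP"
    using compact_imp_bounded[OF compact_continuous_image[OF contP compact_Icc]] unfolding bounded_iff by blast
  obtain MR where MR: "\<And>t. t \<in> {0..1} \<Longrightarrow> cmod (R t) \<le> MR"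
    using compact_imp_bounded[OF compact_continuous_image[OF contR compact_Icc]] unfolding bounded_iff by blast
  define M where "M = max 0 (max MP MR)"
  have P: "\<And>t. t \<in> {0..1} \<Longrightarrow> cmod (P t) \<le> M" and R: "\<And>t. t \<in> {0..1} \<Longrightarrow> cmod (R t) \<le> M"
    using MP MR unfolding M_def by (meson max.coboundedI1 max.coboundedI2)+
  have M0: "0 \<le> M" by (simp add: M_def)
  define C where "C = 1 + (cmod c1 + cmod c2 + cmod c3 + cmod c4 + (cmod d1 + cmod d2 + cmod d3 + cmod d4))"
  have C: "cmod c1 \<le> C" "cmod c2 \<le> C" "cmod c3 \<le> C" "cmod c4 \<le> C" "cmod d1 \<le> C" "cmod d2 \<le> C" "cmod d3 \<le> C" "cmod d4 \<le> C"
    and C1: "1 \<le> C"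
    using norm_ge_zero[of c1] norm_ge_zero[of c2] norm_ge_zero[of c3] norm_ge_zero[of c4]
      norm_ge_zero[of d1] norm_ge_zero[of d2] norm_ge_zero[of d3] norm_ge_zero[of d4]
    unfolding C_def by linarith+
  \<comment> \<open>\<open>L\<close> collects the constants of Cramer's rule; \<open>\<eta>\<close>
    is chosen so that \<open>L * \<eta> = 1 / 4\<close>, which later lets the term with
    \<open>W\<close> be absorbed.\<close>
  define L where "L = 16 * C\<^sup>2 * max 1 H / k"
  have L: "0 < L" using C1 kw(1) by (simp add: L_def)
  define \<eta> where "\<eta> = 1 / (4 * L)"
  have eta: "0 < \<eta>" using L by (simp add: \<eta>_def)
  obtain NP where NP: "NP \<ge> 0" "\<And>t. t \<in> {0..1} \<Longrightarrow> cmod (P t - P 0) \<le> \<eta> / 2 + NP * t"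
    using modulus_of_continuity_at_0[OF contP, of "\<eta>/2"] eta by auto
  have contR': "continuous_on {0..1} (\<lambda>t. - R (1 - t))"
    by (intro continuous_intros continuous_on_compose2[OF contR]) auto
  obtain NR where NR: "NR \<ge> 0" "\<And>t. t \<in> {0..1} \<Longrightarrow> cmod (- R (1 - t) - - R (1 - 0)) \<le> \<eta> / 2 + NR * t"
    using modulus_of_continuity_at_0[OF contR', of "\<eta>/2"] eta by auto
  define N where "N = NP + NR"
  have N: "\<And>t. t \<in> {0..1} \<Longrightarrow> cmod (P t - P 0) \<le> \<eta> / 2 + N * t"
    "\<And>t. t \<in> {0..1} \<Longrightarrow> cmod (- R (1 - t) - - R (1 - 0)) \<le> \<eta> / 2 + N * t" "0 \<le> N"
    using NP NR order_trans[OF NP(2)] order_trans[OF NR(2)] by (auto simp: N_def distrib_right)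
  \<comment> \<open>The last entry makes the part \<open>(M\<^sup>2 + N + 3) / s\<close> of the
    error at most \<open>\<eta> / 2\<close>; the other half of \<open>\<eta>\<close> is spent on the
    modulus of continuity.\<close>
  define s0 where "s0 = max 1 (max (4 * M) (max w0 (2 * (M\<^sup>2 + N + 3) / \<eta>)))"
  define K where "K = 8 * L + 8"
  show ?thesis
  proof
    show "0 < K" using L by (simp add: K_def)
    show "0 < s0" by (simp add: s0_def)
    fix \<alpha> \<gamma> s g h u v G and x :: real
    assume d: "dichotomic \<alpha> \<gamma> P R g h u v" and s: "s0 \<le> s" "s \<le> Re \<alpha>" "s \<le> Re \<gamma>" and H: "cmod (\<alpha> + \<gamma>) \<le> H * s"
      and g: "\<And>t. t \<in> {0..1} \<Longrightarrow> cmod (g t) \<le> G" and h: "\<And>t. t \<in> {0..1} \<Longrightarrow> cmod (h t) \<le> G"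
      and bc: "c1 * u 0 + c2 * v 0 + c3 * u 1 + c4 * v 1 = 0" "d1 * u 0 + d2 * v 0 + d3 * u 1 + d4 * v 1 = 0"
      and x: "x \<in> {0..1}"
    have s1: "1 \<le> s" "4 * M \<le> s" "w0 \<le> s" "2 * (M\<^sup>2 + N + 3) / \<eta> \<le> s"
      using s(1) by (simp_all add: s0_def)
    have sp: "0 < s" using s1 by simp
    have G0: "0 \<le> G" using g[OF x] by (meson norm_ge_zero order_trans)
    define p q W where "p = cmod (u 1)" and "q = cmod (v 0)" and "W = 2 * (p + q) + 4 * G / s"
    have W: "cmod (u t) \<le> W" "cmod (v t) \<le> W" if "t \<in> {0..1}" for t
      using dichotomic_bound[OF d P R g h sp s(2,3) s1(2) that] unfolding W_def p_def q_def by auto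
    have W0: "0 \<le> W" using W(1)[OF x] by (meson norm_ge_zero order_trans)
    define w where "w = \<alpha> + \<gamma>"
    have sw: "s \<le> cmod w" using s sp complex_Re_le_cmod[of w] by (simp add: w_def)
    have wn: "w \<noteq> 0" using sw sp by auto
    have eps: "\<eta> / 2 + (M\<^sup>2 + N + 3) / s \<le> \<eta>"
      using s1(4) sp eta by (simp add: field_simps)
    \<comment> \<open>\<open>X\<close> and \<open>Y\<close> are what is left of the end values
      \<open>u 0\<close> and \<open>v 1\<close> after removal of their leading terms.\<close>
    define X where "X = u 0 + P 0 * v 0 / w"
    define Y where "Y = v 1 - R 1 * u 1 / w"
    have err: "((\<eta> / 2 + (M\<^sup>2 + N + 3) / s) * W + 2 * G) / s \<le> (\<eta> * W + 2 * G) / s"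
      using eps W0 G0 sp by (intro divide_right_mono add_mono mult_right_mono) auto
    have X: "cmod X \<le> (\<eta> * W + 2 * G) / s"
      using dichotomic_left_value[OF d P R g h s1(1) s(2,3) s1(2) N(1) _ N(3) W(1) W(2)] eta err
      unfolding X_def w_def by simp
    have Y: "cmod Y \<le> (\<eta> * W + 2 * G) / s"
      using dichotomic_left_value[OF dichotomic_reflect[OF d] _ _ _ _ s1(1) s(3,2) s1(2) N(2) _ N(3), of G W] P R g h W eta err
      unfolding Y_def w_def by (simp add: add.commute)
    \<comment> \<open>The coefficients of \<open>u 1\<close> and \<open>v 0\<close> after
      elimination of \<open>u 0\<close> and \<open>v 1\<close>.\<close>
    define m1 m2 n1 n2 where "m1 = c3 + c4 * R 1 / w" and "m2 = d3 + d4 * R 1 / w"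
      and "n1 = c2 - c1 * P 0 / w" and "n2 = d2 - d1 * P 0 / w"
    define \<rho> where "\<rho> = 2 * C * ((\<eta> * W + 2 * G) / s)"
    have r1: "m1 * u 1 + n1 * v 0 = - (c1 * X + c4 * Y)" and r2: "m2 * u 1 + n2 * v 0 = - (d1 * X + d4 * Y)"
      using bc by (simp_all add: m1_def m2_def n1_def n2_def X_def Y_def algebra_simps add_eq_0_iff2)
    have r: "cmod (- (e1 * X + e4 * Y)) \<le> \<rho>" if "cmod e1 \<le> C" "cmod e4 \<le> C" for e1 e4
    proof -
      have "cmod (- (e1 * X + e4 * Y)) \<le> cmod e1 * cmod X + cmod e4 * cmod Y"
        unfolding norm_minus_cancel by (metis norm_mult norm_triangle_ineq)
      also have "\<dots> \<le> C * ((\<eta> * W + 2 * G) / s) + C * ((\<eta> * W + 2 * G) / s)"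
        using that X Y C1 by (intro add_mono mult_mono) auto
      finally show ?thesis by (simp add: \<rho>_def)
    qed
    have mn: "cmod (e + f * S / w) \<le> 2 * C" "cmod (e - f * S / w) \<le> 2 * C" if "cmod e \<le> C" "cmod f \<le> C" "cmod S \<le> M" for e f S
    proof -
      have "cmod f * cmod S / cmod w \<le> C * M / s"
        using that sw sp C1 M0 by (intro frac_le mult_mono) auto
      also have "\<dots> \<le> C" using s1(2) sp C1 M0 mult_left_mono[of M s C] by (simp add: field_simps)
      finally have "cmod (f * S / w) \<le> C" by (simp add: norm_mult norm_divide)
      then show "cmod (e + f * S / w) \<le> 2 * C" "cmod (e - f * S / w) \<le> 2 * C"
        using that(1) norm_triangle_ineq[of e "f * S / w"] norm_triangle_ineq4[of e "f * S / w"] by simp_all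
    qed
    have b: "cmod m1 \<le> 2 * C" "cmod m2 \<le> 2 * C" "cmod n1 \<le> 2 * C" "cmod n2 \<le> 2 * C"
      unfolding m1_def m2_def n1_def n2_def using C P[of 0] R[of 1] by (intro mn; simp)+
    define \<Delta> where "\<Delta> = m1 * n2 - m2 * n1"
    have "\<Delta> = (c3 * d2 - c2 * d3) + ((c1 * d3 - c3 * d1) * P 0 + (c4 * d2 - c2 * d4) * R 1) / w + D / w\<^sup>2"
      using wn by (simp add: \<Delta>_def m1_def m2_def n1_def n2_def D_def field_simps power2_eq_square)
    then have "k / cmod w \<le> cmod \<Delta>" using kw(3)[of w] sw s1(3) by simp
    moreover have "k / (max 1 H * s) \<le> k / cmod w"
    proof -
      have "cmod w \<le> max 1 H * s" using H sp mult_right_mono[of H "max 1 H" s] unfolding w_def by linarith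
      then show ?thesis using kw(1) wn sp by (intro divide_left_mono) (auto intro!: mult_pos_pos)
    qed
    ultimately have \<Delta>: "k / (max 1 H * s) \<le> cmod \<Delta>" by simp
    have solve: "cmod t \<le> L * (\<eta> * W + 2 * G) / 2" if "\<Delta> * t = a * e - b * f" "cmod a \<le> \<rho>" "cmod b \<le> \<rho>" "cmod e \<le> 2 * C" "cmod f \<le> 2 * C" for t a b e f
    proof -
      have "k / (max 1 H * s) * cmod t \<le> cmod (\<Delta> * t)"
        unfolding norm_mult using \<Delta> by (rule mult_right_mono) simp
      also have "\<dots> \<le> cmod a * cmod e + cmod b * cmod f"
        unfolding that(1) by (metis norm_mult norm_triangle_ineq4)
      also have "\<dots> \<le> \<rho> * (2 * C) + \<rho> * (2 * C)"
        using that C1 order_trans[OF norm_ge_zero that(2)] by (intro add_mono mult_mono) simp_all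
      finally have "cmod t \<le> 4 * \<rho> * C * (max 1 H * s) / k"
        using kw(1) sp by (simp add: field_simps)
      also have "\<dots> = L * (\<eta> * W + 2 * G) / 2"
        using sp kw(1) by (simp add: L_def \<rho>_def power2_eq_square field_simps)
      finally show ?thesis .
    qed
    have "\<Delta> * u 1 = (m1 * u 1 + n1 * v 0) * n2 - (m2 * u 1 + n2 * v 0) * n1"
      by (simp add: \<Delta>_def algebra_simps)
    then have "p \<le> L * (\<eta> * W + 2 * G) / 2"
      unfolding r1 r2 p_def using b C by (intro solve[of _ "- (c1 * X + c4 * Y)" n2 "- (d1 * X + d4 * Y)" n1] r) auto
    moreover have "\<Delta> * v 0 = (m2 * u 1 + n2 * v 0) * m1 - (m1 * u 1 + n1 * v 0) * m2"
      by (simp add: \<Delta>_def algebra_simps)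
    then have "q \<le> L * (\<eta> * W + 2 * G) / 2"
      unfolding r1 r2 q_def using b C by (intro solve[of _ "- (d1 * X + d4 * Y)" m1 "- (c1 * X + c4 * Y)" m2] r) auto
    ultimately have "p + q \<le> L * \<eta> * W + 2 * L * G" by (simp add: algebra_simps)
    also have "L * \<eta> = 1 / 4" using L by (simp add: \<eta>_def)
    finally have pq: "p + q \<le> W / 4 + 2 * (L * G)" by simp
    have "G / s \<le> G" using divide_left_mono[OF s1(1) G0] sp by simp
    then have "W \<le> 2 * (p + q) + 4 * G" by (simp add: W_def)
    moreover have "2 * (p + q) \<le> W / 2 + 4 * (L * G)" using pq by argo
    ultimately have "W \<le> W / 2 + 4 * (L * G) + 4 * G" by linarith
    then have "W \<le> 8 * (L * G) + 8 * G" by argo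
    also have "\<dots> = K * G" by (simp add: K_def algebra_simps)
    finally show "cmod (u x) \<le> K * G \<and> cmod (v x) \<le> K * G" using W[OF x] by linarith
  qed
qed

section \<open>The space of square-integrable functions\<close>

lemma abs_L2_C2_eqI:
  assumes "square_integrable f" "square_integrable g" "AE x in lebesgue_on {0..1}. f x = g x"
  shows "abs_L2_C2 f = abs_L2_C2 g"
  by (rule Quotient_rel_abs[OF Quotient_L2_C2]) (use assms in \<open>simp add: L2_eq_def\<close>)

lemma L2_C2_cases:
  obtains f where "u = abs_L2_C2 f" "square_integrable f"
  using L2_C2.abs_induct[of "\<lambda>u. \<exists>f. u = abs_L2_C2 f \<and> square_integrable f" u] by (auto simp: L2_eq_def)

lemma abs_L2_C2_cong:
  assumes "square_integrable f" "square_integrable g" "\<And>x. x \<in> {0..1} \<Longrightarrow> f x = g x"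
  shows "abs_L2_C2 f = abs_L2_C2 g"
  using assms by (intro abs_L2_C2_eqI) (auto simp: AE_restrict_space_iff)

lemma abs_L2_C2_eqD:
  assumes "abs_L2_C2 f = abs_L2_C2 g" "square_integrable f" "square_integrable g"
  shows "AE x in lebesgue_on {0..1}. f x = g x"
  using assms Quotient_rel[OF Quotient_L2_C2, of f g] by (simp add: L2_eq_def)

lemma abs_L2_C2_add:
  "square_integrable f \<Longrightarrow> square_integrable g \<Longrightarrow> abs_L2_C2 (\<lambda>x. f x + g x) = abs_L2_C2 f + abs_L2_C2 g"
  by (simp add: plus_L2_C2.abs_eq L2_eq_def)

lemma abs_L2_C2_scaleC:
  "square_integrable f \<Longrightarrow> abs_L2_C2 (\<lambda>x. c *s f x) = scaleC_L2 c (abs_L2_C2 f)"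
  by (simp add: scaleC_L2.abs_eq L2_eq_def)

lemma scaleR_conv_scaleC_L2: "r *\<^sub>R u = scaleC_L2 (of_real r) u"
proof transfer
  fix r and f :: "real \<Rightarrow> complex^2"
  assume "L2_eq f f"
  moreover have "r *\<^sub>R f x = of_real r *s f x" for x
    unfolding vec_eq_iff vector_scaleR_component vector_smult_component by (simp add: scaleR_conv_of_real)
  ultimately show "L2_eq (\<lambda>x. r *\<^sub>R f x) (\<lambda>x. of_real r *s f x)"
    by (simp add: L2_eq_def square_integrable_scaleC)
qed

lemma abs_L2_C2_diff:
  assumes "square_integrable f" "square_integrable g"
  shows "abs_L2_C2 (\<lambda>x. f x - g x) = abs_L2_C2 f - abs_L2_C2 g"
proof -
  have "abs_L2_C2 (\<lambda>x. f x - g x) = abs_L2_C2 (\<lambda>x. f x + (- 1) *s g x)"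
    by (rule arg_cong[of _ _ abs_L2_C2]) (simp add: fun_eq_iff vec_eq_iff)
  also have "\<dots> = abs_L2_C2 f + scaleC_L2 (- 1) (abs_L2_C2 g)"
    unfolding abs_L2_C2_scaleC[OF assms(2), symmetric]
    by (rule abs_L2_C2_add[OF assms(1) square_integrable_scaleC[OF assms(2)]])
  also have "\<dots> = abs_L2_C2 f - abs_L2_C2 g"
    by (metis L2.scale_minus_left L2.scale_one add_uminus_conv_diff)
  finally show ?thesis .
qed

lemma square_integrable_diff:
  assumes "square_integrable f" "square_integrable g"
  shows "square_integrable (\<lambda>x. f x - g x)"
  using square_integrable_add[OF assms(1) square_integrable_scaleR[OF assms(2), of "-1"]] by simp

lemma norm_abs_L2_C2:
  assumes "square_integrable f"
  shows "(norm (abs_L2_C2 f))\<^sup>2 = (LINT x|lebesgue_on {0..1}. (norm (f x))\<^sup>2)"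
  using assms by (simp add: power2_norm_eq_inner inner_L2_C2.abs_eq L2_eq_def)

lemma continuous_square_integrable:
  assumes "continuous_on {0..1} f" shows "square_integrable f"
  unfolding square_integrable_def
proof
  show "f \<in> borel_measurable (lebesgue_on {0..1})"
    using assms by (rule continuous_imp_measurable_on_sets_lebesgue) simp
  show "integrable (lebesgue_on {0..1}) (\<lambda>x. (norm (f x))\<^sup>2)"
    by (intro continuous_imp_integrable_real continuous_intros assms)
qed

lemma norm_abs_L2_C2_le:
  assumes "continuous_on {0..1} f" "\<And>x. x \<in> {0..1} \<Longrightarrow> norm (f x) \<le> C"
  shows "norm (abs_L2_C2 f) \<le> C"
proof -
  have C: "0 \<le> C" using assms(2)[of 0] by (meson atLeastAtMost_iff norm_ge_zero order_refl order_trans zero_le_one)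
  have "(norm (abs_L2_C2 f))\<^sup>2 = integral {0..1} (\<lambda>x. (norm (f x))\<^sup>2)"
    unfolding norm_abs_L2_C2[OF continuous_square_integrable[OF assms(1)]]
    by (intro lebesgue_integral_eq_integral continuous_imp_integrable_real continuous_intros assms) simp
  also have "\<dots> \<le> integral {0..1} (\<lambda>x::real. C\<^sup>2)"
    by (intro integral_le integrable_continuous_interval continuous_intros assms power_mono) auto
  finally show ?thesis using C by (simp add: power2_le_iff_abs_le)
qed

text \<open>Cauchy-Schwarz on an interval of length 1, in the form that the variance of
  \<open>norm (f x)\<close> is not negative.\<close>

lemma integral_norm_le_norm_abs_L2_C2:
  assumes "continuous_on {0..1} f"
  shows "integral {0..1} (\<lambda>x. norm (f x)) \<le> norm (abs_L2_C2 f)"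
proof -
  define I where "I = integral {0..1} (\<lambda>x. norm (f x))"
  have i: "(\<lambda>x. norm (f x)) integrable_on {0..1}" "(\<lambda>x. (norm (f x))\<^sup>2) integrable_on {0..1}"
    by (intro integrable_continuous_interval continuous_intros assms)+
  have "0 \<le> integral {0..1} (\<lambda>x. (norm (f x) - I)\<^sup>2)"
    by (intro integral_nonneg integrable_continuous_interval continuous_intros assms) auto
  also have "(\<lambda>x. (norm (f x) - I)\<^sup>2) = (\<lambda>x. (norm (f x))\<^sup>2 - 2 * I * norm (f x) + I\<^sup>2)"
    by (auto simp: power2_eq_square algebra_simps)
  also have "integral {0..1} \<dots> = integral {0..1} (\<lambda>x. (norm (f x))\<^sup>2) - 2 * I * I + I\<^sup>2"
    using has_integral_add[OF has_integral_diff[OF integrable_integral[OF i(2)]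
        has_integral_mult_right[OF integrable_integral[OF i(1)], of "2 * I"]] has_integral_const_real[of "I\<^sup>2" 0 1]]
    by (simp add: I_def[symmetric] integral_unique)
  also have "integral {0..1} (\<lambda>x. (norm (f x))\<^sup>2) = (norm (abs_L2_C2 f))\<^sup>2"
    unfolding norm_abs_L2_C2[OF continuous_square_integrable[OF assms(1)]]
    by (intro lebesgue_integral_eq_integral[symmetric] continuous_imp_integrable_real continuous_intros assms) simp
  finally have "I\<^sup>2 \<le> (norm (abs_L2_C2 f))\<^sup>2" by (simp add: power2_eq_square)
  then show ?thesis unfolding I_def[symmetric] by (rule power2_le_imp_le) simp
qed

lemma norm_scaleC_L2: "norm (scaleC_L2 c u) = cmod c * norm u"
proof -
  have "(norm (scaleC_L2 c (abs_L2_C2 f)))\<^sup>2 = (cmod c * norm (abs_L2_C2 f))\<^sup>2" if f: "square_integrable f" for f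
    using f by (simp add: norm_abs_L2_C2 square_integrable_scaleC norm_vector_scalar_mult power_mult_distrib
        flip: abs_L2_C2_scaleC)
  moreover obtain f where "u = abs_L2_C2 f" "square_integrable f"
    by (rule L2_C2_cases)
  ultimately have "(norm (scaleC_L2 c u))\<^sup>2 = (cmod c * norm u)\<^sup>2" by simp
  then show ?thesis by (simp only: power2_eq_iff_nonneg norm_ge_zero mult_nonneg_nonneg)
qed

lemma abs_L2_C2_tendsto_dominated:
  assumes f: "square_integrable f" and s: "\<And>n::nat. square_integrable (s n)"
    and lim: "AE x in lebesgue_on {0..1}. (\<lambda>n. s n x) \<longlonglongrightarrow> f x"
    and w: "integrable (lebesgue_on {0..1}) w" "\<And>n. AE x in lebesgue_on {0..1}. (norm (s n x - f x))\<^sup>2 \<le> w x"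
  shows "(\<lambda>n. abs_L2_C2 (s n)) \<longlonglongrightarrow> abs_L2_C2 f"
proof -
  have "(\<lambda>n. LINT x|lebesgue_on {0..1}. (norm (s n x - f x))\<^sup>2) \<longlonglongrightarrow> (LINT x|lebesgue_on {0..1::real}. 0)"
  proof (rule integral_dominated_convergence[where w = w])
    show "(\<lambda>x. (norm (s n x - f x))\<^sup>2) \<in> borel_measurable (lebesgue_on {0..1})" for n
    proof -
      have "(\<lambda>x. s n x - f x) \<in> borel_measurable (lebesgue_on {0..1})"
        using square_integrable_diff[OF s f] by (simp add: square_integrable_def)
      from borel_measurable_power[OF measurable_compose[OF this borel_measurable_norm]] show ?thesis .
    qed
    show "AE x in lebesgue_on {0..1}. (\<lambda>n. (norm (s n x - f x))\<^sup>2) \<longlonglongrightarrow> 0"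
      using lim by eventually_elim (metis LIM_zero tendsto_norm_zero tendsto_null_power zero_less_numeral)
  qed (use w in auto)
  then have "(\<lambda>n. (norm (abs_L2_C2 (s n) - abs_L2_C2 f))\<^sup>2) \<longlonglongrightarrow> 0"
    using f s by (simp add: norm_abs_L2_C2 square_integrable_diff flip: abs_L2_C2_diff)
  then have "(\<lambda>n. sqrt ((norm (abs_L2_C2 (s n) - abs_L2_C2 f))\<^sup>2)) \<longlonglongrightarrow> sqrt 0"
    by (rule tendsto_real_sqrt)
  then have "(\<lambda>n. norm (abs_L2_C2 (s n) - abs_L2_C2 f)) \<longlonglongrightarrow> 0" by simp
  then show ?thesis by (simp only: tendsto_norm_zero_iff LIM_zero_iff)
qed

section \<open>Dense subspaces\<close>

text \<open>Setting \<open>f\<close> to 0 where its norm exceeds \<open>n\<close> changes it by at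
  most \<open>norm (f x)\<close>, so dominated convergence applies.\<close>

lemma closure_bounded_L2_C2:
  "closure {abs_L2_C2 f | f. square_integrable f \<and> (\<exists>K. \<forall>x. norm (f x) \<le> K)} = UNIV"
proof -
  have "u \<in> closure {abs_L2_C2 f | f. square_integrable f \<and> (\<exists>K. \<forall>x. norm (f x) \<le> K)}" for u
  proof -
    obtain f where u: "u = abs_L2_C2 f" and f: "square_integrable f"
      by (rule L2_C2_cases)
    define s where "s = (\<lambda>n x. if norm (f x) \<le> real n then f x else 0)"
    have m: "f \<in> borel_measurable (lebesgue_on {0..1})" using f by (simp add: square_integrable_def)
    have s: "square_integrable (s n)" for n
      unfolding square_integrable_def
    proof
      have "{x \<in> space (lebesgue_on {0..1}). norm (f x) \<le> real n} \<in> sets (lebesgue_on {0..1})"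
        using m by measurable
      then show ms: "s n \<in> borel_measurable (lebesgue_on {0..1})"
        unfolding s_def using m by (intro measurable_If) auto
      show "integrable (lebesgue_on {0..1}) (\<lambda>x. (norm (s n x))\<^sup>2)"
      proof (rule Bochner_Integration.integrable_bound)
        show "integrable (lebesgue_on {0..1}) (\<lambda>x. (norm (f x))\<^sup>2)" using f by (simp add: square_integrable_def)
        show "(\<lambda>x. (norm (s n x))\<^sup>2) \<in> borel_measurable (lebesgue_on {0..1})" using ms by measurable
      qed (auto simp: s_def)
    qed
    have "(\<lambda>n. abs_L2_C2 (s n)) \<longlonglongrightarrow> abs_L2_C2 f"
    proof (rule abs_L2_C2_tendsto_dominated[OF f s])
      show "integrable (lebesgue_on {0..1}) (\<lambda>x. (norm (f x))\<^sup>2)" using f by (simp add: square_integrable_def)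
      have "(\<lambda>n. s n x) \<longlonglongrightarrow> f x" for x
      proof (rule tendsto_eventually)
        show "\<forall>\<^sub>F n in sequentially. s n x = f x"
          using eventually_ge_at_top[of "nat \<lceil>norm (f x)\<rceil>"]
          by eventually_elim (auto simp: s_def nat_le_iff ceiling_le_iff)
      qed
      then show "AE x in lebesgue_on {0..1}. (\<lambda>n. s n x) \<longlonglongrightarrow> f x" by simp
    qed (auto simp: s_def)
    moreover have "abs_L2_C2 (s n) \<in> {abs_L2_C2 f | f. square_integrable f \<and> (\<exists>K. \<forall>x. norm (f x) \<le> K)}" for n
      by (intro CollectI exI[of _ "s n"] conjI s refl exI[of _ "real n"] allI) (simp add: s_def)
    ultimately show ?thesis
      unfolding u closure_sequential by (intro exI[of _ "\<lambda>n. abs_L2_C2 (s n)"] conjI allI)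
  qed
  then show ?thesis by auto
qed

text \<open>A measurable function is an almost everywhere limit of continuous ones. These are moved
  into a fixed ball, which makes a constant a dominating function.\<close>

lemma closure_continuous_L2_C2:
  "closure {abs_L2_C2 f | f. continuous_on {0..1} f} = UNIV"
proof -
  let ?C = "{abs_L2_C2 f | f. continuous_on {0..1} f}"
  have "{abs_L2_C2 f | f. square_integrable f \<and> (\<exists>K. \<forall>x. norm (f x) \<le> K)} \<subseteq> closure ?C"
  proof safe
    fix f :: "real \<Rightarrow> complex^2" and K0 assume f: "square_integrable f" and K0: "\<forall>x. norm (f x) \<le> K0"
    define K where "K = max 1 K0"
    have K: "0 < K" "norm (f x) \<le> K" for x using K0 by (auto simp: K_def le_max_iff_disj)
    have "f measurable_on {0..1}"
      using f by (simp add: measurable_on_iff_borel_measurable square_integrable_def)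
    then obtain N g where N: "negligible N" and g: "\<And>n. continuous_on UNIV (g n)"
      and lim: "\<And>x. x \<notin> N \<Longrightarrow> (\<lambda>n. g n x) \<longlonglongrightarrow> (if x \<in> {0..1} then f x else 0)"
      unfolding measurable_on_def by blast
    \<comment> \<open>The radial retraction to the ball of radius \<open>K\<close>; it fixes the
      values of \<open>f\<close>, so the limit is unchanged.\<close>
    define s where "s = (\<lambda>n x. (K / max K (norm (g n x))) *\<^sub>R g n x)"
    have cs: "continuous_on {0..1} (s n)" for n
      unfolding s_def using K(1)
      by (intro continuous_intros continuous_on_subset[OF g]) auto
    have sK: "norm (s n x) \<le> K" for n x
      using K(1) by (simp add: s_def field_simps)
    have "(\<lambda>n. abs_L2_C2 (s n)) \<longlonglongrightarrow> abs_L2_C2 f"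
    proof (rule abs_L2_C2_tendsto_dominated[OF f continuous_square_integrable[OF cs]])
      show "integrable (lebesgue_on {0..1}) (\<lambda>x::real. (K + K)\<^sup>2)" by (intro continuous_imp_integrable_real continuous_intros)
      show "AE x in lebesgue_on {0..1}. (norm (s n x - f x))\<^sup>2 \<le> (K + K)\<^sup>2" for n
        by (intro AE_I2 power_mono norm_triangle_le_diff add_mono sK K) auto
      have "(\<lambda>n. s n x) \<longlonglongrightarrow> f x" if "x \<in> {0..1}" "x \<notin> N" for x
      proof -
        have "(\<lambda>n. g n x) \<longlonglongrightarrow> f x" using lim[OF that(2)] that(1) by simp
        then have "(\<lambda>n. s n x) \<longlonglongrightarrow> (K / max K (norm (f x))) *\<^sub>R f x"
          unfolding s_def using K(1) by (intro tendsto_intros) auto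
        then show ?thesis using K by (simp add: max_absorb1)
      qed
      moreover have "AE x in lebesgue_on {0..1}. x \<notin> N"
        using AE_not_in[of N lebesgue] N by (auto simp: AE_restrict_space_iff negligible_iff_null_sets elim: eventually_mono)
      moreover have "AE x in lebesgue_on {0..1}. x \<in> {0..1::real}" by (rule AE_I2) simp
      ultimately show "AE x in lebesgue_on {0..1}. (\<lambda>n. s n x) \<longlonglongrightarrow> f x" by (auto elim: eventually_elim2)
    qed
    moreover have "abs_L2_C2 (s n) \<in> ?C" for n using cs by auto
    ultimately show "abs_L2_C2 f \<in> closure ?C"
      unfolding closure_sequential by (intro exI[of _ "\<lambda>n. abs_L2_C2 (s n)"] conjI allI)
  qed
  then have "closure {abs_L2_C2 f | f. square_integrable f \<and> (\<exists>K. \<forall>x. norm (f x) \<le> K)} \<subseteq> closure ?C"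
    by (rule closure_minimal) simp
  then show ?thesis unfolding closure_bounded_L2_C2 by auto
qed

text \<open>Polynomials are made to vanish at both end points by the cut-off \<open>1 - (1 - 2 * x) ^ (2 * n + 2)\<close>,
  which tends to \<open>1\<close> in between.\<close>
lemma closure_C1_vanishing_endpoints_L2_C2:
  "closure {abs_L2_C2 y | y y'. (\<forall>x. (y has_vector_derivative y' x) (at x)) \<and>
     continuous_on UNIV y' \<and> y 0 = 0 \<and> y 1 = 0} = UNIV" (is "closure ?D = UNIV")
proof -
  define P where "P = {abs_L2_C2 p | p. polynomial_function (p :: real \<Rightarrow> complex^2)}"
  have contp: "continuous_on {0..1} p" if "polynomial_function p" for p :: "real \<Rightarrow> complex^2"
    using that by (rule continuous_on_polymonial_function)
  have "{abs_L2_C2 f | f. continuous_on {0..1} f} \<subseteq> closure P"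
  proof safe
    fix f :: "real \<Rightarrow> complex^2" assume f: "continuous_on {0..1} f"
    show "abs_L2_C2 f \<in> closure P"
      unfolding closure_approachable
    proof safe
      fix e :: real assume "0 < e"
      then obtain p where p: "polynomial_function p" "\<And>x. x \<in> {0..1} \<Longrightarrow> norm (f x - p x) < e / 2"
        using Stone_Weierstrass_polynomial_function[OF compact_Icc f, of "e/2"] by auto
      have "norm (abs_L2_C2 (\<lambda>x. f x - p x)) \<le> e / 2"
        by (intro norm_abs_L2_C2_le continuous_intros f contp p less_imp_le)
      then have "dist (abs_L2_C2 p) (abs_L2_C2 f) < e"
        using \<open>0 < e\<close> abs_L2_C2_diff[of f p] f contp[OF p(1)]
        by (simp add: dist_norm norm_minus_commute continuous_square_integrable)
      then show "\<exists>u\<in>P. dist u (abs_L2_C2 f) < e" using p(1) unfolding P_def by blast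
    qed
  qed
  then have "closure {abs_L2_C2 f | f. continuous_on {0..1} f} \<subseteq> closure P"
    by (rule closure_minimal) simp
  then have P: "closure P = UNIV" unfolding closure_continuous_L2_C2 by auto
  have "P \<subseteq> closure ?D"
    unfolding P_def
  proof safe
    fix p :: "real \<Rightarrow> complex^2" assume p: "polynomial_function p"
    obtain p' where p': "polynomial_function p'" "\<And>x. (p has_vector_derivative p' x) (at x)"
      using has_vector_derivative_polynomial_function[OF p] by auto
    define y where "y = (\<lambda>n x. (1 - (1 - 2 * x) ^ (2 * n + 2)) *\<^sub>R p x)"
    define y' where "y' = (\<lambda>n x. (1 - (1 - 2 * x) ^ (2 * n + 2)) *\<^sub>R p' x + (2 * real (2 * n + 2) * (1 - 2 * x) ^ (2 * n + 1)) *\<^sub>R p x)"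
    have der: "(y n has_vector_derivative y' n x) (at x)" for n x
    proof -
      have "((\<lambda>x. 1 - (1 - 2 * x) ^ (2 * n + 2)) has_real_derivative 2 * real (2 * n + 2) * (1 - 2 * x) ^ (2 * n + 1)) (at x)"
      proof -
        have "((\<lambda>x. 1 - (1 - 2 * x) ^ m) has_real_derivative 2 * real m * (1 - 2 * x) ^ (m - 1)) (at x)" for m
          by (auto intro!: derivative_eq_intros)
        from this[of "2 * n + 2"] show ?thesis by simp
      qed
      from has_vector_derivative_scaleR[OF this p'(2)[of x]] show ?thesis
        unfolding y_def y'_def .
    qed
    have cy': "continuous_on UNIV (y' n)" for n
      unfolding y'_def by (intro continuous_intros continuous_on_polymonial_function p p')
    have cy: "continuous_on {0..1} (y n)" for n
      unfolding y_def by (intro continuous_intros continuous_on_polymonial_function p p')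
    have si: "square_integrable p" by (rule continuous_square_integrable[OF contp[OF p]])
    have "(\<lambda>n. abs_L2_C2 (y n)) \<longlonglongrightarrow> abs_L2_C2 p"
    proof (rule abs_L2_C2_tendsto_dominated[OF si continuous_square_integrable[OF cy]])
      show "integrable (lebesgue_on {0..1}) (\<lambda>x. (norm (p x))\<^sup>2)" using si by (simp add: square_integrable_def)
      have "(norm (y n x - p x))\<^sup>2 \<le> (norm (p x))\<^sup>2" if "x \<in> {0..1}" for n x
      proof -
        have "\<bar>1 - 2 * x\<bar> ^ (2 * n + 2) \<le> 1" using that by (intro power_le_one) auto
        then have "\<bar>1 - 2 * x\<bar> ^ (2 * n + 2) * norm (p x) \<le> 1 * norm (p x)" by (rule mult_right_mono) simp
        moreover have "y n x - p x = - ((1 - 2 * x) ^ (2 * n + 2)) *\<^sub>R p x"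
          by (simp add: y_def algebra_simps)
        ultimately show ?thesis by (intro power_mono) (simp_all add: power_abs abs_mult)
      qed
      then show "AE x in lebesgue_on {0..1}. (norm (y n x - p x))\<^sup>2 \<le> (norm (p x))\<^sup>2" for n
        by (intro AE_I2) simp
      have lim: "(\<lambda>n. y n x) \<longlonglongrightarrow> p x" if "x \<in> {0..1}" "x \<notin> {0, 1}" for x
      proof -
        have "(\<lambda>n. ((1 - 2 * x)\<^sup>2) ^ (n + 1)) \<longlonglongrightarrow> 0"
          using that by (intro LIMSEQ_ignore_initial_segment LIMSEQ_power_zero) (auto simp: abs_square_less_1)
        moreover have "((1 - 2 * x)\<^sup>2) ^ (n + 1) = (1 - 2 * x) ^ (2 * n + 2)" for n
          by (metis power_mult distrib_left mult.right_neutral)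
        ultimately have "(\<lambda>n. (1 - 2 * x) ^ (2 * n + 2)) \<longlonglongrightarrow> 0" by simp
        then have "(\<lambda>n. y n x) \<longlonglongrightarrow> (1 - 0) *\<^sub>R p x" unfolding y_def by (intro tendsto_intros)
        then show ?thesis by simp
      qed
      have "negligible {0, 1::real}" by simp
      then have "AE x in lebesgue_on {0..1}. x \<notin> {0, 1::real}"
        using AE_not_in[of "{0, 1}" lebesgue] by (auto simp: AE_restrict_space_iff negligible_iff_null_sets elim: eventually_mono)
      moreover have "AE x in lebesgue_on {0..1}. x \<in> {0..1::real}" by (rule AE_I2) simp
      ultimately show "AE x in lebesgue_on {0..1}. (\<lambda>n. y n x) \<longlonglongrightarrow> p x" using lim by (auto elim: eventually_elim2)
    qed
    moreover have "abs_L2_C2 (y n) \<in> ?D" for n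
    proof -
      have "y n 0 = 0" "y n 1 = 0" by (simp_all add: y_def)
      then show ?thesis
        by (intro CollectI exI[of _ "y n"] exI[of _ "y' n"] conjI allI der cy' refl)
    qed
    ultimately show "abs_L2_C2 p \<in> closure ?D"
      unfolding closure_sequential by (intro exI[of _ "\<lambda>n. abs_L2_C2 (y n)"] conjI allI)
  qed
  then have "closure P \<subseteq> closure ?D" by (rule closure_minimal) simp
  then show ?thesis unfolding P by auto
qed

section \<open>Separation by bounded functionals\<close>

text \<open>The space is not known to be complete, so the functional is obtained as the limit of the
  functionals \<open>\<lambda>h. h \<bullet> (g - v n)\<close> for a minimizing sequence \<open>v\<close> in \<open>V\<close>.\<close>
lemma separating_functional_real_inner:
  fixes V :: "'a::real_inner set"
  assumes V: "subspace V" and g: "g \<notin> closure V"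
  obtains \<phi> where "bounded_linear \<phi>" "\<And>v. v \<in> V \<Longrightarrow> \<phi> v = 0" "\<phi> g \<noteq> (0::real)"
proof -
  define D where "D = Inf ((\<lambda>v. (norm (g - v))\<^sup>2) ` V)"
  have V0: "0 \<in> V" using V by (rule subspace_0)
  have bdd: "bdd_below ((\<lambda>v. (norm (g - v))\<^sup>2) ` V)" by (rule bdd_belowI[of _ 0]) auto
  have D_le: "D \<le> (norm (g - v))\<^sup>2" if "v \<in> V" for v
    unfolding D_def by (rule cInf_lower) (use that bdd in auto)
  obtain e where e: "e > 0" "\<And>v. v \<in> V \<Longrightarrow> e \<le> norm (g - v)"
    using g unfolding closure_approachable by (auto simp: dist_norm norm_minus_commute not_less)
  have D_pos: "0 < D"
  proof -
    have "e\<^sup>2 \<le> D" unfolding D_def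
      by (rule cInf_greatest) (use V0 e in \<open>auto intro!: power_mono\<close>)
    then show ?thesis using e(1) by (meson less_le_trans zero_less_power)
  qed
  have "\<exists>v\<in>V. (norm (g - v))\<^sup>2 < D + 1 / real (Suc n)" for n
    using cInf_lessD[of "(\<lambda>v. (norm (g - v))\<^sup>2) ` V" "D + 1 / real (Suc n)"] V0 unfolding D_def by auto
  then obtain v where v: "\<And>n. v n \<in> V" "\<And>n. (norm (g - v n))\<^sup>2 < D + 1 / real (Suc n)" by metis
  \<comment> \<open>Moving from \<open>v n\<close> along \<open>w\<close> by the optimal
    \<open>t\<close> cannot bring the squared distance below \<open>D\<close>; hence
    \<open>g - v n\<close> is almost orthogonal to \<open>V\<close>.\<close>
  have orth: "(w \<bullet> (g - v n))\<^sup>2 \<le> (norm w)\<^sup>2 / real (Suc n)" if w: "w \<in> V" for w n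
  proof (cases "w = 0")
    case False
    define t where "t = (w \<bullet> (g - v n)) / (norm w)\<^sup>2"
    have "v n + t *\<^sub>R w \<in> V" using V v(1) w by (intro subspace_add subspace_scale)
    then have "D \<le> (norm (g - v n - t *\<^sub>R w))\<^sup>2" using D_le by (metis diff_diff_eq)
    also have "\<dots> = (norm (g - v n))\<^sup>2 - 2 * t * (w \<bullet> (g - v n)) + t\<^sup>2 * (norm w)\<^sup>2"
      unfolding power2_norm_eq_inner by (simp add: inner_diff inner_commute power2_eq_square algebra_simps)
    also have "\<dots> = (norm (g - v n))\<^sup>2 - (w \<bullet> (g - v n))\<^sup>2 / (norm w)\<^sup>2"
      using False by (simp add: t_def field_simps power2_eq_square)
    finally have "(w \<bullet> (g - v n))\<^sup>2 / (norm w)\<^sup>2 \<le> 1 / real (Suc n)" using v(2)[of n] by linarith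
    then have "(w \<bullet> (g - v n))\<^sup>2 \<le> 1 / real (Suc n) * (norm w)\<^sup>2" using False by (subst (asm) pos_divide_le_eq) auto
    then show ?thesis by simp
  qed simp
  \<comment> \<open>The parallelogram identity, with the midpoint of \<open>v m\<close> and
    \<open>v n\<close> as competitor in the minimization.\<close>
  have cauchy_v: "(norm (v m - v n))\<^sup>2 \<le> 2 / real (Suc m) + 2 / real (Suc n)" for m n
  proof -
    have "(1/2) *\<^sub>R (v m + v n) \<in> V" using V v(1) by (intro subspace_add subspace_scale)
    then have "4 * D \<le> 4 * (norm (g - (1/2) *\<^sub>R (v m + v n)))\<^sup>2" using D_le by simp
    also have "\<dots> = 2 * (norm (g - v m))\<^sup>2 + 2 * (norm (g - v n))\<^sup>2 - (norm (v m - v n))\<^sup>2"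
      unfolding power2_norm_eq_inner by (simp add: inner_diff inner_add inner_commute algebra_simps)
    finally show ?thesis using v(2)[of m] v(2)[of n] by simp
  qed
  have conv: "convergent (\<lambda>n. h \<bullet> (g - v n))" for h
  proof (rule real_Cauchy_convergent, rule CauchyI)
    fix \<epsilon> :: real assume "0 < \<epsilon>"
    define c where "c = 4 * ((norm h)\<^sup>2 + 1)"
    obtain N where N: "c / \<epsilon>\<^sup>2 < real N" using reals_Archimedean2 by blast
    have "norm (h \<bullet> (g - v m) - h \<bullet> (g - v n)) < \<epsilon>" if "N \<le> m" "N \<le> n" for m n
    proof -
      have Np: "0 < real N" using N \<open>0 < \<epsilon>\<close> by (intro le_less_trans[OF _ N]) (auto simp: c_def)
      have "2 / real (Suc m) + 2 / real (Suc n) \<le> 2 / real N + 2 / real N"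
        using that Np by (intro add_mono divide_left_mono) auto
      then have vv: "(norm (v m - v n))\<^sup>2 \<le> 4 / real N" using cauchy_v[of m n] by simp
      have "(h \<bullet> (g - v m) - h \<bullet> (g - v n))\<^sup>2 = (h \<bullet> (v n - v m))\<^sup>2" by (simp add: inner_diff)
      also have "\<dots> \<le> (norm h * norm (v n - v m))\<^sup>2"
        using Cauchy_Schwarz_ineq2[of h "v n - v m"] by (metis abs_ge_zero power2_abs power_mono)
      also have "\<dots> \<le> (norm h)\<^sup>2 * (4 / real N)"
        unfolding power_mult_distrib using vv by (intro mult_left_mono) (auto simp: norm_minus_commute)
      also have "\<dots> < c / real N" using Np by (simp add: c_def divide_strict_right_mono)
      also have "\<dots> < \<epsilon>\<^sup>2" using N Np \<open>0 < \<epsilon>\<close> by (simp add: field_simps)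
      finally have "\<bar>h \<bullet> (g - v m) - h \<bullet> (g - v n)\<bar>\<^sup>2 < \<epsilon>\<^sup>2" by (simp only: power2_abs)
      from power_less_imp_less_base[OF this] show ?thesis using \<open>0 < \<epsilon>\<close> by simp
    qed
    then show "\<exists>M. \<forall>m\<ge>M. \<forall>n\<ge>M. norm (h \<bullet> (g - v m) - h \<bullet> (g - v n)) < \<epsilon>" by blast
  qed
  define \<phi> where "\<phi> = (\<lambda>h. lim (\<lambda>n. h \<bullet> (g - v n)))"
  have phi: "(\<lambda>n. h \<bullet> (g - v n)) \<longlonglongrightarrow> \<phi> h" for h
    using conv unfolding \<phi>_def by (simp add: convergent_LIMSEQ_iff)
  define B where "B = sqrt (D + 1)"
  have r_le: "norm (g - v n) \<le> B" for n
  proof -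
    have "1 / real (Suc n) \<le> 1" by simp
    then have "(norm (g - v n))\<^sup>2 \<le> D + 1" using v(2)[of n] by linarith
    then show ?thesis unfolding B_def by (rule real_le_rsqrt)
  qed
  show ?thesis
  proof
    show "bounded_linear \<phi>"
    proof (rule bounded_linear_intro[of _ B])
      show "\<phi> (x + y) = \<phi> x + \<phi> y" for x y
        by (rule LIMSEQ_unique[OF phi]) (use tendsto_add[OF phi[of x] phi[of y]] in \<open>simp add: inner_add\<close>)
      show "\<phi> (r *\<^sub>R x) = r *\<^sub>R \<phi> x" for r x
        by (rule LIMSEQ_unique[OF phi]) (use tendsto_mult_left[OF phi[of x], of r] in simp)
      show "norm (\<phi> x) \<le> norm x * B" for x
      proof (rule tendsto_upperbound[OF tendsto_norm[OF phi]])
        show "\<forall>\<^sub>F n in sequentially. norm (x \<bullet> (g - v n)) \<le> norm x * B"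
          proof (intro always_eventually allI)
            show "norm (x \<bullet> (g - v n)) \<le> norm x * B" for n
              using order_trans[OF Cauchy_Schwarz_ineq2[of x "g - v n"] mult_left_mono[OF r_le norm_ge_zero]] by simp
          qed
      qed simp
    qed
    have lim0: "(\<lambda>n. c / real (Suc n)) \<longlonglongrightarrow> 0" for c :: real
      using LIMSEQ_inverse_real_of_nat tendsto_mult_right_zero[of "\<lambda>n. inverse (real (Suc n))" sequentially c]
      by (simp add: divide_inverse)
    show "\<phi> w = 0" if "w \<in> V" for w
    proof -
      have "(\<lambda>n. (w \<bullet> (g - v n))\<^sup>2) \<longlonglongrightarrow> 0"
        by (rule tendsto_sandwich[OF _ _ tendsto_const lim0[of "(norm w)\<^sup>2"]]) (use orth[OF that] in auto)
      then have "(\<phi> w)\<^sup>2 = 0" using LIMSEQ_unique[OF tendsto_power[OF phi[of w], of 2]] by blast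
      then show ?thesis by simp
    qed
    \<comment> \<open>\<open>g \<bullet> (g - v n)\<close> differs from the squared distance by
      \<open>v n \<bullet> (g - v n)\<close>, which tends to 0 because the \<open>v n\<close> are
      bounded and almost orthogonal to \<open>g - v n\<close>.\<close>
    have "D \<le> \<phi> g"
    proof (rule tendsto_le[OF trivial_limit_sequentially phi])
      define c where "c = (norm g + B)\<^sup>2"
      have "(\<lambda>n. D - sqrt (c / real (Suc n))) \<longlonglongrightarrow> D - sqrt 0"
        by (intro tendsto_intros lim0)
      then show "(\<lambda>n. D - sqrt (c / real (Suc n))) \<longlonglongrightarrow> D" by simp
      have "D - sqrt (c / real (Suc n)) \<le> g \<bullet> (g - v n)" for n
      proof -
        have "norm (v n) \<le> norm g + B" using norm_triangle_ineq4[of g "g - v n"] r_le[of n] by simp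
        then have "(norm (v n))\<^sup>2 \<le> c" unfolding c_def by (rule power_mono) simp
        then have "(v n \<bullet> (g - v n))\<^sup>2 \<le> c / real (Suc n)"
          by (intro order_trans[OF orth[OF v(1)]] divide_right_mono) auto
        then have "\<bar>v n \<bullet> (g - v n)\<bar> \<le> sqrt (c / real (Suc n))"
          by (metis real_sqrt_abs real_sqrt_le_iff)
        moreover have "g \<bullet> (g - v n) = (norm (g - v n))\<^sup>2 + v n \<bullet> (g - v n)"
          by (simp add: power2_norm_eq_inner inner_diff)
        ultimately show ?thesis using D_le[OF v(1), of n] by linarith
      qed
      then show "\<forall>\<^sub>F n in sequentially. D - sqrt (c / real (Suc n)) \<le> g \<bullet> (g - v n)" by simp
    qed
    then show "\<phi> g \<noteq> 0" using D_pos by simp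
  qed
qed

definition bounded_clinear_functional :: "(L2_C2 \<Rightarrow> complex) \<Rightarrow> bool" where
  "bounded_clinear_functional \<psi> \<longleftrightarrow> (\<forall>u v. \<psi> (u + v) = \<psi> u + \<psi> v) \<and>
     (\<forall>c u. \<psi> (scaleC_L2 c u) = c * \<psi> u) \<and> (\<exists>K\<ge>0. \<forall>u. cmod (\<psi> u) \<le> K * norm u)"

text \<open>A real functional \<open>\<phi>\<close> that separates is turned into the complex linear
  one with value \<open>\<phi> u - \<i> * \<phi> (\<i> u)\<close>; it still vanishes on
  \<open>V\<close>, which is stable under multiplication by \<i>.\<close>

lemma separating_functional_L2_C2:
  assumes V: "L2.subspace V" and g: "g \<notin> closure V"
  obtains \<psi> where "bounded_clinear_functional \<psi>" "\<And>v. v \<in> V \<Longrightarrow> \<psi> v = 0" "\<psi> g \<noteq> 0"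
proof -
  have "subspace V"
    using V by (simp add: subspace_def L2.subspace_def scaleR_conv_scaleC_L2)
  then obtain \<phi> where \<phi>: "bounded_linear \<phi>" "\<And>v. v \<in> V \<Longrightarrow> \<phi> v = 0" "\<phi> g \<noteq> (0::real)"
    using separating_functional_real_inner[OF _ g] by blast
  interpret \<phi>: bounded_linear \<phi> by fact
  obtain K where K: "K > 0" "\<And>u. norm (\<phi> u) \<le> norm u * K" using \<phi>.pos_bounded by blast
  define \<psi> where "\<psi> = (\<lambda>u. Complex (\<phi> u) (- \<phi> (scaleC_L2 \<i> u)))"
  have phi_real: "\<phi> (scaleC_L2 (of_real r) u) = r * \<phi> u" for r u
    using \<phi>.scaleR[of r u] by (simp add: scaleR_conv_scaleC_L2)
  have phi_c: "\<phi> (scaleC_L2 c u) = Re c * \<phi> u + Im c * \<phi> (scaleC_L2 \<i> u)" for c u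
  proof -
    have "scaleC_L2 c u = scaleC_L2 (of_real (Re c)) u + scaleC_L2 (of_real (Im c)) (scaleC_L2 \<i> u)"
      by (simp flip: L2.scale_left_distrib add: mult.commute flip: complex_eq)
    then show ?thesis by (simp only: \<phi>.add phi_real)
  qed
  show ?thesis
  proof
    show "bounded_clinear_functional \<psi>"
      unfolding bounded_clinear_functional_def
    proof (intro conjI allI exI[of _ "2 * K"])
      show "\<psi> (u + v) = \<psi> u + \<psi> v" for u v
        by (simp add: \<psi>_def complex_eq_iff \<phi>.add L2.scale_right_distrib)
      show "\<psi> (scaleC_L2 c u) = c * \<psi> u" for c u
        using phi_c[of c u] phi_c[of "\<i> * c" u] by (simp add: \<psi>_def complex_eq_iff mult.commute algebra_simps)
      show "cmod (\<psi> u) \<le> 2 * K * norm u" for u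
      proof -
        have "cmod (\<psi> u) \<le> \<bar>\<phi> u\<bar> + \<bar>\<phi> (scaleC_L2 \<i> u)\<bar>"
          using cmod_le[of "\<psi> u"] by (simp add: \<psi>_def)
        also have "\<dots> \<le> norm u * K + norm u * K"
          using K(2)[of u] K(2)[of "scaleC_L2 \<i> u"] by (intro add_mono) (simp_all add: norm_scaleC_L2)
        finally show ?thesis by (simp add: algebra_simps)
      qed
    qed (use K in simp)
    show "\<psi> v = 0" if "v \<in> V" for v
      using \<phi>(2) that V by (simp add: \<psi>_def L2.subspace_def complex_eq_iff)
    show "\<psi> g \<noteq> 0" using \<phi>(3) by (simp add: \<psi>_def complex_eq_iff)
  qed
qed

section \<open>Finite-dimensional subspaces\<close>

text \<open>One Gram-Schmidt step per generator: of \<open>a\<close>, only the part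
  \<open>va\<close> orthogonal to the previous span is new.\<close>

lemma orthogonal_decomposition_span_finite:
  fixes F :: "'a::real_inner set"
  assumes "finite F"
  shows "\<exists>w v. u = w + v \<and> w \<in> span F \<and> (\<forall>x\<in>span F. x \<bullet> v = 0)"
  using assms
proof (induction F arbitrary: u)
  case empty
  then show ?case by (intro exI[of _ 0] exI[of _ u]) auto
next
  case (insert a F)
  obtain wa va where a: "a = wa + va" "wa \<in> span F" "\<And>x. x \<in> span F \<Longrightarrow> x \<bullet> va = 0" using insert.IH[of a] by blast
  obtain w v where u: "u = w + v" "w \<in> span F" "\<And>x. x \<in> span F \<Longrightarrow> x \<bullet> v = 0" using insert.IH[of u] by blast
  \<comment> \<open>If \<open>va = 0\<close>, division by zero yields \<open>t = 0\<close> and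
    nothing is added.\<close>
  define t where "t = (va \<bullet> v) / (va \<bullet> va)"
  have mono: "x \<in> span (insert a F)" if "x \<in> span F" for x
    using that span_mono[of F "insert a F"] by blast
  have va: "va \<in> span (insert a F)"
    using span_diff[OF span_base[of a "insert a F"] mono[OF a(2)]] a(1) by (simp add: algebra_simps)
  have t: "va \<bullet> (v - t *\<^sub>R va) = 0" by (cases "va = 0") (auto simp: t_def inner_diff)
  have "x \<bullet> (v - t *\<^sub>R va) = 0" if x: "x \<in> span (insert a F)" for x
  proof -
    obtain k where k: "x - k *\<^sub>R a \<in> span F" using x span_breakdown_eq[of x a F] by blast
    have "x \<bullet> (v - t *\<^sub>R va) = (x - k *\<^sub>R a) \<bullet> (v - t *\<^sub>R va) + k * (wa \<bullet> (v - t *\<^sub>R va)) + k * (va \<bullet> (v - t *\<^sub>R va))"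
      by (simp add: inner_diff_left inner_add_left a(1) algebra_simps)
    also have "\<dots> = 0" using u(3)[OF k] a(3)[OF k] u(3)[OF a(2)] a(3)[OF a(2)] t by (simp add: inner_diff_right)
    finally show ?thesis .
  qed
  moreover have "w + t *\<^sub>R va \<in> span (insert a F)"
    by (intro span_add span_scale mono[OF u(2)] va)
  moreover have "u = (w + t *\<^sub>R va) + (v - t *\<^sub>R va)" using u(1) by simp
  ultimately show ?case by blast
qed

text \<open>The component \<open>v\<close> of a limit point orthogonal to the span has inner product
  0 with the limit point, by continuity, and therefore with itself.\<close>

lemma closed_span_finite_real_inner:
  fixes F :: "'a::real_inner set"
  assumes "finite F" shows "closed (span F)"
proof -
  have "u \<in> span F" if u: "u \<in> closure (span F)" for u
  proof -
    obtain w v where uv: "u = w + v" "w \<in> span F" "\<And>x. x \<in> span F \<Longrightarrow> x \<bullet> v = 0"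
      using orthogonal_decomposition_span_finite[OF assms, of u] by blast
    obtain s where s: "\<And>n. s n \<in> span F" "s \<longlonglongrightarrow> u" using u unfolding closure_sequential by blast
    have "(\<lambda>n. s n \<bullet> v) \<longlonglongrightarrow> u \<bullet> v" by (intro tendsto_intros s)
    moreover have "s n \<bullet> v = 0" for n by (rule uv(3)[OF s(1)])
    ultimately have "u \<bullet> v = 0" by (simp add: LIMSEQ_const_iff)
    then have "v \<bullet> v = 0" using uv by (simp add: inner_add_left)
    then show ?thesis using uv by simp
  qed
  then have "closure (span F) = span F" using closure_subset by blast
  then show ?thesis by (simp add: closure_eq)
qed

text \<open>The complex span of \<open>F\<close> is the real span of \<open>F\<close> together with
  its multiples by \<i>, again a finite set of generators.\<close>

lemma closed_L2_span_finite:
  assumes "finite F" shows "closed (L2.span F)"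
proof -
  have "L2.span F = span (F \<union> scaleC_L2 \<i> ` F)" (is "?L = span ?G")
  proof (rule L2.span_unique)
    have iG: "scaleC_L2 \<i> x \<in> span ?G" if "x \<in> span ?G" for x
      using that
    proof (induction rule: span_induct_alt)
      case base then show ?case by (simp add: span_zero)
    next
      case (step c x y)
      have "scaleC_L2 \<i> x \<in> span ?G"
      proof (cases "x \<in> F")
        case True then show ?thesis by (intro span_base) auto
      next
        case False
        then obtain z where "z \<in> F" "x = scaleC_L2 \<i> z" using step by auto
        then have "scaleC_L2 \<i> x = (-1) *\<^sub>R z" by (simp add: scaleR_conv_scaleC_L2)
        then show ?thesis using \<open>z \<in> F\<close> by (metis span_scale span_base UnI1)
      qed
      then have "c *\<^sub>R scaleC_L2 \<i> x + scaleC_L2 \<i> y \<in> span ?G" using step by (intro span_add span_scale)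
      also have "c *\<^sub>R scaleC_L2 \<i> x + scaleC_L2 \<i> y = scaleC_L2 \<i> (c *\<^sub>R x + y)"
        by (simp add: scaleR_conv_scaleC_L2 L2.scale_right_distrib mult.commute)
      finally show ?case .
    qed
    show "F \<subseteq> span ?G" by (rule order_trans[OF Un_upper1 span_superset])
    show "L2.subspace (span ?G)"
      unfolding L2.subspace_def
    proof (intro conjI ballI allI)
      fix c x assume x: "x \<in> span ?G"
      have "scaleC_L2 c x = Re c *\<^sub>R x + Im c *\<^sub>R scaleC_L2 \<i> x"
        by (simp add: scaleR_conv_scaleC_L2 flip: L2.scale_left_distrib) (simp add: mult.commute flip: complex_eq)
      then show "scaleC_L2 c x \<in> span ?G" using x iG by (simp add: span_add span_scale)
    qed (auto simp: span_zero span_add)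
    fix T assume T: "F \<subseteq> T" "L2.subspace T"
    then have "subspace T" by (simp add: subspace_def L2.subspace_def scaleR_conv_scaleC_L2)
    then show "span ?G \<subseteq> T" using T by (intro span_minimal) (auto simp: L2.subspace_def)
  qed
  then show ?thesis using closed_span_finite_real_inner[of ?G] assms by simp
qed

section \<open>Solutions of the Dirac system\<close>

text \<open>Integrating \<open>k * C * exp (2 * k * t)\<close> yields the factor
  \<open>1 / 2\<close>. In the norm weighted by \<open>exp (- 2 * k * t)\<close>, integrating a
  field with Lipschitz constant \<open>k\<close> is therefore a contraction on the whole
  interval.\<close>

lemma exponential_majorant_bound:
  fixes d :: "real \<Rightarrow> 'a::real_normed_vector"
  assumes der: "\<And>t. t \<in> {0..1} \<Longrightarrow> (d has_vector_derivative d' t) (at t within {0..1})"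
    and le: "\<And>t. t \<in> {0..1} \<Longrightarrow> norm (d' t) \<le> k * C * exp (2 * k * t)"
    and C: "0 \<le> C" and x: "x \<in> {0..1}"
  shows "norm (d x - d 0) \<le> C / 2 * exp (2 * k * x)"
proof (cases "x = 0")
  case False
  then have x0: "0 < x" using x by simp
  have "norm (d x - d 0) \<le> C / 2 * exp (2 * k * x) - C / 2 * exp (2 * k * 0)"
  proof (rule differentiable_bound_general[OF x0, where f' = d' and \<phi>' = "\<lambda>t. k * C * exp (2 * k * t)"])
    have "continuous_on {0..1} d"
      by (rule continuous_on_vector_derivative[where f' = d']) (rule der)
    then show "continuous_on {0..x} d" by (rule continuous_on_subset) (use x in auto)
    show "continuous_on {0..x} (\<lambda>t. C / 2 * exp (2 * k * t))" by (intro continuous_intros)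
    fix t assume t: "0 < t" "t < x"
    have "at t within {0..1} = at t" using t x by (intro at_within_interior) auto
    then show "(d has_vector_derivative d' t) (at t)" using der[of t] t x by simp
    show "((\<lambda>t. C / 2 * exp (2 * k * t)) has_vector_derivative k * C * exp (2 * k * t)) (at t)"
      unfolding has_real_derivative_iff_has_vector_derivative[symmetric]
      by (auto intro!: derivative_eq_intros)
    show "norm (d' t) \<le> k * C * exp (2 * k * t)" using le[of t] t x by simp
  qed
  then show ?thesis using C by simp
qed (use C in simp)

text \<open>The maximum \<open>Z\<close> of the weighted norm satisfies
  \<open>Z \<le> norm (y 0) + H + Z / 2\<close>. The inhomogeneity enters only through its
  antiderivative \<open>h\<close>, so an integral norm of it will do.\<close>

lemma gronwall_bound:
  fixes y h :: "real \<Rightarrow> 'a::real_normed_vector"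
  assumes dy: "\<And>t. t \<in> {0..1} \<Longrightarrow> (y has_vector_derivative y' t) (at t within {0..1})"
    and dh: "\<And>t. t \<in> {0..1} \<Longrightarrow> (h has_vector_derivative h' t) (at t within {0..1})"
    and le: "\<And>t. t \<in> {0..1} \<Longrightarrow> norm (y' t - h' t) \<le> k * norm (y t)" and k: "0 < k"
    and h: "h 0 = 0" "\<And>t. t \<in> {0..1} \<Longrightarrow> norm (h t) \<le> H" and x: "x \<in> {0..1}"
  shows "norm (y x) \<le> 2 * (norm (y 0) + H) * exp (2 * k * x)"
proof -
  have cy: "continuous_on {0..1} y"
    by (rule continuous_on_vector_derivative[where f' = y']) (rule dy)
  have "continuous_on {0..1} (\<lambda>t. exp (- (2 * k * t)) * norm (y t))"
    by (intro continuous_intros cy)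
  then obtain m where m: "m \<in> {0..1}"
    "\<And>t. t \<in> {0..1} \<Longrightarrow> exp (- (2 * k * t)) * norm (y t) \<le> exp (- (2 * k * m)) * norm (y m)"
    using continuous_attains_sup[of "{0..1::real}" "\<lambda>t. exp (- (2 * k * t)) * norm (y t)"] by fastforce
  define Z where "Z = exp (- (2 * k * m)) * norm (y m)"
  have yZ: "norm (y t) \<le> Z * exp (2 * k * t)" if "t \<in> {0..1}" for t
    using m(2)[OF that] by (simp add: Z_def exp_minus field_simps)
  have H: "0 \<le> H" using h(2)[OF x] norm_ge_zero order_trans by blast
  have "norm ((y m - h m) - (y 0 - h 0)) \<le> Z / 2 * exp (2 * k * m)"
  proof (rule exponential_majorant_bound[where d = "\<lambda>t. y t - h t" and d' = "\<lambda>t. y' t - h' t"])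
    show "norm (y' t - h' t) \<le> k * Z * exp (2 * k * t)" if "t \<in> {0..1}" for t
      using order_trans[OF le[OF that] mult_left_mono[OF yZ[OF that], of k]] k by (simp add: mult.assoc)
  qed (use m dy dh in \<open>auto simp: Z_def intro!: has_vector_derivative_diff\<close>)
  then have "norm (y m) \<le> norm (y 0) + norm (h m) + Z / 2 * exp (2 * k * m)"
    using norm_triangle_ineq[of "(y m - h m) - (y 0 - h 0)" "y 0 + h m"] norm_triangle_ineq[of "y 0" "h m"] h(1)
    by (simp add: algebra_simps)
  also have "\<dots> \<le> (norm (y 0) + H) * exp (2 * k * m) + Z / 2 * exp (2 * k * m)"
  proof -
    have "(norm (y 0) + H) * 1 \<le> (norm (y 0) + H) * exp (2 * k * m)"
      using k m(1) H by (intro mult_left_mono) auto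
    then show ?thesis using h(2)[OF m(1)] by simp
  qed
  finally have "exp (- (2 * k * m)) * norm (y m) \<le> exp (- (2 * k * m)) * ((norm (y 0) + H + Z / 2) * exp (2 * k * m))"
    by (intro mult_left_mono) (simp_all add: algebra_simps)
  also have "\<dots> = norm (y 0) + H + Z / 2"
    by (simp add: exp_minus)
  finally have "Z \<le> norm (y 0) + H + Z / 2" unfolding Z_def[symmetric] .
  then have "Z \<le> 2 * (norm (y 0) + H)" by simp
  then have "Z * exp (2 * k * x) \<le> 2 * (norm (y 0) + H) * exp (2 * k * x)" by (rule mult_right_mono) simp
  then show ?thesis using yZ[OF x] by linarith
qed

text \<open>The increments of the Picard iterates are halved at each step in the weighted norm; the
  series converges uniformly on \<open>{0..1}\<close> without any continuation argument.\<close>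

lemma picard_lindeloef_global:
  fixes f :: "real \<Rightarrow> 'a::banach \<Rightarrow> 'a"
  assumes lip: "\<And>t v w. t \<in> {0..1} \<Longrightarrow> norm (f t v - f t w) \<le> k * norm (v - w)" and k: "0 < k"
    and cont: "\<And>y. continuous_on {0..1} y \<Longrightarrow> continuous_on {0..1} (\<lambda>t. f t (y t))"
  shows "\<exists>y. y 0 = \<eta> \<and> (\<forall>t\<in>{0..1}. (y has_vector_derivative f t (y t)) (at t within {0..1}))"
proof -
  define Y where "Y = rec_nat (\<lambda>x. \<eta>) (\<lambda>n y x. \<eta> + integral {0..x} (\<lambda>t. f t (y t)))"
  have Y0: "Y 0 = (\<lambda>x. \<eta>)" and YS: "Y (Suc n) = (\<lambda>x. \<eta> + integral {0..x} (\<lambda>t. f t (Y n t)))" for n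
    by (simp_all add: Y_def)
  have der: "((\<lambda>x. \<eta> + integral {0..x} (\<lambda>t. f t (y t))) has_vector_derivative f t (y t)) (at t within {0..1})"
    if "continuous_on {0..1} y" "t \<in> {0..1}" for y t
    using has_vector_derivative_add[OF has_vector_derivative_const[of \<eta>] integral_has_vector_derivative[OF cont[OF that(1)] that(2)]]
    by simp
  have contY: "continuous_on {0..1} (Y n)" for n
  proof (induction n)
    case (Suc n)
    show ?case unfolding YS
      by (rule continuous_on_vector_derivative) (rule der[OF Suc.IH])
  qed (simp add: Y0)
  have Y_init: "Y n 0 = \<eta>" for n by (cases n) (simp_all add: Y0 YS)
  have "bounded ((\<lambda>t. Y 1 t - Y 0 t) ` {0..1})"
    by (intro compact_imp_bounded compact_continuous_image continuous_intros contY compact_Icc)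
  then obtain D where D: "\<And>t. t \<in> {0..1} \<Longrightarrow> norm (Y 1 t - Y 0 t) \<le> D" unfolding bounded_iff by blast
  have D0: "0 \<le> D" using D[of 0] by (meson atLeastAtMost_iff norm_ge_zero order_refl order_trans zero_le_one)
  have diff: "norm (Y (Suc n) t - Y n t) \<le> D * (1/2) ^ n * exp (2 * k * t)" if "t \<in> {0..1}" for n t
    using that
  proof (induction n arbitrary: t)
    case 0
    have "D * 1 \<le> D * exp (2 * k * t)" using 0 k D0 by (intro mult_left_mono) auto
    then show ?case using D[OF 0] by simp
  next
    case (Suc n)
    have "norm ((Y (Suc (Suc n)) t - Y (Suc n) t) - (Y (Suc (Suc n)) 0 - Y (Suc n) 0)) \<le> (D * (1/2) ^ n) / 2 * exp (2 * k * t)"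
    proof (rule exponential_majorant_bound[where d = "\<lambda>t. Y (Suc (Suc n)) t - Y (Suc n) t" and d' = "\<lambda>t. f t (Y (Suc n) t) - f t (Y n t)"])
      show "((\<lambda>t. Y (Suc (Suc n)) t - Y (Suc n) t) has_vector_derivative f t (Y (Suc n) t) - f t (Y n t)) (at t within {0..1})"
        if "t \<in> {0..1}" for t
        using has_vector_derivative_diff[OF der[OF contY[of "Suc n"] that] der[OF contY[of n] that]] by (simp add: YS)
      show "norm (f t (Y (Suc n) t) - f t (Y n t)) \<le> k * (D * (1/2) ^ n) * exp (2 * k * t)" if "t \<in> {0..1}" for t
        using order_trans[OF lip[OF that, of "Y (Suc n) t" "Y n t"] mult_left_mono[OF Suc.IH[OF that], of k]] k by (simp add: mult.assoc)
    qed (use D0 Suc.prems in auto)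
    then show ?case by (simp add: Y_init)
  qed
  define y where "y = (\<lambda>x. \<eta> + (\<Sum>i. Y (Suc i) x - Y i x))"
  have "uniform_limit {0..1} (\<lambda>n x. \<Sum>i<n. Y (Suc i) x - Y i x) (\<lambda>x. \<Sum>i. Y (Suc i) x - Y i x) sequentially"
  proof (rule Weierstrass_m_test)
    show "norm (Y (Suc n) t - Y n t) \<le> D * exp (2 * k) * (1/2) ^ n" if "t \<in> {0..1}" for n t
    proof -
      have "exp (2 * k * t) \<le> exp (2 * k)" using that k by simp
      then have "D * (1/2) ^ n * exp (2 * k * t) \<le> D * (1/2) ^ n * exp (2 * k)" using D0 by (intro mult_left_mono) auto
      then show ?thesis using diff[OF that, of n] by (simp add: algebra_simps)
    qed
    show "summable (\<lambda>n. D * exp (2 * k) * (1/2) ^ n)"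
      by (intro summable_mult summable_geometric) simp
  qed
  moreover have "(\<Sum>i<n. Y (Suc i) x - Y i x) = Y n x - \<eta>" for n x
    using sum_lessThan_telescope[of "\<lambda>i. Y i x" n] by (simp add: Y0)
  ultimately have ul: "uniform_limit {0..1} Y y sequentially"
    by (simp add: uniform_limit_iff y_def dist_norm algebra_simps)
  have conty: "continuous_on {0..1} y"
    by (rule uniform_limit_theorem[OF _ ul]) (simp_all add: contY)
  have "y x = \<eta> + integral {0..x} (\<lambda>t. f t (y t))" if x: "x \<in> {0..1}" for x
  proof (rule LIMSEQ_unique)
    show "(\<lambda>n. Y (Suc n) x) \<longlonglongrightarrow> y x"
      using tendsto_uniform_limitI[OF ul x] by (rule LIMSEQ_Suc)
    show "(\<lambda>n. Y (Suc n) x) \<longlonglongrightarrow> \<eta> + integral {0..x} (\<lambda>t. f t (y t))"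
    proof (rule LIMSEQ_I)
      fix r :: real assume r: "0 < r"
      define e where "e = r / (2 * k)"
      have e: "0 < e" using r k by (simp add: e_def)
      obtain N where N: "\<And>n t. n \<ge> N \<Longrightarrow> t \<in> {0..1} \<Longrightarrow> dist (Y n t) (y t) < e"
        using uniform_limitD[OF ul e] unfolding eventually_sequentially by blast
      have "norm (Y (Suc n) x - (\<eta> + integral {0..x} (\<lambda>t. f t (y t)))) < r" if "n \<ge> N" for n
      proof -
        have c: "continuous_on {0..x} (\<lambda>t. f t (Y n t))" "continuous_on {0..x} (\<lambda>t. f t (y t))"
          using x by (auto intro!: continuous_on_subset[OF cont[OF contY[of n]]] continuous_on_subset[OF cont[OF conty]])
        have "Y (Suc n) x - (\<eta> + integral {0..x} (\<lambda>t. f t (y t))) = integral {0..x} (\<lambda>t. f t (Y n t) - f t (y t))"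
          using c by (simp add: YS integral_diff integrable_continuous_interval)
        also have "norm \<dots> \<le> (k * e) * (x - 0)"
        proof (rule integral_bound)
          show "norm (f t (Y n t) - f t (y t)) \<le> k * e" if "t \<in> {0..x}" for t
            using lip[of t "Y n t" "y t"] N[OF \<open>n \<ge> N\<close>, of t] that x k
            by (smt (verit) atLeastAtMost_iff dist_norm mult_left_mono)
        qed (use x in \<open>auto intro!: continuous_intros c\<close>)
        also have "\<dots> \<le> (k * e) * 1" using x k e by (intro mult_left_mono) auto
        also have "\<dots> < r" using r k by (simp add: e_def)
        finally show ?thesis .
      qed
      then show "\<exists>N. \<forall>n\<ge>N. norm (Y (Suc n) x - (\<eta> + integral {0..x} (\<lambda>t. f t (y t)))) < r" by blast
    qed
  qed
  then have eq: "y x = \<eta> + integral {0..x} (\<lambda>t. f t (y t))" if "x \<in> {0..1}" for x using that by blast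
  have "(y has_vector_derivative f t (y t)) (at t within {0..1})" if "t \<in> {0..1}" for t
    using der[OF conty that] by (rule has_vector_derivative_transform[OF that eq, rotated]) 
  moreover have "y 0 = \<eta>" using eq[of 0] by simp
  ultimately show ?thesis by blast
qed

lemma norm_complex_2_le: "norm (v :: complex^2) \<le> cmod (v $ 1) + cmod (v $ 2)"
  using L2_set_le_sum[of UNIV "\<lambda>i. cmod (v $ i)"] by (simp add: norm_vec_def sum_2)

lemma bounded_linear_vector_smult: "bounded_linear (\<lambda>v::complex^2. c *s v)"
  by (rule bounded_linear_intro[of _ "cmod c"])
    (auto simp: vec_eq_iff algebra_simps norm_vector_scalar_mult)

lemma continuous_on_vector_smult [continuous_intros]:
  fixes f :: "'a::topological_space \<Rightarrow> complex^2"
  shows "continuous_on S f \<Longrightarrow> continuous_on S (\<lambda>x. c *s f x)"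
  by (rule bounded_linear.continuous_on[OF bounded_linear_vector_smult])

lemma vector_smult_has_vector_derivative:
  fixes f :: "real \<Rightarrow> complex^2"
  shows "(f has_vector_derivative f') F \<Longrightarrow> ((\<lambda>x. c *s f x) has_vector_derivative c *s f') F"
  by (rule bounded_linear.has_vector_derivative[OF bounded_linear_vector_smult])

section \<open>Initial value problems for the Dirac system\<close>

locale dirac_system =
  fixes b1 b2 :: real and Q12 Q21 :: "real \<Rightarrow> complex" and a :: "complex^4^2"
  assumes b1: "b1 < 0" and b2: "0 < b2"
    and contQ12: "continuous_on {0..1} Q12" and contQ21: "continuous_on {0..1} Q21"
begin

text \<open>This is \<i> times the inverse of \<open>B\<close>, whose entries are \<open>b1\<close>
  and \<open>b2\<close>, applied to \<open>\<zeta> v - Q v + w\<close>.\<close>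

definition field :: "complex \<Rightarrow> real \<Rightarrow> complex^2 \<Rightarrow> complex^2 \<Rightarrow> complex^2" where
  "field \<zeta> t v w = (\<chi> i. if i = 1 then \<i> * b1 * (\<zeta> * v $ 1 - Q12 t * v $ 2 + w $ 1)
                       else \<i> * b2 * (\<zeta> * v $ 2 - Q21 t * v $ 1 + w $ 2))"

text \<open>\<open>sol \<zeta> g y\<close> is the equation \<open>- \<i> B y' + Q y - \<zeta> y = g\<close>, solved for \<open>y'\<close>.\<close>
definition sol :: "complex \<Rightarrow> (real \<Rightarrow> complex^2) \<Rightarrow> (real \<Rightarrow> complex^2) \<Rightarrow> bool" where
  "sol \<zeta> g y \<longleftrightarrow> (\<forall>t\<in>{0..1}. (y has_vector_derivative field \<zeta> t (y t) (g t)) (at t within {0..1}))"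

definition U :: "2 \<Rightarrow> (real \<Rightarrow> complex^2) \<Rightarrow> complex" where
  "U j y = a $ j $ 1 * y 0 $ 1 + a $ j $ 2 * y 0 $ 2 + a $ j $ 3 * y 1 $ 1 + a $ j $ 4 * y 1 $ 2"

definition \<beta> :: real where "\<beta> = \<bar>b1\<bar> + \<bar>b2\<bar>"

definition Qsup :: real where
  "Qsup = (SOME M. 0 \<le> M \<and> (\<forall>t\<in>{0..1}. cmod (Q12 t) \<le> M \<and> cmod (Q21 t) \<le> M))"

text \<open>A Lipschitz constant of the field; the summand 1 keeps it positive.\<close>

definition \<kappa> :: "complex \<Rightarrow> real" where "\<kappa> \<zeta> = \<beta> * (cmod \<zeta> + Qsup) + 1"

lemma Qsup: "0 \<le> Qsup" "t \<in> {0..1} \<Longrightarrow> cmod (Q12 t) \<le> Qsup" "t \<in> {0..1} \<Longrightarrow> cmod (Q21 t) \<le> Qsup"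
proof -
  obtain M1 where M1: "\<And>t. t \<in> {0..1} \<Longrightarrow> cmod (Q12 t) \<le> M1"
    using compact_imp_bounded[OF compact_continuous_image[OF contQ12 compact_Icc]] unfolding bounded_iff by blast
  obtain M2 where M2: "\<And>t. t \<in> {0..1} \<Longrightarrow> cmod (Q21 t) \<le> M2"
    using compact_imp_bounded[OF compact_continuous_image[OF contQ21 compact_Icc]] unfolding bounded_iff by blast
  have "0 \<le> max 0 (max M1 M2) \<and> (\<forall>t\<in>{0..1}. cmod (Q12 t) \<le> max 0 (max M1 M2) \<and> cmod (Q21 t) \<le> max 0 (max M1 M2))"
    using M1 M2 by (simp add: le_max_iff_disj)
  from someI[where P = "\<lambda>M. 0 \<le> M \<and> (\<forall>t\<in>{0..1}. cmod (Q12 t) \<le> M \<and> cmod (Q21 t) \<le> M)", OF this]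
  show "0 \<le> Qsup" "t \<in> {0..1} \<Longrightarrow> cmod (Q12 t) \<le> Qsup" "t \<in> {0..1} \<Longrightarrow> cmod (Q21 t) \<le> Qsup"
    unfolding Qsup_def by blast+
qed

lemma beta_nonneg: "0 \<le> \<beta>" by (simp add: \<beta>_def)

lemma kappa_pos: "0 < \<kappa> \<zeta>"
  using beta_nonneg Qsup(1) by (simp add: \<kappa>_def add_nonneg_pos)

lemma field_nth [simp]:
  "field \<zeta> t v w $ 1 = \<i> * b1 * (\<zeta> * v $ 1 - Q12 t * v $ 2 + w $ 1)"
  "field \<zeta> t v w $ 2 = \<i> * b2 * (\<zeta> * v $ 2 - Q21 t * v $ 1 + w $ 2)"
  by (simp_all add: field_def)

lemma field_add: "field \<zeta> t (v + v') (w + w') = field \<zeta> t v w + field \<zeta> t v' w'"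
  by (simp add: vec_eq_iff forall_2 algebra_simps)

lemma field_diff: "field \<zeta> t (v - v') (w - w') = field \<zeta> t v w - field \<zeta> t v' w'"
  by (simp add: vec_eq_iff forall_2 algebra_simps)

lemma field_smult: "field \<zeta> t (c *s v) (c *s w) = c *s field \<zeta> t v w"
  by (simp add: vec_eq_iff forall_2 algebra_simps)

lemma field_shift: "field \<zeta> t v w = field \<mu> t v (w + (\<zeta> - \<mu>) *s v)"
  by (simp add: vec_eq_iff forall_2 algebra_simps)

lemma norm_field_le_v:
  assumes "t \<in> {0..1}" shows "norm (field \<zeta> t v 0) \<le> \<kappa> \<zeta> * norm v"
proof -
  have v: "cmod (v $ i) \<le> norm v" for i by (rule Finite_Cartesian_Product.norm_nth_le)
  have "norm (field \<zeta> t v 0) \<le> cmod (field \<zeta> t v 0 $ 1) + cmod (field \<zeta> t v 0 $ 2)"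
    by (rule norm_complex_2_le)
  also have "\<dots> \<le> \<bar>b1\<bar> * (cmod \<zeta> * norm v + Qsup * norm v) + \<bar>b2\<bar> * (cmod \<zeta> * norm v + Qsup * norm v)"
  proof (intro add_mono)
    have "cmod (\<zeta> * v $ 1 - Q12 t * v $ 2) \<le> cmod \<zeta> * cmod (v $ 1) + cmod (Q12 t) * cmod (v $ 2)"
      by (metis norm_mult norm_triangle_ineq4)
    also have "\<dots> \<le> cmod \<zeta> * norm v + Qsup * norm v"
      using Qsup assms v by (intro add_mono mult_mono) auto
    finally show "cmod (field \<zeta> t v 0 $ 1) \<le> \<bar>b1\<bar> * (cmod \<zeta> * norm v + Qsup * norm v)"
      by (simp add: norm_mult mult_left_mono)
    have "cmod (\<zeta> * v $ 2 - Q21 t * v $ 1) \<le> cmod \<zeta> * cmod (v $ 2) + cmod (Q21 t) * cmod (v $ 1)"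
      by (metis norm_mult norm_triangle_ineq4)
    also have "\<dots> \<le> cmod \<zeta> * norm v + Qsup * norm v"
      using Qsup assms v by (intro add_mono mult_mono) auto
    finally show "cmod (field \<zeta> t v 0 $ 2) \<le> \<bar>b2\<bar> * (cmod \<zeta> * norm v + Qsup * norm v)"
      by (simp add: norm_mult mult_left_mono)
  qed
  also have "\<dots> = (\<kappa> \<zeta> - 1) * norm v" by (simp add: \<kappa>_def \<beta>_def algebra_simps)
  also have "\<dots> \<le> \<kappa> \<zeta> * norm v" by (rule mult_right_mono) auto
  finally show ?thesis .
qed

lemma norm_field_le_w: "norm (field \<zeta> t 0 w) \<le> \<beta> * norm w"
proof -
  have v: "cmod (w $ i) \<le> norm w" for i by (rule Finite_Cartesian_Product.norm_nth_le)
  have "norm (field \<zeta> t 0 w) \<le> cmod (field \<zeta> t 0 w $ 1) + cmod (field \<zeta> t 0 w $ 2)"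
    by (rule norm_complex_2_le)
  also have "\<dots> \<le> \<bar>b1\<bar> * norm w + \<bar>b2\<bar> * norm w"
    by (intro add_mono) (simp_all add: norm_mult mult_left_mono v)
  finally show ?thesis by (simp add: \<beta>_def algebra_simps)
qed

lemma continuous_on_field:
  assumes "continuous_on {0..1} y" "continuous_on {0..1} g"
  shows "continuous_on {0..1} (\<lambda>t. field \<zeta> t (y t) (g t))"
proof -
  have "continuous_on {0..1} (\<lambda>t. if i = 1 then \<i> * b1 * (\<zeta> * y t $ 1 - Q12 t * y t $ 2 + g t $ 1)
           else \<i> * b2 * (\<zeta> * y t $ 2 - Q21 t * y t $ 1 + g t $ 2))" for i :: 2
    by (cases "i = 1") (auto intro!: continuous_intros assms contQ12 contQ21)
  then show ?thesis unfolding field_def by (rule continuous_on_vec_lambda)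
qed

lemma sol_continuous: "sol \<zeta> g y \<Longrightarrow> continuous_on {0..1} y"
  by (rule continuous_on_vector_derivative[where f' = "\<lambda>t. field \<zeta> t (y t) (g t)"]) (simp add: sol_def)

lemma sol_add: "sol \<zeta> g y \<Longrightarrow> sol \<zeta> h z \<Longrightarrow> sol \<zeta> (\<lambda>t. g t + h t) (\<lambda>t. y t + z t)"
  by (auto simp: sol_def field_add intro!: has_vector_derivative_add)

lemma sol_diff: "sol \<zeta> g y \<Longrightarrow> sol \<zeta> h z \<Longrightarrow> sol \<zeta> (\<lambda>t. g t - h t) (\<lambda>t. y t - z t)"
  by (auto simp: sol_def field_diff intro!: has_vector_derivative_diff)

lemma sol_smult: "sol \<zeta> g y \<Longrightarrow> sol \<zeta> (\<lambda>t. c *s g t) (\<lambda>t. c *s y t)"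
  by (auto simp: sol_def field_smult intro!: vector_smult_has_vector_derivative)

text \<open>A change of the spectral parameter is absorbed into the inhomogeneity. All resolvent
  identities rest on this.\<close>

lemma sol_shift: "sol \<zeta> g y \<longleftrightarrow> sol \<mu> (\<lambda>t. g t + (\<zeta> - \<mu>) *s y t) y"
  unfolding sol_def field_shift[of \<zeta> _ _ _ \<mu>] ..

lemma sol_zero: "sol \<zeta> (\<lambda>t. 0) (\<lambda>t. 0)"
proof -
  have "field \<zeta> t 0 0 = 0" for t by (simp add: vec_eq_iff forall_2)
  then show ?thesis by (simp add: sol_def)
qed

lemma sol_exists:
  assumes "continuous_on {0..1} g" shows "\<exists>y. y 0 = \<eta> \<and> sol \<zeta> g y"
  unfolding sol_def
proof (rule picard_lindeloef_global)
  show "norm (field \<zeta> t v (g t) - field \<zeta> t w (g t)) \<le> \<kappa> \<zeta> * norm (v - w)" if "t \<in> {0..1}" for t v w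
    using norm_field_le_v[OF that, of \<zeta> "v - w"] field_diff[of \<zeta> t v w "g t" "g t"] by simp
qed (use kappa_pos continuous_on_field assms in auto)

text \<open>The antiderivative of the inhomogeneous part is controlled by the integral of
  \<open>norm (g t)\<close>, hence by the norm of the class of \<open>g\<close>. Functionals of
  solutions thus become continuous in that norm.\<close>

lemma sol_bound:
  assumes s: "sol \<zeta> g y" and g: "continuous_on {0..1} g" and x: "x \<in> {0..1}"
  shows "norm (y x) \<le> 2 * (norm (y 0) + \<beta> * norm (abs_L2_C2 g)) * exp (2 * \<kappa> \<zeta>)"
proof -
  have cg: "continuous_on {0..1} (\<lambda>t. field \<zeta> t 0 (g t))" by (intro continuous_on_field g continuous_intros)
  have nn: "0 \<le> norm (y 0) + \<beta> * norm (abs_L2_C2 g)" using beta_nonneg by simp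
  have "norm (y x) \<le> 2 * (norm (y 0) + \<beta> * norm (abs_L2_C2 g)) * exp (2 * \<kappa> \<zeta> * x)"
  proof (rule gronwall_bound[where y' = "\<lambda>t. field \<zeta> t (y t) (g t)" and h = "\<lambda>t. integral {0..t} (\<lambda>t. field \<zeta> t 0 (g t))" and h' = "\<lambda>t. field \<zeta> t 0 (g t)"])
    show "(y has_vector_derivative field \<zeta> t (y t) (g t)) (at t within {0..1})" if "t \<in> {0..1}" for t
      using s that by (simp add: sol_def)
    show "((\<lambda>t. integral {0..t} (\<lambda>t. field \<zeta> t 0 (g t))) has_vector_derivative field \<zeta> t 0 (g t)) (at t within {0..1})" if "t \<in> {0..1}" for t
      by (rule integral_has_vector_derivative[OF cg that])
    show "norm (field \<zeta> t (y t) (g t) - field \<zeta> t 0 (g t)) \<le> \<kappa> \<zeta> * norm (y t)" if "t \<in> {0..1}" for t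
      using norm_field_le_v[OF that, of \<zeta> "y t"] field_diff[of \<zeta> t "y t" 0 "g t" "g t"] by simp
    show "norm (integral {0..t} (\<lambda>t. field \<zeta> t 0 (g t))) \<le> \<beta> * norm (abs_L2_C2 g)" if t: "t \<in> {0..1}" for t
    proof -
      have i: "(\<lambda>s. \<beta> * norm (g s)) integrable_on {0..1}"
        by (intro integrable_continuous_interval continuous_intros g)
      have "norm (integral {0..t} (\<lambda>t. field \<zeta> t 0 (g t))) \<le> integral {0..t} (\<lambda>s. \<beta> * norm (g s))"
        using t by (intro integral_norm_bound_integral integrable_continuous_interval norm_field_le_w
            continuous_on_subset[OF cg] continuous_on_subset[OF g] continuous_intros) auto
      also have "\<dots> \<le> integral {0..1} (\<lambda>s. \<beta> * norm (g s))"
        using t beta_nonneg i by (intro integral_subset_le integrable_on_subinterval[OF i]) auto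
      also have "\<dots> = \<beta> * integral {0..1} (\<lambda>s. norm (g s))" by simp
      also have "\<dots> \<le> \<beta> * norm (abs_L2_C2 g)"
        by (intro mult_left_mono integral_norm_le_norm_abs_L2_C2 g beta_nonneg)
      finally show ?thesis .
    qed
  qed (use kappa_pos x in auto)
  also have "\<dots> \<le> 2 * (norm (y 0) + \<beta> * norm (abs_L2_C2 g)) * exp (2 * \<kappa> \<zeta>)"
    using x kappa_pos[of \<zeta>] nn by (intro mult_left_mono) auto
  finally show ?thesis .
qed

lemma abs_L2_C2_zero: "abs_L2_C2 (\<lambda>t. 0) = 0"
  by (simp add: zero_L2_C2.abs_eq)

lemma sol_unique:
  assumes "sol \<zeta> g y" "sol \<zeta> g z" "y 0 = z 0" "x \<in> {0..1}"
  shows "y x = z x"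
  using sol_bound[OF sol_diff[OF assms(1,2)] _ assms(4)] assms(3) by (simp add: abs_L2_C2_zero)

text \<open>Only the values on \<open>{0..1}\<close> are determined by the choice. Identities
  between solutions are therefore pointwise there, and pass to functionals by
  \<open>cont_clinear_functional_cong\<close>.\<close>

definition Y :: "complex \<Rightarrow> complex^2 \<Rightarrow> (real \<Rightarrow> complex^2) \<Rightarrow> real \<Rightarrow> complex^2" where
  "Y \<zeta> \<eta> g = (SOME y. y 0 = \<eta> \<and> sol \<zeta> g y)"

lemma Y_initial: "continuous_on {0..1} g \<Longrightarrow> Y \<zeta> \<eta> g 0 = \<eta>"
  and sol_Y: "continuous_on {0..1} g \<Longrightarrow> sol \<zeta> g (Y \<zeta> \<eta> g)"
  using someI_ex[OF sol_exists[of g \<eta> \<zeta>]] by (simp_all add: Y_def)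

lemma continuous_on_Y: "continuous_on {0..1} g \<Longrightarrow> continuous_on {0..1} (Y \<zeta> \<eta> g)"
  using sol_Y sol_continuous by blast

lemma sol_eq_Y:
  assumes "sol \<zeta> g y" "continuous_on {0..1} g" "x \<in> {0..1}"
  shows "y x = Y \<zeta> (y 0) g x"
  by (rule sol_unique[OF assms(1) sol_Y[OF assms(2)] _ assms(3)]) (simp add: Y_initial assms)

lemma norm_Y_le:
  assumes "continuous_on {0..1} g" "x \<in> {0..1}"
  shows "norm (Y \<zeta> \<eta> g x) \<le> 2 * (norm \<eta> + \<beta> * norm (abs_L2_C2 g)) * exp (2 * \<kappa> \<zeta>)"
  using sol_bound[OF sol_Y[OF assms(1)] assms] by (simp add: Y_initial assms)

lemma Y_add:
  assumes "continuous_on {0..1} g" "continuous_on {0..1} h" "x \<in> {0..1}"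
  shows "Y \<zeta> (\<eta> + \<theta>) (\<lambda>t. g t + h t) x = Y \<zeta> \<eta> g x + Y \<zeta> \<theta> h x"
  using sol_eq_Y[OF sol_add[OF sol_Y[OF assms(1), of \<zeta> \<eta>] sol_Y[OF assms(2), of \<zeta> \<theta>]] _ assms(3)] assms
  by (simp add: Y_initial continuous_on_add)

lemma Y_smult:
  assumes "continuous_on {0..1} g" "x \<in> {0..1}"
  shows "Y \<zeta> (c *s \<eta>) (\<lambda>t. c *s g t) x = c *s Y \<zeta> \<eta> g x"
  using sol_eq_Y[OF sol_smult[OF sol_Y[OF assms(1), of \<zeta> \<eta>]] _ assms(2)] assms
  by (simp add: Y_initial continuous_on_vector_smult)

text \<open>Both sides solve the problem with parameter \<zeta>, initial value 0 and inhomogeneity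
  \<open>(\<zeta> - \<mu>) *s Y \<mu> \<eta> g\<close>.\<close>

lemma Y_resolvent_identity:
  assumes g: "continuous_on {0..1} g" and x: "x \<in> {0..1}"
  shows "Y \<zeta> \<eta> g x - Y \<mu> \<eta> g x = (\<zeta> - \<mu>) *s Y \<zeta> 0 (Y \<mu> \<eta> g) x"
proof -
  let ?y = "Y \<mu> \<eta> g"
  have c: "continuous_on {0..1} ?y" by (rule continuous_on_Y[OF g])
  have "sol \<zeta> (\<lambda>t. g t - (\<zeta> - \<mu>) *s ?y t) ?y"
    using sol_Y[OF g, of \<mu> \<eta>] sol_shift[of \<mu> g ?y \<zeta>] by (simp add: vec_eq_iff algebra_simps)
  from sol_diff[OF sol_Y[OF g, of \<zeta> \<eta>] this]
  have "sol \<zeta> (\<lambda>t. (\<zeta> - \<mu>) *s ?y t) (\<lambda>t. Y \<zeta> \<eta> g t - ?y t)" by simp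
  moreover have "sol \<zeta> (\<lambda>t. (\<zeta> - \<mu>) *s ?y t) (\<lambda>t. (\<zeta> - \<mu>) *s Y \<zeta> 0 ?y t)"
    by (rule sol_smult[OF sol_Y[OF c]])
  ultimately show ?thesis
    by (rule sol_unique[OF _ _ _ x]) (simp add: Y_initial g c)
qed

end

section \<open>The characteristic determinant and the resolvent\<close>

text \<open>One notion that covers bounded functionals of the class of \<open>f\<close>, point
  evaluations and the boundary forms \<open>U j\<close>. With it, holomorphy in \<zeta> is stated
  for scalar functions only, and solutions, being continuous, can be inserted directly.\<close>

definition cont_clinear_functional :: "((real \<Rightarrow> complex^2) \<Rightarrow> complex) \<Rightarrow> bool" where
  "cont_clinear_functional \<xi> \<longleftrightarrow>
     (\<forall>f g. continuous_on {0..1} f \<longrightarrow> continuous_on {0..1} g \<longrightarrow> \<xi> (\<lambda>x. f x + g x) = \<xi> f + \<xi> g) \<and>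
     (\<forall>c f. continuous_on {0..1} f \<longrightarrow> \<xi> (\<lambda>x. c *s f x) = c * \<xi> f) \<and>
     (\<exists>K\<ge>0. \<forall>f C. continuous_on {0..1} f \<longrightarrow> (\<forall>x\<in>{0..1}. norm (f x) \<le> C) \<longrightarrow> cmod (\<xi> f) \<le> K * C)"

lemma bounded_clinear_functional_abs:
  assumes "bounded_clinear_functional \<psi>"
  shows "cont_clinear_functional (\<lambda>f. \<psi> (abs_L2_C2 f))"
proof -
  obtain K where K: "0 \<le> K" "\<And>u. cmod (\<psi> u) \<le> K * norm u"
    using assms by (auto simp: bounded_clinear_functional_def)
  have "cmod (\<psi> (abs_L2_C2 f)) \<le> K * C" if "continuous_on {0..1} f" "\<forall>x\<in>{0..1}. norm (f x) \<le> C" for f C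
    using order_trans[OF K(2) mult_left_mono[OF norm_abs_L2_C2_le K(1)]] that by blast
  then show ?thesis
    using assms K(1)
    by (auto simp: cont_clinear_functional_def bounded_clinear_functional_def abs_L2_C2_add abs_L2_C2_scaleC
        continuous_square_integrable)
qed

lemma evaluation_functional:
  assumes "x \<in> {0..1}" shows "cont_clinear_functional (\<lambda>f. f x $ k)"
  unfolding cont_clinear_functional_def
  using assms order_trans[OF Finite_Cartesian_Product.norm_nth_le] by (fastforce intro!: exI[of _ "1::real"])

lemma cont_clinear_functional_add:
  "\<lbrakk>cont_clinear_functional \<xi>; continuous_on {0..1} f; continuous_on {0..1} g\<rbrakk> \<Longrightarrow> \<xi> (\<lambda>x. f x + g x) = \<xi> f + \<xi> g"
  by (simp add: cont_clinear_functional_def)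

lemma cont_clinear_functional_smult:
  "\<lbrakk>cont_clinear_functional \<xi>; continuous_on {0..1} f\<rbrakk> \<Longrightarrow> \<xi> (\<lambda>x. c *s f x) = c * \<xi> f"
  by (simp add: cont_clinear_functional_def)

lemma cont_clinear_functional_bound:
  assumes "cont_clinear_functional \<xi>"
  obtains K where "0 \<le> K" "\<And>f C. \<lbrakk>continuous_on {0..1} f; \<And>x. x \<in> {0..1} \<Longrightarrow> norm (f x) \<le> C\<rbrakk> \<Longrightarrow> cmod (\<xi> f) \<le> K * C"
proof -
  obtain K where "0 \<le> K" "\<forall>f C. continuous_on {0..1} f \<longrightarrow> (\<forall>x\<in>{0..1}. norm (f x) \<le> C) \<longrightarrow> cmod (\<xi> f) \<le> K * C"
    using assms by (auto simp only: cont_clinear_functional_def)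
  then show ?thesis by (intro that[of K]) simp_all
qed

lemma cont_clinear_functional_diff:
  assumes "cont_clinear_functional \<xi>" "continuous_on {0..1} f" "continuous_on {0..1} g"
  shows "\<xi> (\<lambda>x. f x - g x) = \<xi> f - \<xi> g"
proof -
  have "\<xi> (\<lambda>x. (f x - g x) + g x) = \<xi> (\<lambda>x. f x - g x) + \<xi> g"
    by (intro cont_clinear_functional_add continuous_on_diff assms)
  then show ?thesis by simp
qed

text \<open>The bound with \<open>C = 0\<close> shows that only the values on \<open>{0..1}\<close>
  matter.\<close>

lemma cont_clinear_functional_cong:
  assumes "cont_clinear_functional \<xi>" "continuous_on {0..1} f" "continuous_on {0..1} g" "\<And>x. x \<in> {0..1} \<Longrightarrow> f x = g x"
  shows "\<xi> f = \<xi> g"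
proof -
  obtain K where K: "\<And>f C. \<lbrakk>continuous_on {0..1} f; \<And>x. x \<in> {0..1} \<Longrightarrow> norm (f x) \<le> C\<rbrakk> \<Longrightarrow> cmod (\<xi> f) \<le> K * C"
    using cont_clinear_functional_bound[OF assms(1)] by metis
  have "cmod (\<xi> (\<lambda>x. f x - g x)) \<le> K * 0"
    by (rule K) (use assms in \<open>auto intro!: continuous_intros\<close>)
  then show ?thesis using cont_clinear_functional_diff[OF assms(1-3)] by simp
qed

context dirac_system
begin

lemma U_add: "U j (\<lambda>x. f x + g x) = U j f + U j g"
  and U_smult: "U j (\<lambda>x. c *s f x) = c * U j f"
  and U_diff: "U j (\<lambda>x. f x - g x) = U j f - U j g"
  by (simp_all add: U_def algebra_simps)

lemma U_functional: "cont_clinear_functional (U j)"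
  unfolding cont_clinear_functional_def
proof (intro conjI allI impI exI)
  define A where "A = cmod (a $ j $ 1) + cmod (a $ j $ 2) + cmod (a $ j $ 3) + cmod (a $ j $ 4)"
  show "0 \<le> A" by (simp add: A_def)
  fix f :: "real \<Rightarrow> complex^2" and C assume "\<forall>x\<in>{0..1}. norm (f x) \<le> C"
  then have "norm (f 0) \<le> C" "norm (f 1) \<le> C" by simp_all
  then have f: "cmod (f 0 $ k) \<le> C" "cmod (f 1 $ k) \<le> C" for k
    by (auto intro: order_trans[OF Finite_Cartesian_Product.norm_nth_le])
  have "cmod (U j f) \<le> cmod (a $ j $ 1) * cmod (f 0 $ 1) + cmod (a $ j $ 2) * cmod (f 0 $ 2)
      + cmod (a $ j $ 3) * cmod (f 1 $ 1) + cmod (a $ j $ 4) * cmod (f 1 $ 2)"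
  proof -
    have "cmod (p + q + r + s) \<le> cmod p + cmod q + cmod r + cmod s" for p q r s
      using norm_triangle_ineq[of "p + q + r" s] norm_triangle_ineq[of "p + q" r] norm_triangle_ineq[of p q] by linarith
    then show ?thesis unfolding U_def norm_mult[symmetric] .
  qed
  also have "\<dots> \<le> A * C"
    unfolding A_def distrib_right by (intro add_mono mult_left_mono f) auto
  finally show "cmod (U j f) \<le> A * C" .
qed (simp_all add: U_add U_smult)

section \<open>Dependence on the spectral parameter\<close>

lemma functional_Y_resolvent_identity:
  assumes \<xi>: "cont_clinear_functional \<xi>" and g: "continuous_on {0..1} g"
  shows "\<xi> (Y \<zeta> \<eta> g) - \<xi> (Y \<mu> \<eta> g) = (\<zeta> - \<mu>) * \<xi> (Y \<zeta> 0 (Y \<mu> \<eta> g))"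
proof -
  note c = continuous_on_Y
  have "\<xi> (Y \<zeta> \<eta> g) - \<xi> (Y \<mu> \<eta> g) = \<xi> (\<lambda>x. Y \<zeta> \<eta> g x - Y \<mu> \<eta> g x)"
    by (intro cont_clinear_functional_diff[symmetric] \<xi> c g)
  also have "\<dots> = \<xi> (\<lambda>x. (\<zeta> - \<mu>) *s Y \<zeta> 0 (Y \<mu> \<eta> g) x)"
    by (intro cont_clinear_functional_cong \<xi> continuous_intros c g Y_resolvent_identity)
  also have "\<dots> = (\<zeta> - \<mu>) * \<xi> (Y \<zeta> 0 (Y \<mu> \<eta> g))"
    by (intro cont_clinear_functional_smult \<xi> c g)
  finally show ?thesis .
qed

definition E :: "complex \<Rightarrow> real" where "E \<zeta> = exp (2 * \<kappa> \<zeta>)"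

lemma E_eq: "E \<zeta> = exp (2 * (\<beta> * Qsup + 1)) * exp (2 * \<beta> * cmod \<zeta>)"
  by (simp add: E_def \<kappa>_def algebra_simps flip: exp_add)

lemma E_pos: "0 < E \<zeta>" and E_ge_1: "1 \<le> E \<zeta>"
  using kappa_pos[of \<zeta>] by (simp_all add: E_def)

lemma E_mono: "cmod \<zeta> \<le> cmod \<mu> \<Longrightarrow> E \<zeta> \<le> E \<mu>"
  using beta_nonneg by (simp add: E_eq mult_left_mono)

lemma norm_Y_le_E:
  assumes "continuous_on {0..1} g" "x \<in> {0..1}"
  shows "norm (Y \<zeta> \<eta> g x) \<le> 2 * (norm \<eta> + \<beta> * norm (abs_L2_C2 g)) * E \<zeta>"
  using norm_Y_le[OF assms] by (simp add: E_def)

lemma functional_Y_bound: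
  assumes "cont_clinear_functional \<xi>"
  obtains K where "0 \<le> K"
    "\<And>\<zeta> \<eta> g. continuous_on {0..1} g \<Longrightarrow> cmod (\<xi> (Y \<zeta> \<eta> g)) \<le> K * (norm \<eta> + \<beta> * norm (abs_L2_C2 g)) * E \<zeta>"
proof -
  obtain K where K: "0 \<le> K" "\<And>f C. \<lbrakk>continuous_on {0..1} f; \<And>x. x \<in> {0..1} \<Longrightarrow> norm (f x) \<le> C\<rbrakk> \<Longrightarrow> cmod (\<xi> f) \<le> K * C"
    using cont_clinear_functional_bound[OF assms] by metis
  have "cmod (\<xi> (Y \<zeta> \<eta> g)) \<le> (K * 2) * (norm \<eta> + \<beta> * norm (abs_L2_C2 g)) * E \<zeta>" if "continuous_on {0..1} g" for \<zeta> \<eta> g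
    using K(2)[OF continuous_on_Y[OF that] norm_Y_le_E[OF that]] by (simp add: mult.assoc)
  then show ?thesis using K(1) by (intro that[of "K * 2"]) auto
qed

text \<open>The resolvent identity computes the difference quotient. Applied once more, it shows
  that this quotient differs from its limit by at most \<open>cmod (\<zeta> - \<mu>) * L\<close>
  near \<mu>.\<close>

lemma functional_Y_has_field_derivative:
  assumes \<xi>: "cont_clinear_functional \<xi>" and g: "continuous_on {0..1} g"
  shows "((\<lambda>\<zeta>. \<xi> (Y \<zeta> \<eta> g)) has_field_derivative \<xi> (Y \<mu> 0 (Y \<mu> \<eta> g))) (at \<mu>)"
proof -
  note c = continuous_on_Y
  obtain K where K: "0 \<le> K" "\<And>\<zeta> \<eta> g. continuous_on {0..1} g \<Longrightarrow> cmod (\<xi> (Y \<zeta> \<eta> g)) \<le> K * (norm \<eta> + \<beta> * norm (abs_L2_C2 g)) * E \<zeta>"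
    using functional_Y_bound[OF \<xi>] by metis
  define h where "h = Y \<mu> 0 (Y \<mu> \<eta> g)"
  have ch: "continuous_on {0..1} h" unfolding h_def by (intro c g)
  define L where "L = K * (\<beta> * norm (abs_L2_C2 h)) * E (of_real (cmod \<mu> + 1))"
  have L: "0 \<le> L" using K(1) beta_nonneg E_pos by (simp add: L_def less_imp_le)
  have bound: "cmod (\<xi> (Y \<zeta> 0 (Y \<mu> \<eta> g)) - \<xi> h) \<le> cmod (\<zeta> - \<mu>) * L" if "cmod (\<zeta> - \<mu>) < 1" for \<zeta>
  proof -
    have "cmod \<zeta> \<le> cmod (complex_of_real (cmod \<mu> + 1))"
      using that norm_triangle_ineq2[of \<zeta> \<mu>] by (simp only: norm_of_real)
    then have "E \<zeta> \<le> E (of_real (cmod \<mu> + 1))" by (rule E_mono)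
    then have "cmod (\<xi> (Y \<zeta> 0 h)) \<le> L"
      using order_trans[OF K(2)[OF ch, of \<zeta> 0]] K(1) beta_nonneg unfolding L_def by (simp add: mult_left_mono)
    then show ?thesis
      unfolding h_def functional_Y_resolvent_identity[OF \<xi> c[OF g]] norm_mult by (intro mult_left_mono) auto
  qed
  have "((\<lambda>\<zeta>. \<xi> (Y \<zeta> 0 (Y \<mu> \<eta> g)) - \<xi> h) \<longlongrightarrow> 0) (at \<mu>)"
  proof (rule Lim_null_comparison)
    have "\<forall>\<^sub>F \<zeta> in at \<mu>. \<zeta> \<in> ball \<mu> 1" by (rule eventually_at_in_open') auto
    then show "\<forall>\<^sub>F \<zeta> in at \<mu>. norm (\<xi> (Y \<zeta> 0 (Y \<mu> \<eta> g)) - \<xi> h) \<le> cmod (\<zeta> - \<mu>) * L"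
      by eventually_elim (use bound in \<open>auto simp: dist_norm norm_minus_commute\<close>)
    have "((\<lambda>\<zeta>. cmod (\<zeta> - \<mu>) * L) \<longlongrightarrow> cmod (\<mu> - \<mu>) * L) (at \<mu>)" by (intro tendsto_intros)
    then show "((\<lambda>\<zeta>. cmod (\<zeta> - \<mu>) * L) \<longlongrightarrow> 0) (at \<mu>)" by simp
  qed
  then have "((\<lambda>\<zeta>. \<xi> (Y \<zeta> 0 (Y \<mu> \<eta> g))) \<longlongrightarrow> \<xi> h) (at \<mu>)" by (simp add: LIM_zero_iff)
  then show ?thesis
    unfolding has_field_derivative_iff h_def
    by (rule Lim_transform_eventually)
      (auto simp: eventually_at_filter functional_Y_resolvent_identity[OF \<xi> g] intro!: always_eventually)
qed

lemma functional_Y_holomorphic: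
  assumes "cont_clinear_functional \<xi>" "continuous_on {0..1} g"
  shows "(\<lambda>\<zeta>. \<xi> (Y \<zeta> \<eta> g)) holomorphic_on S"
  using functional_Y_has_field_derivative[OF assms]
  by (meson holomorphic_onI field_differentiable_at_within field_differentiable_def)

section \<open>Characteristic matrix, Cramer's rule and resolvent\<close>

definition Phi :: "2 \<Rightarrow> complex \<Rightarrow> real \<Rightarrow> complex^2" where
  "Phi k \<zeta> = Y \<zeta> (axis k 1) (\<lambda>_. 0)"

definition Mat :: "2 \<Rightarrow> 2 \<Rightarrow> complex \<Rightarrow> complex" where
  "Mat j k \<zeta> = U j (Phi k \<zeta>)"

definition Del :: "complex \<Rightarrow> complex" where
  "Del \<zeta> = Mat 1 1 \<zeta> * Mat 2 2 \<zeta> - Mat 1 2 \<zeta> * Mat 2 1 \<zeta>"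

text \<open>The columns of the adjugate of the characteristic matrix are the initial values of solutions
  that violate only one of the two boundary conditions.\<close>
definition adj_col :: "2 \<Rightarrow> complex \<Rightarrow> complex^2" where
  "adj_col j \<zeta> = (if j = 1 then vector [Mat 2 2 \<zeta>, - Mat 2 1 \<zeta>] else vector [- Mat 1 2 \<zeta>, Mat 1 1 \<zeta>])"

definition W :: "2 \<Rightarrow> complex \<Rightarrow> real \<Rightarrow> complex^2" where
  "W j \<zeta> = Y \<zeta> (adj_col j \<zeta>) (\<lambda>_. 0)"

lemma continuous_on_Phi: "continuous_on {0..1} (Phi k \<zeta>)"
  and continuous_on_W: "continuous_on {0..1} (W k \<zeta>)"
  unfolding Phi_def W_def by (intro continuous_on_Y continuous_on_const)+

lemma Y_homogeneous_eq:
  assumes "x \<in> {0..1}"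
  shows "Y \<zeta> \<eta> (\<lambda>_. 0) x = \<eta> $ 1 *s Phi 1 \<zeta> x + \<eta> $ 2 *s Phi 2 \<zeta> x"
proof -
  have "\<eta> = \<eta> $ 1 *s axis 1 1 + \<eta> $ 2 *s axis 2 1"
    by (simp add: vec_eq_iff forall_2 axis_def)
  then have "Y \<zeta> \<eta> (\<lambda>_. 0) x = Y \<zeta> (\<eta> $ 1 *s axis 1 1 + \<eta> $ 2 *s axis 2 1) (\<lambda>_. 0 + 0) x" by simp
  also have "\<dots> = Y \<zeta> (\<eta> $ 1 *s axis 1 1) (\<lambda>_. \<eta> $ 1 *s 0) x + Y \<zeta> (\<eta> $ 2 *s axis 2 1) (\<lambda>_. \<eta> $ 2 *s 0) x"
    by (subst Y_add) (use assms in auto)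
  also have "\<dots> = \<eta> $ 1 *s Phi 1 \<zeta> x + \<eta> $ 2 *s Phi 2 \<zeta> x"
    unfolding Phi_def by (subst (1 2) Y_smult) (use assms in auto)
  finally show ?thesis .
qed

lemma functional_Y_homogeneous:
  assumes "cont_clinear_functional \<xi>"
  shows "\<xi> (Y \<zeta> \<eta> (\<lambda>_. 0)) = \<eta> $ 1 * \<xi> (Phi 1 \<zeta>) + \<eta> $ 2 * \<xi> (Phi 2 \<zeta>)"
proof -
  have "\<xi> (Y \<zeta> \<eta> (\<lambda>_. 0)) = \<xi> (\<lambda>x. \<eta> $ 1 *s Phi 1 \<zeta> x + \<eta> $ 2 *s Phi 2 \<zeta> x)"
    by (intro cont_clinear_functional_cong[OF assms] continuous_on_Y continuous_intros continuous_on_Phi Y_homogeneous_eq)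
  then show ?thesis
    by (simp add: cont_clinear_functional_add[OF assms] cont_clinear_functional_smult[OF assms] continuous_on_Phi continuous_on_vector_smult)
qed

lemma functional_W:
  assumes "cont_clinear_functional \<xi>"
  shows "\<xi> (W j \<zeta>) = adj_col j \<zeta> $ 1 * \<xi> (Phi 1 \<zeta>) + adj_col j \<zeta> $ 2 * \<xi> (Phi 2 \<zeta>)"
  unfolding W_def by (rule functional_Y_homogeneous[OF assms])

text \<open>The characteristic matrix times its adjugate is \<open>Del\<close> times the
  identity.\<close>

lemma U_W: "U i (W j \<zeta>) = (if i = j then Del \<zeta> else 0)"
proof -
  have "U i (W j \<zeta>) = adj_col j \<zeta> $ 1 * Mat i 1 \<zeta> + adj_col j \<zeta> $ 2 * Mat i 2 \<zeta>"
    unfolding Mat_def by (rule functional_W[OF U_functional])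
  moreover have "i = 1 \<or> i = 2" "j = 1 \<or> j = 2" using exhaust_2 by auto
  ultimately show ?thesis by (auto simp: adj_col_def Del_def)
qed

lemma functional_Phi_holomorphic:
  "cont_clinear_functional \<xi> \<Longrightarrow> (\<lambda>\<zeta>. \<xi> (Phi k \<zeta>)) holomorphic_on S"
  unfolding Phi_def by (intro functional_Y_holomorphic continuous_on_const)

lemma Mat_holomorphic: "Mat j k holomorphic_on S"
proof -
  have "(\<lambda>\<zeta>. U j (Phi k \<zeta>)) holomorphic_on S" by (intro functional_Phi_holomorphic U_functional)
  then show ?thesis by (simp add: Mat_def[abs_def])
qed

lemma adj_col_holomorphic: "(\<lambda>\<zeta>. adj_col j \<zeta> $ k) holomorphic_on S"
proof -
  have "j = 1 \<or> j = 2" "k = 1 \<or> k = 2" using exhaust_2 by auto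
  then show ?thesis by (auto simp: adj_col_def intro!: holomorphic_intros Mat_holomorphic)
qed

lemma Del_holomorphic: "Del holomorphic_on S"
  unfolding Del_def[abs_def] by (intro holomorphic_intros Mat_holomorphic)

lemma functional_W_holomorphic:
  "cont_clinear_functional \<xi> \<Longrightarrow> (\<lambda>\<zeta>. \<xi> (W j \<zeta>)) holomorphic_on S"
  unfolding functional_W by (intro holomorphic_intros functional_Phi_holomorphic adj_col_holomorphic)

lemma functional_Phi_bound:
  assumes "cont_clinear_functional \<xi>"
  obtains K where "0 \<le> K" "\<And>k \<zeta>. cmod (\<xi> (Phi k \<zeta>)) \<le> K * E \<zeta>"
proof -
  obtain K where K: "0 \<le> K" "\<And>\<zeta> \<eta> g. continuous_on {0..1} g \<Longrightarrow> cmod (\<xi> (Y \<zeta> \<eta> g)) \<le> K * (norm \<eta> + \<beta> * norm (abs_L2_C2 g)) * E \<zeta>"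
    using functional_Y_bound[OF assms] by metis
  have "cmod (\<xi> (Phi k \<zeta>)) \<le> K * E \<zeta>" for k \<zeta>
    using K(2)[of "\<lambda>_. 0" \<zeta> "axis k 1"] by (simp add: Phi_def abs_L2_C2_zero)
  then show ?thesis using K(1) that by blast
qed

lemma adj_col_bound:
  obtains K where "0 \<le> K" "\<And>j k \<zeta>. cmod (Mat j k \<zeta>) \<le> K * E \<zeta>" "\<And>j k \<zeta>. cmod (adj_col j \<zeta> $ k) \<le> K * E \<zeta>"
proof -
  obtain K1 where K1: "0 \<le> K1" "\<And>k \<zeta>. cmod (U 1 (Phi k \<zeta>)) \<le> K1 * E \<zeta>"
    using functional_Phi_bound[OF U_functional] by metis
  obtain K2 where K2: "0 \<le> K2" "\<And>k \<zeta>. cmod (U 2 (Phi k \<zeta>)) \<le> K2 * E \<zeta>"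
    using functional_Phi_bound[OF U_functional] by metis
  have M: "cmod (Mat j k \<zeta>) \<le> (K1 + K2) * E \<zeta>" for j k \<zeta>
  proof -
    have "j = 1 \<or> j = 2" using exhaust_2 by auto
    moreover have "0 \<le> K1 * E \<zeta>" "0 \<le> K2 * E \<zeta>" using K1(1) K2(1) E_pos[of \<zeta>] by auto
    ultimately show ?thesis unfolding Mat_def distrib_right using K1(2)[of k \<zeta>] K2(2)[of k \<zeta>] by auto
  qed
  have "cmod (adj_col j \<zeta> $ k) \<le> (K1 + K2) * E \<zeta>" for j k \<zeta>
  proof -
    have "j = 1 \<or> j = 2" "k = 1 \<or> k = 2" using exhaust_2 by auto
    then show ?thesis by (auto simp: adj_col_def M)
  qed
  then show ?thesis using M K1(1) K2(1) by (intro that[of "K1 + K2"]) auto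
qed

lemma functional_W_bound:
  assumes \<xi>: "cont_clinear_functional \<xi>"
  obtains K where "0 \<le> K" "\<And>j \<zeta>. cmod (\<xi> (W j \<zeta>)) \<le> K * (E \<zeta>)\<^sup>2"
proof -
  obtain A where A: "0 \<le> A" "\<And>j k \<zeta>. cmod (adj_col j \<zeta> $ k) \<le> A * E \<zeta>" using adj_col_bound by metis
  obtain K where K: "0 \<le> K" "\<And>k \<zeta>. cmod (\<xi> (Phi k \<zeta>)) \<le> K * E \<zeta>" using functional_Phi_bound[OF \<xi>] by metis
  have "cmod (\<xi> (W j \<zeta>)) \<le> (2 * A * K) * (E \<zeta>)\<^sup>2" for j \<zeta>
  proof -
    have "cmod (\<xi> (W j \<zeta>)) \<le> cmod (adj_col j \<zeta> $ 1) * cmod (\<xi> (Phi 1 \<zeta>)) + cmod (adj_col j \<zeta> $ 2) * cmod (\<xi> (Phi 2 \<zeta>))"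
      unfolding functional_W[OF \<xi>] by (metis norm_mult norm_triangle_ineq)
    also have "\<dots> \<le> (A * E \<zeta>) * (K * E \<zeta>) + (A * E \<zeta>) * (K * E \<zeta>)"
      using A K E_pos[of \<zeta>] by (intro add_mono mult_mono) auto
    finally show ?thesis by (simp add: power2_eq_square algebra_simps)
  qed
  then show ?thesis using A(1) K(1) by (intro that[of "2 * A * K"]) auto
qed

lemma Del_bound:
  obtains K where "0 \<le> K" "\<And>\<zeta>. cmod (Del \<zeta>) \<le> K * (E \<zeta>)\<^sup>2"
  using functional_W_bound[OF U_functional[of 1]] U_W[of 1 1] by metis

text \<open>Subtracting the multiples of \<open>W 1\<close> and \<open>W 2\<close> corrects the two
  boundary values separately. Where \<open>Del \<zeta> = 0\<close>, the quotients are 0 by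
  convention and \<open>R \<zeta> g\<close> is just \<open>Y \<zeta> 0 g\<close>.\<close>

definition R :: "complex \<Rightarrow> (real \<Rightarrow> complex^2) \<Rightarrow> real \<Rightarrow> complex^2" where
  "R \<zeta> g = (\<lambda>x. Y \<zeta> 0 g x - ((U 1 (Y \<zeta> 0 g) / Del \<zeta>) *s W 1 \<zeta> x + (U 2 (Y \<zeta> 0 g) / Del \<zeta>) *s W 2 \<zeta> x))"

lemma continuous_on_R: "continuous_on {0..1} g \<Longrightarrow> continuous_on {0..1} (R \<zeta> g)"
  unfolding R_def by (intro continuous_intros continuous_on_Y continuous_on_W)

lemma sol_R:
  assumes g: "continuous_on {0..1} g" shows "sol \<zeta> g (R \<zeta> g)"
proof -
  have W: "sol \<zeta> (\<lambda>_. 0) (W j \<zeta>)" for j unfolding W_def by (rule sol_Y) simp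
  have "sol \<zeta> (\<lambda>x. g x - (c1 *s 0 + c2 *s 0)) (\<lambda>x. Y \<zeta> 0 g x - (c1 *s W 1 \<zeta> x + c2 *s W 2 \<zeta> x))" for c1 c2
    by (intro sol_diff sol_add sol_smult W sol_Y g)
  then show ?thesis unfolding R_def by (simp add: vec.scale_zero_right)
qed

lemma U_R:
  assumes "Del \<zeta> \<noteq> 0" shows "U j (R \<zeta> g) = 0"
proof -
  have "j = 1 \<or> j = 2" using exhaust_2 by auto
  then show ?thesis using assms by (auto simp: R_def U_diff U_add U_smult U_W)
qed

lemma homogeneous_unique:
  assumes "Del \<zeta> \<noteq> 0" "sol \<zeta> (\<lambda>_. 0) z" "\<And>j. U j z = 0" "x \<in> {0..1}"
  shows "z x = 0"
proof -
  have z: "z t = Y \<zeta> (z 0) (\<lambda>_. 0) t" if "t \<in> {0..1}" for t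
    by (rule sol_eq_Y[OF assms(2) _ that]) simp
  have "U j z = z 0 $ 1 * Mat j 1 \<zeta> + z 0 $ 2 * Mat j 2 \<zeta>" for j
  proof -
    have "U j z = U j (Y \<zeta> (z 0) (\<lambda>_. 0))"
      using z[of 0] z[of 1] by (simp add: U_def)
    then show ?thesis unfolding Mat_def by (simp only: functional_Y_homogeneous[OF U_functional])
  qed
  then have e: "z 0 $ 1 * Mat 1 1 \<zeta> + z 0 $ 2 * Mat 1 2 \<zeta> = 0" "z 0 $ 1 * Mat 2 1 \<zeta> + z 0 $ 2 * Mat 2 2 \<zeta> = 0"
    using assms(3) by metis+
  have "z 0 $ 1 * Del \<zeta> = (z 0 $ 1 * Mat 1 1 \<zeta> + z 0 $ 2 * Mat 1 2 \<zeta>) * Mat 2 2 \<zeta> - (z 0 $ 1 * Mat 2 1 \<zeta> + z 0 $ 2 * Mat 2 2 \<zeta>) * Mat 1 2 \<zeta>"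
    "z 0 $ 2 * Del \<zeta> = (z 0 $ 1 * Mat 2 1 \<zeta> + z 0 $ 2 * Mat 2 2 \<zeta>) * Mat 1 1 \<zeta> - (z 0 $ 1 * Mat 1 1 \<zeta> + z 0 $ 2 * Mat 1 2 \<zeta>) * Mat 2 1 \<zeta>"
    by (simp_all add: Del_def algebra_simps)
  then have "z 0 = 0" using assms(1) unfolding e by (simp add: vec_eq_iff forall_2)
  then show ?thesis using z[OF assms(4)] Y_homogeneous_eq[OF assms(4), of \<zeta> "z 0"] by simp
qed

text \<open>A nonzero column of the adjugate is the initial value of an eigenfunction. If the
  adjugate is zero, so is the characteristic matrix, and every solution satisfies the boundary
  conditions.\<close>

lemma Del_zero_imp_eigenfunction:
  assumes "Del \<zeta> = 0"
  obtains z where "sol \<zeta> (\<lambda>_. 0) z" "\<And>j. U j z = 0" "z 0 \<noteq> 0"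
proof (cases "adj_col 1 \<zeta> = 0 \<and> adj_col 2 \<zeta> = 0")
  case True
  then have "Mat 2 2 \<zeta> = 0" "Mat 2 1 \<zeta> = 0" "Mat 1 2 \<zeta> = 0" "Mat 1 1 \<zeta> = 0"
    by (auto simp: adj_col_def vec_eq_iff forall_2)
  then have "U j (Phi 1 \<zeta>) = 0" for j
    using exhaust_2[of j] by (auto simp: Mat_def)
  moreover have "sol \<zeta> (\<lambda>_. 0) (Phi 1 \<zeta>)" "Phi 1 \<zeta> 0 \<noteq> 0"
    unfolding Phi_def by (simp_all add: sol_Y Y_initial axis_eq_0_iff)
  ultimately show ?thesis using that by blast
next
  case False
  then obtain k where k: "adj_col k \<zeta> \<noteq> 0" by blast
  have "sol \<zeta> (\<lambda>_. 0) (W k \<zeta>)" "W k \<zeta> 0 \<noteq> 0" "U j (W k \<zeta>) = 0" for j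
    using k assms U_W[of j k \<zeta>] unfolding W_def by (simp_all add: sol_Y Y_initial)
  then show ?thesis using that by blast
qed

lemma R_unique:
  assumes "Del \<zeta> \<noteq> 0" "sol \<zeta> g y" "\<And>j. U j y = 0" "continuous_on {0..1} g" "x \<in> {0..1}"
  shows "y x = R \<zeta> g x"
proof -
  have "sol \<zeta> (\<lambda>_. 0) (\<lambda>x. y x - R \<zeta> g x)"
    using sol_diff[OF assms(2) sol_R[OF assms(4), of \<zeta>]] by simp
  then have "y x - R \<zeta> g x = 0"
    by (rule homogeneous_unique[OF assms(1) _ _ assms(5)]) (simp add: U_diff assms(1,3) U_R)
  then show ?thesis by simp
qed

lemma functional_R:
  assumes "cont_clinear_functional \<xi>" "continuous_on {0..1} g"
  shows "\<xi> (R \<zeta> g) = \<xi> (Y \<zeta> 0 g) - (U 1 (Y \<zeta> 0 g) * \<xi> (W 1 \<zeta>) + U 2 (Y \<zeta> 0 g) * \<xi> (W 2 \<zeta>)) / Del \<zeta>"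
  unfolding R_def using assms(2)
  by (simp add: cont_clinear_functional_diff[OF assms(1)] cont_clinear_functional_add[OF assms(1)]
      cont_clinear_functional_smult[OF assms(1)] continuous_on_W continuous_on_Y continuous_on_vector_smult continuous_on_add add_divide_distrib)

text \<open>The growth in \<zeta> is crude, one factor \<open>E\<close> from \<open>Y\<close> and
  two from \<open>W\<close>, but \<open>g\<close> enters through the norm of its class. It serves at
  a fixed point and on circles; along the rays a bound in the supremum norm takes over.\<close>

lemma functional_R_bound:
  assumes \<xi>: "cont_clinear_functional \<xi>"
  obtains K where "0 \<le> K" "\<And>\<zeta> g. \<lbrakk>continuous_on {0..1} g; Del \<zeta> \<noteq> 0\<rbrakk> \<Longrightarrow>
     cmod (\<xi> (R \<zeta> g)) \<le> K * (E \<zeta>)^3 * (1 + 1 / cmod (Del \<zeta>)) * norm (abs_L2_C2 g)"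
proof -
  obtain K1 where K1: "0 \<le> K1" "\<And>\<zeta> \<eta> g. continuous_on {0..1} g \<Longrightarrow> cmod (\<xi> (Y \<zeta> \<eta> g)) \<le> K1 * (norm \<eta> + \<beta> * norm (abs_L2_C2 g)) * E \<zeta>"
    using functional_Y_bound[OF \<xi>] by metis
  obtain K2 where K2: "0 \<le> K2" "\<And>\<zeta> \<eta> g. continuous_on {0..1} g \<Longrightarrow> cmod (U 1 (Y \<zeta> \<eta> g)) \<le> K2 * (norm \<eta> + \<beta> * norm (abs_L2_C2 g)) * E \<zeta>"
    using functional_Y_bound[OF U_functional[of 1]] by metis
  obtain K3 where K3: "0 \<le> K3" "\<And>\<zeta> \<eta> g. continuous_on {0..1} g \<Longrightarrow> cmod (U 2 (Y \<zeta> \<eta> g)) \<le> K3 * (norm \<eta> + \<beta> * norm (abs_L2_C2 g)) * E \<zeta>"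
    using functional_Y_bound[OF U_functional[of 2]] by metis
  obtain K4 where K4: "0 \<le> K4" "\<And>j \<zeta>. cmod (\<xi> (W j \<zeta>)) \<le> K4 * (E \<zeta>)\<^sup>2"
    using functional_W_bound[OF \<xi>] by metis
  define K where "K = (K1 + (K2 + K3) * K4) * \<beta>"
  have K: "0 \<le> K" using K1(1) K2(1) K3(1) K4(1) beta_nonneg by (simp add: K_def)
  have "cmod (\<xi> (R \<zeta> g)) \<le> K * (E \<zeta>)^3 * (1 + 1 / cmod (Del \<zeta>)) * norm (abs_L2_C2 g)"
    if g: "continuous_on {0..1} g" and d: "Del \<zeta> \<noteq> 0" for \<zeta> g
  proof -
    define N where "N = \<beta> * norm (abs_L2_C2 g)"
    have N: "0 \<le> N" using beta_nonneg by (simp add: N_def)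
    have e: "0 \<le> E \<zeta>" "1 \<le> E \<zeta>" using E_pos[of \<zeta>] E_ge_1 by auto
    have "E \<zeta> \<le> (E \<zeta>) ^ 3" using e(2) self_le_power[of "E \<zeta>" 3] by simp
    then have y: "cmod (\<xi> (Y \<zeta> 0 g)) \<le> K1 * N * (E \<zeta>) ^ 3"
      using K1(2)[OF g, of \<zeta> 0] mult_left_mono[of "E \<zeta>" "(E \<zeta>)^3" "K1 * N"] K1(1) N by (simp add: N_def)
    have "cmod (U 1 (Y \<zeta> 0 g) * \<xi> (W 1 \<zeta>) + U 2 (Y \<zeta> 0 g) * \<xi> (W 2 \<zeta>)) \<le>
        cmod (U 1 (Y \<zeta> 0 g)) * cmod (\<xi> (W 1 \<zeta>)) + cmod (U 2 (Y \<zeta> 0 g)) * cmod (\<xi> (W 2 \<zeta>))"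
      by (metis norm_mult norm_triangle_ineq)
    also have "\<dots> \<le> (K2 * N * E \<zeta>) * (K4 * (E \<zeta>)\<^sup>2) + (K3 * N * E \<zeta>) * (K4 * (E \<zeta>)\<^sup>2)"
      using K2(2)[OF g, of \<zeta> 0] K3(2)[OF g, of \<zeta> 0] K4(2) K2(1) K3(1) N e
      by (intro add_mono mult_mono) (auto simp: N_def)
    also have "\<dots> = (K2 + K3) * K4 * N * (E \<zeta>) ^ 3"
      by (simp add: power2_eq_square power3_eq_cube algebra_simps)
    finally have w: "cmod (U 1 (Y \<zeta> 0 g) * \<xi> (W 1 \<zeta>) + U 2 (Y \<zeta> 0 g) * \<xi> (W 2 \<zeta>)) \<le> (K2 + K3) * K4 * N * (E \<zeta>) ^ 3" .
    have "cmod (\<xi> (R \<zeta> g)) \<le> K1 * N * (E \<zeta>) ^ 3 + (K2 + K3) * K4 * N * (E \<zeta>) ^ 3 / cmod (Del \<zeta>)"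
      unfolding functional_R[OF \<xi> g] using y w
      by (intro order_trans[OF norm_triangle_ineq4] add_mono) (auto simp: norm_divide divide_right_mono)
    also have "\<dots> \<le> (K1 + (K2 + K3) * K4) * N * (E \<zeta>)^3 + (K1 + (K2 + K3) * K4) * N * (E \<zeta>)^3 / cmod (Del \<zeta>)"
      using K1(1) K2(1) K3(1) K4(1) N e by (intro add_mono divide_right_mono mult_right_mono) auto
    also have "\<dots> = K * (E \<zeta>)^3 * (1 + 1 / cmod (Del \<zeta>)) * norm (abs_L2_C2 g)"
      by (simp add: K_def N_def algebra_simps add_divide_distrib)
    finally show ?thesis .
  qed
  then show ?thesis using K that by blast
qed

end

section \<open>The differential operator and the resolvent estimate\<close>

lemma J_eq: "J a j k = a $ 1 $ j * a $ 2 $ k - a $ 1 $ k * a $ 2 $ j"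
  by (simp add: J_def det_2)

lemma square_integrable_bounded_linear:
  assumes A: "bounded_linear (A :: complex^2 \<Rightarrow> complex^2)" and f: "square_integrable f"
  shows "square_integrable (\<lambda>x. A (f x))"
proof -
  obtain K where K: "0 < K" "\<And>v. norm (A v) \<le> norm v * K" using bounded_linear.pos_bounded[OF A] by blast
  have fm: "f \<in> borel_measurable (lebesgue_on {0..1})" using f by (simp add: square_integrable_def)
  have m: "(\<lambda>x. A (f x)) \<in> borel_measurable (lebesgue_on {0..1})"
    using measurable_compose[OF fm borel_measurable_continuous_onI[OF linear_continuous_on[OF A]]] .
  show ?thesis
    unfolding square_integrable_def
  proof
    show "integrable (lebesgue_on {0..1}) (\<lambda>x. (norm (A (f x)))\<^sup>2)"
    proof (rule Bochner_Integration.integrable_bound)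
      show "integrable (lebesgue_on {0..1}) (\<lambda>x. K\<^sup>2 * (norm (f x))\<^sup>2)"
        using f by (simp add: square_integrable_def)
      show "(\<lambda>x. (norm (A (f x)))\<^sup>2) \<in> borel_measurable (lebesgue_on {0..1})"
        using borel_measurable_power[OF measurable_compose[OF m borel_measurable_norm]] .
      have "(norm (A v))\<^sup>2 \<le> K\<^sup>2 * (norm v)\<^sup>2" for v
        using power_mono[OF K(2)[of v] norm_ge_zero, of 2] by (simp add: power_mult_distrib mult.commute)
      then show "AE x in lebesgue_on {0..1}. norm ((norm (A (f x)))\<^sup>2) \<le> norm (K\<^sup>2 * (norm (f x))\<^sup>2)"
        by (simp add: abs_mult)
    qed
  qed (rule m)
qed

lemma square_integrable_imp_integrable:
  assumes f: "square_integrable f" shows "integrable (lebesgue_on {0..1}) f"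
proof (rule Bochner_Integration.integrable_bound)
  show "integrable (lebesgue_on {0..1}) (\<lambda>x. 1 + (norm (f x))\<^sup>2)"
  proof (rule Bochner_Integration.integrable_add)
    show "integrable (lebesgue_on {0..1}) (\<lambda>x::real. 1::real)"
      by (intro continuous_imp_integrable_real continuous_on_const)
  qed (use f in \<open>simp add: square_integrable_def\<close>)
  show "f \<in> borel_measurable (lebesgue_on {0..1})" using f by (simp add: square_integrable_def)
  have "r \<le> 1 + r\<^sup>2" for r :: real
    using zero_le_power2[of "r - 1/2"] by (simp add: power2_eq_square algebra_simps)
  then show "AE x in lebesgue_on {0..1}. norm (f x) \<le> norm (1 + (norm (f x))\<^sup>2)" by simp
qed

lemma lebesgue_integral_continuous_on:
  fixes f :: "real \<Rightarrow> complex^2"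
  assumes "continuous_on {0..1} f" "x \<in> {0..1}"
  shows "(LINT t|lebesgue_on {0..x}. f t) = integral {0..x} f"
  using assms by (intro lebesgue_integral_eq_integral continuous_imp_integrable_real continuous_on_subset[OF assms(1)]) auto

section \<open>The operator and its chains of root functions\<close>

context dirac_system
begin

abbreviation T :: L2_operator where
  "T \<equiv> L_op (matB b1 b2) (matQ Q12 Q21) (matC a) (matD a)"

lemma matrix_field_iff:
  "(- \<i>) *s (matB b1 b2 *v v') + matQ Q12 Q21 t *v v = z \<longleftrightarrow> v' = field 0 t v z"
proof -
  have c: "- \<i> * (inverse B * p) + q = r \<longleftrightarrow> p = \<i> * B * (r - q)" if "B \<noteq> 0" for B p q r :: complex
  proof -
    have "- \<i> * (inverse B * p) + q = r \<longleftrightarrow> - \<i> * (inverse B * p) = r - q"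
      by (simp only: eq_diff_eq)
    also have "\<dots> \<longleftrightarrow> \<i> * B * (- \<i> * (inverse B * p)) = \<i> * B * (r - q)"
      using that by (simp only: mult_cancel_left mult_eq_0_iff) simp
    also have "\<i> * B * (- \<i> * (inverse B * p)) = - (\<i> * \<i>) * (B * inverse B) * p"
      by (simp only: mult.assoc mult.left_commute mult_minus_left mult_minus_right)
    also have "\<dots> = p"
      using that by simp
    finally show ?thesis .
  qed
  note c1 = c[of "of_real b1"] and c2 = c[of "of_real b2"]
  show ?thesis
    using c1[of "v' $ 1" "Q12 t * v $ 2" "z $ 1"] c2[of "v' $ 2" "Q21 t * v $ 1" "z $ 2"] b1 b2
    by (simp add: vec_eq_iff forall_2 matB_def matQ_def matrix_vector_mult_def sum_2)
qed

lemma boundary_condition_iff: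
  "matC a *v y 0 + matD a *v y 1 = 0 \<longleftrightarrow> (\<forall>j. U j y = 0)"
  by (simp add: vec_eq_iff forall_2 matC_def matD_def matrix_vector_mult_def sum_2 U_def add.assoc)

lemma sol_in_operator:
  assumes s: "sol 0 z y" and z: "continuous_on {0..1} z" and u: "\<And>j. U j y = 0"
  shows "(abs_L2_C2 y, abs_L2_C2 z) \<in> T"
proof -
  define y' where "y' = (\<lambda>t. field 0 t (y t) (z t))"
  have cy': "continuous_on {0..1} y'" unfolding y'_def by (rule continuous_on_field[OF sol_continuous[OF s] z])
  have "y x = y 0 + (LINT t|lebesgue_on {0..x}. y' t)" if x: "x \<in> {0..1}" for x
  proof -
    have "(y' has_integral y x - y 0) {0..x}"
    proof (rule fundamental_theorem_of_calculus)
      show "(y has_vector_derivative y' t) (at t within {0..x})" if "t \<in> {0..x}" for t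
        using s that x has_vector_derivative_within_subset[of y "y' t" t "{0..1}" "{0..x}"]
        by (auto simp: sol_def y'_def)
    qed (use x in simp)
    then show ?thesis using lebesgue_integral_continuous_on[OF cy' x] by (simp add: integral_unique)
  qed
  then have "W12 y y'" unfolding W12_def using continuous_square_integrable[OF cy'] by blast
  moreover have eq: "(- \<i>) *s (matB b1 b2 *v y' x) + matQ Q12 Q21 x *v y x = z x" for x
    by (simp only: matrix_field_iff y'_def)
  then have "abs_L2_C2 z = abs_L2_C2 (\<lambda>x. (- \<i>) *s (matB b1 b2 *v y' x) + matQ Q12 Q21 x *v y x)" by simp
  moreover have "matC a *v y 0 + matD a *v y 1 = 0" unfolding boundary_condition_iff using u by blast
  ultimately show ?thesis unfolding L_op_def by blast
qed

text \<open>If the image has a continuous representative \<open>z\<close>, the weak derivative of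
  \<open>y\<close> agrees almost everywhere with the continuous function
  \<open>field 0 t (y t) (z t)\<close>; as \<open>y\<close> is an integral of it, \<open>y\<close>
  is a classical solution.\<close>

lemma operator_imp_sol:
  assumes "(u, v) \<in> T"
  obtains y where "continuous_on {0..1} y" "u = abs_L2_C2 y" "\<And>j. U j y = 0"
    "\<And>z. \<lbrakk>continuous_on {0..1} z; v = abs_L2_C2 z\<rbrakk> \<Longrightarrow> sol 0 z y"
proof -
  have "\<exists>y y'. (u, v) = (abs_L2_C2 y, abs_L2_C2 (\<lambda>x. (- \<i>) *s (matB b1 b2 *v y' x) + matQ Q12 Q21 x *v y x)) \<and>
      W12 y y' \<and> matC a *v y 0 + matD a *v y 1 = 0"
    using assms unfolding L_op_def mem_Collect_eq .
  then obtain y y' where uv: "(u, v) = (abs_L2_C2 y, abs_L2_C2 (\<lambda>x. (- \<i>) *s (matB b1 b2 *v y' x) + matQ Q12 Q21 x *v y x))"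
    and w: "W12 y y'" and bc: "matC a *v y 0 + matD a *v y 1 = 0"
    by (elim exE conjE)
  have u: "u = abs_L2_C2 y" and v: "v = abs_L2_C2 (\<lambda>x. (- \<i>) *s (matB b1 b2 *v y' x) + matQ Q12 Q21 x *v y x)"
    using uv by (simp_all only: prod.inject)
  have si': "square_integrable y'" and y_eq: "\<And>x. x \<in> {0..1} \<Longrightarrow> y x = y 0 + (LINT t|lebesgue_on {0..x}. y' t)"
    using w unfolding W12_def by blast+
  have int: "integrable (lebesgue_on {0..1}) y'" by (rule square_integrable_imp_integrable[OF si'])
  have "continuous_on {0..1} (\<lambda>x. y 0 + (LINT t|lebesgue_on {0..x}. y' t))"
    by (intro continuous_on_add continuous_on_const indefinite_integral_continuous_real int)
  then have cy: "continuous_on {0..1} y" by (rule continuous_on_eq) (rule y_eq[symmetric])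
  have si: "square_integrable (\<lambda>x. (- \<i>) *s (matB b1 b2 *v y' x) + matQ Q12 Q21 x *v y x)"
  proof (rule square_integrable_add)
    have "bounded_linear (\<lambda>w. (- \<i>) *s (matB b1 b2 *v w))"
      by (rule bounded_linear_compose[OF bounded_linear_vector_smult])
        (auto intro!: linearI simp: linear_conv_bounded_linear[symmetric] vec_eq_iff matrix_vector_mult_def
          sum_2 algebra_simps)
    then show "square_integrable (\<lambda>x. (- \<i>) *s (matB b1 b2 *v y' x))"
      using si' by (rule square_integrable_bounded_linear)
    have "continuous_on {0..1} (\<lambda>x. if i = 1 then Q12 x * y x $ 2 else Q21 x * y x $ 1)" for i :: 2
      by (cases "i = 1") (auto intro!: continuous_intros cy contQ12 contQ21)
    then have "continuous_on {0..1} (\<lambda>x. (\<chi> i. if i = 1 then Q12 x * y x $ 2 else Q21 x * y x $ 1) :: complex^2)"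
      by (rule continuous_on_vec_lambda)
    moreover have "(\<lambda>x. matQ Q12 Q21 x *v y x) = (\<lambda>x. \<chi> i::2. if i = 1 then Q12 x * y x $ 2 else Q21 x * y x $ 1)"
      by (simp add: fun_eq_iff vec_eq_iff forall_2 matQ_def matrix_vector_mult_def sum_2)
    ultimately show "square_integrable (\<lambda>x. matQ Q12 Q21 x *v y x)"
      by (simp add: continuous_square_integrable)
  qed
  have "sol 0 z y" if z: "continuous_on {0..1} z" "v = abs_L2_C2 z" for z
  proof -
    define f where "f = (\<lambda>t. field 0 t (y t) (z t))"
    have cf: "continuous_on {0..1} f" unfolding f_def by (rule continuous_on_field[OF cy z(1)])
    have "AE x in lebesgue_on {0..1}. (- \<i>) *s (matB b1 b2 *v y' x) + matQ Q12 Q21 x *v y x = z x"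
      using abs_L2_C2_eqD[OF _ si continuous_square_integrable[OF z(1)]] v z(2) by simp
    then have ae: "AE x in lebesgue_on {0..1}. y' x = f x" by (simp only: matrix_field_iff f_def)
    have eq: "y x = y 0 + integral {0..x} f" if x: "x \<in> {0..1}" for x
    proof -
      have sub: "{0..x} \<subseteq> {0..1}" using x by auto
      have "(LINT t|lebesgue_on {0..x}. y' t) = (LINT t|lebesgue_on {0..x}. f t)"
      proof (rule integral_cong_AE)
        show "y' \<in> borel_measurable (lebesgue_on {0..x})"
          using si' measurable_restrict_mono[OF _ sub] by (auto simp: square_integrable_def)
        show "f \<in> borel_measurable (lebesgue_on {0..x})"
          by (rule continuous_imp_measurable_on_sets_lebesgue[OF continuous_on_subset[OF cf sub]]) simp
        show "AE t in lebesgue_on {0..x}. y' t = f t"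
          using ae sub by (auto simp: AE_restrict_space_iff elim!: eventually_mono)
      qed
      then show ?thesis using y_eq[OF x] lebesgue_integral_continuous_on[OF cf x] by simp
    qed
    show ?thesis
      unfolding sol_def
    proof
      fix t :: real assume t: "t \<in> {0..1}"
      have "((\<lambda>x. y 0 + integral {0..x} f) has_vector_derivative 0 + f t) (at t within {0..1})"
        by (intro has_vector_derivative_add has_vector_derivative_const integral_has_vector_derivative cf t)
      then have "((\<lambda>x. y 0 + integral {0..x} f) has_vector_derivative f t) (at t within {0..1})" by simp
      then have "(y has_vector_derivative f t) (at t within {0..1})"
        by (rule has_vector_derivative_transform[OF t eq, rotated])
      then show "(y has_vector_derivative field 0 t (y t) (z t)) (at t within {0..1})" by (simp add: f_def)
    qed
  qed
  then show ?thesis using that[OF cy u _] bc by (simp add: boundary_condition_iff)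
qed

lemma shift_op_continuous_iff:
  assumes z: "continuous_on {0..1} z"
  shows "(u, abs_L2_C2 z) \<in> shift_op T \<mu> \<longleftrightarrow> (\<exists>y. sol \<mu> z y \<and> (\<forall>j. U j y = 0) \<and> u = abs_L2_C2 y)"
proof
  assume "(u, abs_L2_C2 z) \<in> shift_op T \<mu>"
  then obtain v where v: "(u, v) \<in> T" "abs_L2_C2 z = v - scaleC_L2 \<mu> u"
    unfolding shift_op_def by blast
  obtain y where y: "continuous_on {0..1} y" "u = abs_L2_C2 y" "\<And>j. U j y = 0"
    "\<And>z. \<lbrakk>continuous_on {0..1} z; v = abs_L2_C2 z\<rbrakk> \<Longrightarrow> sol 0 z y"
    using operator_imp_sol[OF v(1)] by blast
  have "v = abs_L2_C2 (\<lambda>t. z t + \<mu> *s y t)"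
    using v(2) y(1,2) z
    by (simp add: abs_L2_C2_add abs_L2_C2_scaleC continuous_square_integrable square_integrable_scaleC algebra_simps)
  then have "sol 0 (\<lambda>t. z t + \<mu> *s y t) y" by (intro y(4) continuous_intros z y(1))
  then have "sol \<mu> z y" using sol_shift[of \<mu> z y 0] by simp
  then show "\<exists>y. sol \<mu> z y \<and> (\<forall>j. U j y = 0) \<and> u = abs_L2_C2 y" using y by blast
next
  assume "\<exists>y. sol \<mu> z y \<and> (\<forall>j. U j y = 0) \<and> u = abs_L2_C2 y"
  then obtain y where y: "sol \<mu> z y" "\<And>j. U j y = 0" "u = abs_L2_C2 y" by blast
  have cy: "continuous_on {0..1} y" by (rule sol_continuous[OF y(1)])
  have "(abs_L2_C2 y, abs_L2_C2 (\<lambda>t. z t + \<mu> *s y t)) \<in> T"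
    using sol_shift[of \<mu> z y 0] y z cy by (intro sol_in_operator continuous_intros) auto
  moreover have "abs_L2_C2 z = abs_L2_C2 (\<lambda>t. z t + \<mu> *s y t) - scaleC_L2 \<mu> u"
    using cy z by (simp add: y(3) abs_L2_C2_add abs_L2_C2_scaleC continuous_square_integrable square_integrable_scaleC)
  ultimately show "(u, abs_L2_C2 z) \<in> shift_op T \<mu>" unfolding shift_op_def y(3) by blast
qed

text \<open>The kernel of the \<open>k\<close>-th power of \<open>L - \<mu>\<close> in terms of
  genuine functions instead of classes. Its members solve differential equations, so they can be
  evaluated at the end points and fed into \<open>Y\<close> and \<open>R\<close>.\<close>

primrec chain :: "complex \<Rightarrow> nat \<Rightarrow> (real \<Rightarrow> complex^2) \<Rightarrow> bool" where
  "chain \<mu> 0 y \<longleftrightarrow> y = (\<lambda>_. 0)"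
| "chain \<mu> (Suc k) y \<longleftrightarrow> (\<exists>z. chain \<mu> k z \<and> sol \<mu> z y \<and> (\<forall>j. U j y = 0))"

lemma chain_continuous: "chain \<mu> k y \<Longrightarrow> continuous_on {0..1} y"
  by (cases k) (auto intro: sol_continuous)

text \<open>The induction peels off the first application of the operator. Its image lies in the
  kernel of a lower power, hence has a continuous representative, as
  \<open>shift_op_continuous_iff\<close> requires.\<close>

lemma op_kernel_shift_power_iff:
  "u \<in> op_kernel (shift_op T \<mu> ^^ k) \<longleftrightarrow> (\<exists>y. chain \<mu> k y \<and> u = abs_L2_C2 y)"
proof (induction k arbitrary: u)
  case 0
  show ?case by (simp add: op_kernel_def abs_L2_C2_zero)
next
  case (Suc k)
  have "u \<in> op_kernel (shift_op T \<mu> ^^ Suc k) \<longleftrightarrow> (\<exists>w. (u, w) \<in> shift_op T \<mu> \<and> w \<in> op_kernel (shift_op T \<mu> ^^ k))"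
    unfolding op_kernel_def mem_Collect_eq by (meson relpow_Suc_D2 relpow_Suc_I2)
  also have "\<dots> \<longleftrightarrow> (\<exists>z. (u, abs_L2_C2 z) \<in> shift_op T \<mu> \<and> chain \<mu> k z)"
    unfolding Suc.IH by blast
  also have "\<dots> \<longleftrightarrow> (\<exists>y. chain \<mu> (Suc k) y \<and> u = abs_L2_C2 y)"
  proof -
    have "chain \<mu> k z \<Longrightarrow> (u, abs_L2_C2 z) \<in> shift_op T \<mu> \<longleftrightarrow> (\<exists>y. sol \<mu> z y \<and> (\<forall>j. U j y = 0) \<and> u = abs_L2_C2 y)" for z
      by (rule shift_op_continuous_iff[OF chain_continuous])
    then show ?thesis unfolding chain.simps by blast
  qed
  finally show ?case .
qed

end

section \<open>The estimate along the rays\<close>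

locale dirac_nondegenerate = dirac_system +
  assumes nondeg_upper: "cmod (J a 3 2) + cmod (b1 * J a 1 3 * Q12 0 + b2 * J a 4 2 * Q21 1) \<noteq> 0"
    and nondeg_lower: "cmod (J a 1 4) + cmod (b1 * J a 1 3 * Q12 1 + b2 * J a 4 2 * Q21 0) \<noteq> 0"
begin

lemma sol_component:
  assumes "sol \<zeta> g y" "t \<in> {0..1}"
  shows "((\<lambda>t. y t $ k) has_vector_derivative field \<zeta> t (y t) (g t) $ k) (at t within {0..1})"
  using assms by (intro bounded_linear.has_vector_derivative[OF bounded_linear_vec_nth]) (simp add: sol_def)

text \<open>For \<open>Im \<zeta> > 0\<close> the first component grows at the rate
  \<open>- b1 * Im \<zeta>\<close>, the second decays at the rate \<open>b2 * Im \<zeta>\<close>.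
  The coefficient of order 0 in the determinant is \<open>J a 3 2\<close>, the next one is
  \<open>- \<i>\<close> times the second quantity of the condition. On the diagonal
  \<open>cmod \<zeta> \<le> 2 * Im \<zeta>\<close>, which supplies \<open>H\<close>.\<close>

lemma resolvent_estimate_upper:
  obtains K s0 where "0 < K" "0 < s0"
    "\<And>\<zeta> g y G x k. \<lbrakk>\<bar>Re \<zeta>\<bar> = \<bar>Im \<zeta>\<bar>; s0 \<le> Im \<zeta>; sol \<zeta> g y; \<And>j. U j y = 0;
       \<And>t. t \<in> {0..1} \<Longrightarrow> norm (g t) \<le> G; x \<in> {0..1}\<rbrakk> \<Longrightarrow> cmod (y x $ k) \<le> K * G"
proof -
  define \<delta> where "\<delta> = min (- b1) b2"
  have d: "0 < \<delta>" "\<delta> \<le> - b1" "\<delta> \<le> b2" using b1 b2 by (auto simp: \<delta>_def)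
  define P where "P = (\<lambda>t. - (\<i> * b1) * Q12 t)"
  define R where "R = (\<lambda>t. - (\<i> * b2) * Q21 t)"
  have contPR: "continuous_on {0..1} P" "continuous_on {0..1} R"
    unfolding P_def R_def
    by (intro continuous_on_mult continuous_on_const contQ12 contQ21)+
  have "cmod (a $ 1 $ 3 * a $ 2 $ 2 - a $ 1 $ 2 * a $ 2 $ 3) +
      cmod ((a $ 1 $ 1 * a $ 2 $ 3 - a $ 1 $ 3 * a $ 2 $ 1) * P 0 + (a $ 1 $ 4 * a $ 2 $ 2 - a $ 1 $ 2 * a $ 2 $ 4) * R 1) \<noteq> 0"
  proof -
    have "(a $ 1 $ 1 * a $ 2 $ 3 - a $ 1 $ 3 * a $ 2 $ 1) * P 0 + (a $ 1 $ 4 * a $ 2 $ 2 - a $ 1 $ 2 * a $ 2 $ 4) * R 1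
        = - \<i> * (b1 * J a 1 3 * Q12 0 + b2 * J a 4 2 * Q21 1)"
      by (simp add: J_eq P_def R_def algebra_simps)
    then show ?thesis using nondeg_upper by (simp only: norm_mult norm_minus_cancel norm_ii mult_1 J_eq simp_thms)
  qed
  note dbe = dichotomic_boundary_estimate[OF contPR this, where H = "(b2 - b1) * 2 / \<delta>"]
  obtain K s0 where K: "0 < K" "0 < s0" and est: "\<And>\<alpha> \<gamma> s g h u v G x. \<lbrakk>dichotomic \<alpha> \<gamma> P R g h u v; s0 \<le> s; s \<le> Re \<alpha>; s \<le> Re \<gamma>; cmod (\<alpha> + \<gamma>) \<le> (b2 - b1) * 2 / \<delta> * s;
       \<And>t. t \<in> {0..1} \<Longrightarrow> cmod (g t) \<le> G; \<And>t. t \<in> {0..1} \<Longrightarrow> cmod (h t) \<le> G;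
       a $ 1 $ 1 * u 0 + a $ 1 $ 2 * v 0 + a $ 1 $ 3 * u 1 + a $ 1 $ 4 * v 1 = 0; a $ 2 $ 1 * u 0 + a $ 2 $ 2 * v 0 + a $ 2 $ 3 * u 1 + a $ 2 $ 4 * v 1 = 0;
       x \<in> {0..1}\<rbrakk> \<Longrightarrow> cmod (u x) \<le> K * G \<and> cmod (v x) \<le> K * G"
    by (fact dbe)
  show ?thesis
  proof
    show "0 < K * (\<beta> + 1)" using K beta_nonneg by simp
    show "0 < s0 / \<delta>" using K d by simp
    fix \<zeta> g y G and x :: real and k :: 2
    assume diag: "\<bar>Re \<zeta>\<bar> = \<bar>Im \<zeta>\<bar>" and im: "s0 / \<delta> \<le> Im \<zeta>" and s: "sol \<zeta> g y" and u: "\<And>j. U j y = 0"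
      and g: "\<And>t. t \<in> {0..1} \<Longrightarrow> norm (g t) \<le> G" and x: "x \<in> {0..1}"
    have im0: "0 \<le> Im \<zeta>" using im K d by (meson divide_pos_pos less_imp_le order_trans)
    have G: "0 \<le> G" using g[OF x] norm_ge_zero order_trans by blast
    have gk: "cmod (\<i> * of_real b * g t $ k) \<le> \<beta> * G" if "t \<in> {0..1}" "\<bar>b\<bar> \<le> \<beta>" for t b k
      using mult_mono[OF that(2) order_trans[OF Finite_Cartesian_Product.norm_nth_le g[OF that(1)]] beta_nonneg norm_ge_zero]
      by (simp add: norm_mult)
    have "cmod (y x $ 1) \<le> K * (\<beta> * G) \<and> cmod (y x $ 2) \<le> K * (\<beta> * G)"
    proof (rule est[where \<alpha> = "\<i> * b1 * \<zeta>" and \<gamma> = "- (\<i> * b2 * \<zeta>)" and s = "\<delta> * Im \<zeta>"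
          and g = "\<lambda>t. \<i> * b1 * g t $ 1" and h = "\<lambda>t. \<i> * b2 * g t $ 2" and u = "\<lambda>t. y t $ 1" and v = "\<lambda>t. y t $ 2"])
      show "dichotomic (\<i> * b1 * \<zeta>) (- (\<i> * b2 * \<zeta>)) P R (\<lambda>t. \<i> * b1 * g t $ 1) (\<lambda>t. \<i> * b2 * g t $ 2) (\<lambda>t. y t $ 1) (\<lambda>t. y t $ 2)"
        unfolding dichotomic_def
      proof (intro ballI conjI)
        fix t :: real assume t: "t \<in> {0..1}"
        show "((\<lambda>t. y t $ 1) has_vector_derivative \<i> * b1 * \<zeta> * y t $ 1 + (P t * y t $ 2 + \<i> * b1 * g t $ 1)) (at t within {0..1})"
          by (rule has_vector_derivative_eq_rhs[OF sol_component[OF s t, of 1]]) (simp add: P_def algebra_simps)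
        show "((\<lambda>t. y t $ 2) has_vector_derivative - (- (\<i> * b2 * \<zeta>)) * y t $ 2 + (R t * y t $ 1 + \<i> * b2 * g t $ 2)) (at t within {0..1})"
          by (rule has_vector_derivative_eq_rhs[OF sol_component[OF s t, of 2]]) (simp add: R_def algebra_simps)
      qed
      show "s0 \<le> \<delta> * Im \<zeta>" using im d by (simp add: field_simps)
      show "\<delta> * Im \<zeta> \<le> Re (\<i> * b1 * \<zeta>)" using mult_right_mono[OF d(2) im0] by simp
      show "\<delta> * Im \<zeta> \<le> Re (- (\<i> * b2 * \<zeta>))" using mult_right_mono[OF d(3) im0] by simp
      have "\<i> * b1 * \<zeta> + - (\<i> * b2 * \<zeta>) = \<i> * of_real (b1 - b2) * \<zeta>" by (simp add: algebra_simps)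
      then have "cmod (\<i> * b1 * \<zeta> + - (\<i> * b2 * \<zeta>)) = (b2 - b1) * cmod \<zeta>"
        using b1 b2 by (simp only: norm_mult norm_of_real norm_ii) simp
      also have "\<dots> \<le> (b2 - b1) * (2 * Im \<zeta>)"
        using cmod_le[of \<zeta>] diag im0 b1 b2 by (intro mult_left_mono) auto
      also have "\<dots> = (b2 - b1) * 2 / \<delta> * (\<delta> * Im \<zeta>)" using d by simp
      finally show "cmod (\<i> * b1 * \<zeta> + - (\<i> * b2 * \<zeta>)) \<le> (b2 - b1) * 2 / \<delta> * (\<delta> * Im \<zeta>)" .
      show "a $ 1 $ 1 * y 0 $ 1 + a $ 1 $ 2 * y 0 $ 2 + a $ 1 $ 3 * y 1 $ 1 + a $ 1 $ 4 * y 1 $ 2 = 0"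
        using u[of 1] by (simp add: U_def)
      show "a $ 2 $ 1 * y 0 $ 1 + a $ 2 $ 2 * y 0 $ 2 + a $ 2 $ 3 * y 1 $ 1 + a $ 2 $ 4 * y 1 $ 2 = 0"
        using u[of 2] by (simp add: U_def)
    qed (use gk x in \<open>auto simp: \<beta>_def\<close>)
    moreover have "k = 1 \<or> k = 2" using exhaust_2 by auto
    moreover have "K * (\<beta> * G) \<le> K * (\<beta> + 1) * G" using K G by (simp add: algebra_simps)
    ultimately show "cmod (y x $ k) \<le> K * (\<beta> + 1) * G" by auto
  qed
qed

text \<open>Below the real axis the components exchange roles, and the columns of the boundary
  matrix are read in the order 2, 1, 4, 3. This turns the leading coefficient into
  \<open>- J a 1 4\<close> and exchanges the end points at which \<open>Q12\<close> and
  \<open>Q21\<close> are evaluated.\<close>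

lemma resolvent_estimate_lower:
  obtains K s0 where "0 < K" "0 < s0"
    "\<And>\<zeta> g y G x k. \<lbrakk>\<bar>Re \<zeta>\<bar> = \<bar>Im \<zeta>\<bar>; s0 \<le> - Im \<zeta>; sol \<zeta> g y; \<And>j. U j y = 0;
       \<And>t. t \<in> {0..1} \<Longrightarrow> norm (g t) \<le> G; x \<in> {0..1}\<rbrakk> \<Longrightarrow> cmod (y x $ k) \<le> K * G"
proof -
  define \<delta> where "\<delta> = min (- b1) b2"
  have d: "0 < \<delta>" "\<delta> \<le> - b1" "\<delta> \<le> b2" using b1 b2 by (auto simp: \<delta>_def)
  define R where "R = (\<lambda>t. - (\<i> * b1) * Q12 t)"
  define P where "P = (\<lambda>t. - (\<i> * b2) * Q21 t)"
  have contPR: "continuous_on {0..1} P" "continuous_on {0..1} R"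
    unfolding P_def R_def
    by (intro continuous_on_mult continuous_on_const contQ12 contQ21)+
  have "cmod (a $ 1 $ 4 * a $ 2 $ 1 - a $ 1 $ 1 * a $ 2 $ 4) +
      cmod ((a $ 1 $ 2 * a $ 2 $ 4 - a $ 1 $ 4 * a $ 2 $ 2) * P 0 + (a $ 1 $ 3 * a $ 2 $ 1 - a $ 1 $ 1 * a $ 2 $ 3) * R 1) \<noteq> 0"
  proof -
    have 1: "(a $ 1 $ 2 * a $ 2 $ 4 - a $ 1 $ 4 * a $ 2 $ 2) * P 0 + (a $ 1 $ 3 * a $ 2 $ 1 - a $ 1 $ 1 * a $ 2 $ 3) * R 1
        = \<i> * (b1 * J a 1 3 * Q12 1 + b2 * J a 4 2 * Q21 0)"
      by (simp add: J_eq P_def R_def algebra_simps)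
    have 2: "a $ 1 $ 4 * a $ 2 $ 1 - a $ 1 $ 1 * a $ 2 $ 4 = - J a 1 4" by (simp add: J_eq)
    show ?thesis using nondeg_lower unfolding 1 2 by (simp only: norm_mult norm_minus_cancel norm_ii mult_1 simp_thms)
  qed
  note dbe = dichotomic_boundary_estimate[OF contPR this, where H = "(b2 - b1) * 2 / \<delta>"]
  obtain K s0 where K: "0 < K" "0 < s0" and est: "\<And>\<alpha> \<gamma> s g h u v G x. \<lbrakk>dichotomic \<alpha> \<gamma> P R g h u v; s0 \<le> s; s \<le> Re \<alpha>; s \<le> Re \<gamma>; cmod (\<alpha> + \<gamma>) \<le> (b2 - b1) * 2 / \<delta> * s;
       \<And>t. t \<in> {0..1} \<Longrightarrow> cmod (g t) \<le> G; \<And>t. t \<in> {0..1} \<Longrightarrow> cmod (h t) \<le> G;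
       a $ 1 $ 2 * u 0 + a $ 1 $ 1 * v 0 + a $ 1 $ 4 * u 1 + a $ 1 $ 3 * v 1 = 0; a $ 2 $ 2 * u 0 + a $ 2 $ 1 * v 0 + a $ 2 $ 4 * u 1 + a $ 2 $ 3 * v 1 = 0;
       x \<in> {0..1}\<rbrakk> \<Longrightarrow> cmod (u x) \<le> K * G \<and> cmod (v x) \<le> K * G"
    by (fact dbe)
  show ?thesis
  proof
    show "0 < K * (\<beta> + 1)" using K beta_nonneg by simp
    show "0 < s0 / \<delta>" using K d by simp
    fix \<zeta> g y G and x :: real and k :: 2
    assume diag: "\<bar>Re \<zeta>\<bar> = \<bar>Im \<zeta>\<bar>" and im: "s0 / \<delta> \<le> - Im \<zeta>" and s: "sol \<zeta> g y" and u: "\<And>j. U j y = 0"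
      and g: "\<And>t. t \<in> {0..1} \<Longrightarrow> norm (g t) \<le> G" and x: "x \<in> {0..1}"
    have im0: "0 \<le> - Im \<zeta>" using im K d by (meson divide_pos_pos less_imp_le order_trans)
    have G: "0 \<le> G" using g[OF x] norm_ge_zero order_trans by blast
    have gk: "cmod (\<i> * of_real b * g t $ k) \<le> \<beta> * G" if "t \<in> {0..1}" "\<bar>b\<bar> \<le> \<beta>" for t b k
      using mult_mono[OF that(2) order_trans[OF Finite_Cartesian_Product.norm_nth_le g[OF that(1)]] beta_nonneg norm_ge_zero]
      by (simp add: norm_mult)
    have "cmod (y x $ 2) \<le> K * (\<beta> * G) \<and> cmod (y x $ 1) \<le> K * (\<beta> * G)"
    proof (rule est[where \<alpha> = "\<i> * b2 * \<zeta>" and \<gamma> = "- (\<i> * b1 * \<zeta>)" and s = "\<delta> * (- Im \<zeta>)"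
          and g = "\<lambda>t. \<i> * b2 * g t $ 2" and h = "\<lambda>t. \<i> * b1 * g t $ 1" and u = "\<lambda>t. y t $ 2" and v = "\<lambda>t. y t $ 1"])
      show "dichotomic (\<i> * b2 * \<zeta>) (- (\<i> * b1 * \<zeta>)) P R (\<lambda>t. \<i> * b2 * g t $ 2) (\<lambda>t. \<i> * b1 * g t $ 1) (\<lambda>t. y t $ 2) (\<lambda>t. y t $ 1)"
        unfolding dichotomic_def
      proof (intro ballI conjI)
        fix t :: real assume t: "t \<in> {0..1}"
        show "((\<lambda>t. y t $ 2) has_vector_derivative \<i> * b2 * \<zeta> * y t $ 2 + (P t * y t $ 1 + \<i> * b2 * g t $ 2)) (at t within {0..1})"
          by (rule has_vector_derivative_eq_rhs[OF sol_component[OF s t, of 2]]) (simp add: P_def algebra_simps)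
        show "((\<lambda>t. y t $ 1) has_vector_derivative - (- (\<i> * b1 * \<zeta>)) * y t $ 1 + (R t * y t $ 2 + \<i> * b1 * g t $ 1)) (at t within {0..1})"
          by (rule has_vector_derivative_eq_rhs[OF sol_component[OF s t, of 1]]) (simp add: R_def algebra_simps)
      qed
      show "s0 \<le> \<delta> * (- Im \<zeta>)" using im d by (simp add: field_simps)
      show "\<delta> * (- Im \<zeta>) \<le> Re (\<i> * b2 * \<zeta>)" using mult_right_mono[OF d(3) im0] by simp
      show "\<delta> * (- Im \<zeta>) \<le> Re (- (\<i> * b1 * \<zeta>))" using mult_right_mono[OF d(2) im0] by simp
      have "\<i> * b2 * \<zeta> + - (\<i> * b1 * \<zeta>) = \<i> * of_real (b2 - b1) * \<zeta>" by (simp add: algebra_simps)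
      then have "cmod (\<i> * b2 * \<zeta> + - (\<i> * b1 * \<zeta>)) = (b2 - b1) * cmod \<zeta>"
        using b1 b2 by (simp only: norm_mult norm_of_real norm_ii)
      also have "\<dots> \<le> (b2 - b1) * (2 * (- Im \<zeta>))"
        using cmod_le[of \<zeta>] diag im0 b1 b2 by (intro mult_left_mono) auto
      also have "\<dots> = (b2 - b1) * 2 / \<delta> * (\<delta> * (- Im \<zeta>))" using d by simp
      finally show "cmod (\<i> * b2 * \<zeta> + - (\<i> * b1 * \<zeta>)) \<le> (b2 - b1) * 2 / \<delta> * (\<delta> * (- Im \<zeta>))" .
      show "a $ 1 $ 2 * y 0 $ 2 + a $ 1 $ 1 * y 0 $ 1 + a $ 1 $ 4 * y 1 $ 2 + a $ 1 $ 3 * y 1 $ 1 = 0"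
        using u[of 1] by (simp add: U_def algebra_simps)
      show "a $ 2 $ 2 * y 0 $ 2 + a $ 2 $ 1 * y 0 $ 1 + a $ 2 $ 4 * y 1 $ 2 + a $ 2 $ 3 * y 1 $ 1 = 0"
        using u[of 2] by (simp add: U_def algebra_simps)
    qed (use gk x in \<open>auto simp: \<beta>_def\<close>)
    moreover have "k = 1 \<or> k = 2" using exhaust_2 by auto
    moreover have "K * (\<beta> * G) \<le> K * (\<beta> + 1) * G" using K G by (simp add: algebra_simps)
    ultimately show "cmod (y x $ k) \<le> K * (\<beta> + 1) * G" by auto
  qed
qed

lemma resolvent_estimate:
  obtains K r0 where "0 < K" "0 < r0"
    "\<And>\<zeta> g y G x. \<lbrakk>\<bar>Re \<zeta>\<bar> = \<bar>Im \<zeta>\<bar>; r0 \<le> cmod \<zeta>; sol \<zeta> g y; \<And>j. U j y = 0;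
       \<And>t. t \<in> {0..1} \<Longrightarrow> norm (g t) \<le> G; x \<in> {0..1}\<rbrakk> \<Longrightarrow> norm (y x) \<le> K * G"
proof -
  obtain K1 s1 where 1: "0 < K1" "0 < s1" "\<And>\<zeta> g y G x k. \<lbrakk>\<bar>Re \<zeta>\<bar> = \<bar>Im \<zeta>\<bar>; s1 \<le> Im \<zeta>; sol \<zeta> g y; \<And>j. U j y = 0;
       \<And>t. t \<in> {0..1} \<Longrightarrow> norm (g t) \<le> G; x \<in> {0..1}\<rbrakk> \<Longrightarrow> cmod (y x $ k) \<le> K1 * G"
    by (fact resolvent_estimate_upper)
  obtain K2 s2 where 2: "0 < K2" "0 < s2" "\<And>\<zeta> g y G x k. \<lbrakk>\<bar>Re \<zeta>\<bar> = \<bar>Im \<zeta>\<bar>; s2 \<le> - Im \<zeta>; sol \<zeta> g y; \<And>j. U j y = 0;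
       \<And>t. t \<in> {0..1} \<Longrightarrow> norm (g t) \<le> G; x \<in> {0..1}\<rbrakk> \<Longrightarrow> cmod (y x $ k) \<le> K2 * G"
    by (fact resolvent_estimate_lower)
  have "norm (y x) \<le> (2 * (K1 + K2)) * G"
    if diag: "\<bar>Re \<zeta>\<bar> = \<bar>Im \<zeta>\<bar>" and r: "2 * (s1 + s2) \<le> cmod \<zeta>" and s: "sol \<zeta> g y" and u: "\<And>j. U j y = 0"
      and g: "\<And>t. t \<in> {0..1} \<Longrightarrow> norm (g t) \<le> G" and x: "x \<in> {0..1}" for \<zeta> g y G x
  proof -
    have G: "0 \<le> G" using g[OF x] norm_ge_zero order_trans by blast
    have "s1 + s2 \<le> \<bar>Im \<zeta>\<bar>" using r cmod_le[of \<zeta>] diag by simp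
    then consider "s1 \<le> Im \<zeta>" | "s2 \<le> - Im \<zeta>" using 1(2) 2(2) by linarith
    then have "cmod (y x $ k) \<le> (K1 + K2) * G" for k
    proof cases
      case 1
      have "cmod (y x $ k) \<le> K1 * G" by (rule \<open>\<And>\<zeta> g y G x k. \<lbrakk>\<bar>Re \<zeta>\<bar> = \<bar>Im \<zeta>\<bar>; s1 \<le> Im \<zeta>; sol \<zeta> g y; \<And>j. U j y = 0;
       \<And>t. t \<in> {0..1} \<Longrightarrow> norm (g t) \<le> G; x \<in> {0..1}\<rbrakk> \<Longrightarrow> cmod (y x $ k) \<le> K1 * G\<close>[OF diag 1 s u g x])
      then show ?thesis using mult_right_mono[of K1 "K1 + K2" G] G \<open>0 < K2\<close> by linarith
    next
      case case2: 2
      have "cmod (y x $ k) \<le> K2 * G" by (rule 2(3)[OF diag case2 s u g x])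
      then show ?thesis using mult_right_mono[of K2 "K1 + K2" G] G \<open>0 < K1\<close> by linarith
    qed
    from add_mono[OF this[of 1] this[of 2]] show ?thesis
      using norm_complex_2_le[of "y x"] by (simp add: algebra_simps)
  qed
  then show ?thesis using 1 2 by (intro that[of "2 * (K1 + K2)" "2 * (s1 + s2)"]) auto
qed

text \<open>At a zero of \<open>Del\<close> there is an eigenfunction, and the a priori estimate
  with \<open>g = 0\<close> forces it to vanish. In particular \<open>Del\<close> is not identically
  zero, so its zeros have finite order.\<close>

lemma Del_nonzero_on_diagonals:
  obtains r0 where "0 < r0" "\<And>\<zeta>. \<lbrakk>\<bar>Re \<zeta>\<bar> = \<bar>Im \<zeta>\<bar>; r0 \<le> cmod \<zeta>\<rbrakk> \<Longrightarrow> Del \<zeta> \<noteq> 0"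
proof -
  obtain K r0 where "0 < K" and r0: "0 < r0" and K: "\<And>\<zeta> g y G x. \<lbrakk>\<bar>Re \<zeta>\<bar> = \<bar>Im \<zeta>\<bar>; r0 \<le> cmod \<zeta>; sol \<zeta> g y; \<And>j. U j y = 0;
       \<And>t. t \<in> {0..1} \<Longrightarrow> norm (g t) \<le> G; x \<in> {0..1}\<rbrakk> \<Longrightarrow> norm (y x) \<le> K * G"
    by (fact resolvent_estimate)
  have "Del \<zeta> \<noteq> 0" if z: "\<bar>Re \<zeta>\<bar> = \<bar>Im \<zeta>\<bar>" "r0 \<le> cmod \<zeta>" for \<zeta>
  proof
    assume "Del \<zeta> = 0"
    then obtain y where y: "sol \<zeta> (\<lambda>_. 0) y" "\<And>j. U j y = 0" "y 0 \<noteq> 0" using Del_zero_imp_eigenfunction by metis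
    have "norm (y 0) \<le> K * 0" by (rule K[OF z y(1,2)]) auto
    then show False using y(3) by simp
  qed
  then show ?thesis using r0 that by blast
qed

end

section \<open>Completeness\<close>

text \<open>The zeros of \<open>D\<close> are isolated because \<open>D\<close> is not identically
  zero; a finite limit of the quotient makes each singularity removable.\<close>

lemma entire_quotient:
  fixes D G :: "complex \<Rightarrow> complex"
  assumes G: "G holomorphic_on UNIV" and D: "D holomorphic_on UNIV" and nz: "D z0 \<noteq> 0"
    and lim: "\<And>\<mu>. D \<mu> = 0 \<Longrightarrow> \<exists>c. ((\<lambda>\<zeta>. G \<zeta> / D \<zeta>) \<longlongrightarrow> c) (at \<mu>)"
  obtains F where "F holomorphic_on UNIV" "\<And>\<zeta>. D \<zeta> \<noteq> 0 \<Longrightarrow> F \<zeta> = G \<zeta> / D \<zeta>"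
proof -
  define f where "f = (\<lambda>\<zeta>. G \<zeta> / D \<zeta>)"
  have ana: "f analytic_on {\<mu>}" if "D \<mu> \<noteq> 0" for \<mu>
    unfolding f_def using G D that
    by (intro analytic_intros) (auto simp: analytic_on_open[OF open_UNIV, symmetric] intro: analytic_on_subset)
  have "remove_sings f analytic_on {\<mu>}" for \<mu>
  proof (cases "D \<mu> = 0")
    case True
    then obtain c where c: "(f \<longlongrightarrow> c) (at \<mu>)" using lim unfolding f_def by blast
    have "\<forall>\<^sub>F \<zeta> in at \<mu>. D \<zeta> \<noteq> 0 \<and> \<zeta> \<in> UNIV"
      by (rule non_zero_neighbour_alt[OF D, where \<beta> = z0]) (use nz in auto)
    then obtain r where r: "r > 0" "\<And>\<zeta>. \<zeta> \<in> ball \<mu> r - {\<mu>} \<Longrightarrow> D \<zeta> \<noteq> 0"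
      unfolding eventually_at by (auto simp: dist_commute)
    have "f holomorphic_on ball \<mu> r - {\<mu>}"
      unfolding f_def using r(2) by (intro holomorphic_intros holomorphic_on_subset[OF G] holomorphic_on_subset[OF D]) auto
    then have "f analytic_on ball \<mu> r - {\<mu>}"
      by (subst analytic_on_open) auto
    then have "isolated_singularity_at f \<mu>"
      unfolding isolated_singularity_at_def using r(1) by blast
    then show ?thesis using c by (rule remove_sings_analytic_at)
  next
    case False
    then show ?thesis using remove_sings_analytic_on[OF ana] by simp
  qed
  then have "remove_sings f holomorphic_on UNIV"
    by (metis analytic_imp_holomorphic analytic_on_analytic_at)
  moreover have "remove_sings f \<zeta> = f \<zeta>" if "D \<zeta> \<noteq> 0" for \<zeta>
    using remove_sings_at_analytic[OF ana[OF that]] .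
  ultimately show ?thesis using that unfolding f_def by blast
qed

definition exp_type :: "(complex \<Rightarrow> complex) \<Rightarrow> bool" where
  "exp_type f \<longleftrightarrow> (\<exists>A a. 0 \<le> a \<and> (\<forall>z. cmod (f z) \<le> A * exp (a * cmod z)))"

lemma exp_typeI: "0 \<le> a \<Longrightarrow> (\<And>z. cmod (f z) \<le> A * exp (a * cmod z)) \<Longrightarrow> exp_type f"
  unfolding exp_type_def by blast

lemma exp_type_common:
  assumes "exp_type f" "exp_type g"
  obtains a A where "0 \<le> a" "0 \<le> A" "\<And>z. cmod (f z) \<le> A * exp (a * cmod z)" "\<And>z. cmod (g z) \<le> A * exp (a * cmod z)"
proof -
  obtain A a where a: "0 \<le> a" "\<And>z. cmod (f z) \<le> A * exp (a * cmod z)" using assms(1) by (auto simp: exp_type_def)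
  obtain B b where b: "0 \<le> b" "\<And>z. cmod (g z) \<le> B * exp (b * cmod z)" using assms(2) by (auto simp: exp_type_def)
  have AB: "0 \<le> A" "0 \<le> B"
    using order_trans[OF norm_ge_zero a(2)[of 0]] order_trans[OF norm_ge_zero b(2)[of 0]] by simp_all
  have le: "A * exp (a * r) \<le> (A + B) * exp ((a + b) * r)" "B * exp (b * r) \<le> (A + B) * exp ((a + b) * r)" if "0 \<le> r" for r
    by (rule mult_mono; use AB a(1) b(1) that in \<open>simp add: mult_right_mono\<close>)+
  then show ?thesis
    using AB a(1) b(1) order_trans[OF a(2) le(1)[OF norm_ge_zero]] order_trans[OF b(2) le(2)[OF norm_ge_zero]]
    by (intro that[of "a + b" "A + B"]) simp_all
qed

lemma exp_type_diff: assumes "exp_type f" "exp_type g" shows "exp_type (\<lambda>z. f z - g z)"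
proof -
  obtain A a where A: "0 \<le> a" "0 \<le> A" "\<And>z. cmod (f z) \<le> A * exp (a * cmod z)" "\<And>z. cmod (g z) \<le> A * exp (a * cmod z)"
    by (fact exp_type_common[OF assms])
  have "cmod (f z - g z) \<le> (2 * A) * exp (a * cmod z)" for z
    using norm_triangle_ineq4[of "f z" "g z"] A(3)[of z] A(4)[of z] by simp
  then show ?thesis using A(1) by (rule exp_typeI[rotated])
qed

lemma exp_type_add: assumes "exp_type f" "exp_type g" shows "exp_type (\<lambda>z. f z + g z)"
proof -
  obtain A a where A: "0 \<le> a" "0 \<le> A" "\<And>z. cmod (f z) \<le> A * exp (a * cmod z)" "\<And>z. cmod (g z) \<le> A * exp (a * cmod z)"
    by (fact exp_type_common[OF assms])
  have "cmod (f z + g z) \<le> (2 * A) * exp (a * cmod z)" for z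
    using norm_triangle_ineq[of "f z" "g z"] A(3)[of z] A(4)[of z] by simp
  then show ?thesis using A(1) by (rule exp_typeI[rotated])
qed

lemma exp_type_mult: assumes "exp_type f" "exp_type g" shows "exp_type (\<lambda>z. f z * g z)"
proof -
  obtain A a where A: "0 \<le> a" "0 \<le> A" "\<And>z. cmod (f z) \<le> A * exp (a * cmod z)" "\<And>z. cmod (g z) \<le> A * exp (a * cmod z)"
    by (fact exp_type_common[OF assms])
  have "cmod (f z * g z) \<le> (A * A) * exp ((2 * a) * cmod z)" for z
  proof -
    have "cmod (f z * g z) \<le> (A * exp (a * cmod z)) * (A * exp (a * cmod z))"
      unfolding norm_mult using A by (intro mult_mono) auto
    also have "\<dots> = (A * A) * exp ((2 * a) * cmod z)" by (simp add: algebra_simps flip: exp_add)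
    finally show ?thesis .
  qed
  then show ?thesis by (intro exp_typeI[of "2 * a"]) (use A(1) in auto)
qed

lemma entire_quotient_exp_type:
  fixes D G :: "complex \<Rightarrow> complex"
  assumes G: "G holomorphic_on UNIV" "exp_type G" and D: "D holomorphic_on UNIV" "exp_type D" and nz: "D z0 \<noteq> 0"
    and lim: "\<And>\<mu>. D \<mu> = 0 \<Longrightarrow> \<exists>c. ((\<lambda>\<zeta>. G \<zeta> / D \<zeta>) \<longlongrightarrow> c) (at \<mu>)"
  obtains F where "F holomorphic_on UNIV" "exp_type F" "\<And>\<zeta>. D \<zeta> \<noteq> 0 \<Longrightarrow> F \<zeta> = G \<zeta> / D \<zeta>"
proof -
  obtain F where F: "F holomorphic_on UNIV" "\<And>\<zeta>. D \<zeta> \<noteq> 0 \<Longrightarrow> F \<zeta> = G \<zeta> / D \<zeta>"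
    using entire_quotient[OF G(1) D(1) nz lim] by blast
  obtain A a where A: "0 \<le> a" "0 \<le> A" "\<And>z. cmod (G z) \<le> A * exp (a * cmod z)" "\<And>z. cmod (D z) \<le> A * exp (a * cmod z)"
    by (fact exp_type_common[OF G(2) D(2)])
  have "cmod (F w * D w) \<le> A * exp (a * cmod w)" for w
    using A(2) A(3)[of w] F(2)[of w] by (cases "D w = 0") auto
  from exponential_type_quotient[OF D(1) F(1) nz A(4) this A(1)]
  have "exp_type F" unfolding exp_type_def by blast
  then show ?thesis using F that by blast
qed

section \<open>Cancellation of the zeros of the determinant\<close>

context dirac_system
begin

lemma exp_type_le_E_power:
  assumes "\<And>z. cmod (f z) \<le> K * E z ^ n"
  shows "exp_type f"
proof (rule exp_typeI)
  show "0 \<le> real n * (2 * \<beta>)" using beta_nonneg by simp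
  show "cmod (f z) \<le> (K * exp (2 * (\<beta> * Qsup + 1)) ^ n) * exp (real n * (2 * \<beta>) * cmod z)" for z
    using assms[of z] unfolding E_eq power_mult_distrib by (simp add: mult.assoc flip: exp_of_nat_mult)
qed

lemma functional_Y_exp_type:
  assumes "cont_clinear_functional \<xi>" "continuous_on {0..1} g"
  shows "exp_type (\<lambda>\<zeta>. \<xi> (Y \<zeta> \<eta> g))"
proof -
  obtain K where K: "\<And>\<zeta> \<eta> g. continuous_on {0..1} g \<Longrightarrow> cmod (\<xi> (Y \<zeta> \<eta> g)) \<le> K * (norm \<eta> + \<beta> * norm (abs_L2_C2 g)) * E \<zeta>"
    using functional_Y_bound[OF assms(1)] by metis
  show ?thesis
    by (rule exp_type_le_E_power[of _ "K * (norm \<eta> + \<beta> * norm (abs_L2_C2 g))" 1]) (use K[OF assms(2)] in simp)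
qed

lemma functional_W_exp_type:
  assumes "cont_clinear_functional \<xi>" shows "exp_type (\<lambda>\<zeta>. \<xi> (W j \<zeta>))"
proof -
  obtain K where "\<And>j \<zeta>. cmod (\<xi> (W j \<zeta>)) \<le> K * (E \<zeta>)\<^sup>2" using functional_W_bound[OF assms] by metis
  then show ?thesis by (rule exp_type_le_E_power)
qed

lemma Del_exp_type: "exp_type Del"
proof -
  obtain K where "\<And>\<zeta>. cmod (Del \<zeta>) \<le> K * (E \<zeta>)\<^sup>2" using Del_bound by metis
  then show ?thesis by (rule exp_type_le_E_power)
qed

lemma functional_Y_add:
  assumes \<xi>: "cont_clinear_functional \<xi>" and g: "continuous_on {0..1} g" and h: "continuous_on {0..1} h"
  shows "\<xi> (Y \<zeta> (\<eta> + \<theta>) (\<lambda>t. g t + h t)) = \<xi> (Y \<zeta> \<eta> g) + \<xi> (Y \<zeta> \<theta> h)"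
proof -
  have "\<xi> (Y \<zeta> (\<eta> + \<theta>) (\<lambda>t. g t + h t)) = \<xi> (\<lambda>x. Y \<zeta> \<eta> g x + Y \<zeta> \<theta> h x)"
    by (intro cont_clinear_functional_cong[OF \<xi>] continuous_on_Y continuous_on_add g h Y_add)
  then show ?thesis by (simp add: cont_clinear_functional_add[OF \<xi>] continuous_on_Y g h)
qed

lemma functional_Y_smult:
  assumes \<xi>: "cont_clinear_functional \<xi>" and g: "continuous_on {0..1} g"
  shows "\<xi> (Y \<zeta> (c *s \<eta>) (\<lambda>t. c *s g t)) = c * \<xi> (Y \<zeta> \<eta> g)"
proof -
  have "\<xi> (Y \<zeta> (c *s \<eta>) (\<lambda>t. c *s g t)) = \<xi> (\<lambda>x. c *s Y \<zeta> \<eta> g x)"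
    by (intro cont_clinear_functional_cong[OF \<xi>] continuous_on_Y continuous_on_vector_smult g Y_smult)
  then show ?thesis by (simp add: cont_clinear_functional_smult[OF \<xi>] continuous_on_Y g)
qed

lemma functional_Y_holomorphic_initial:
  assumes \<xi>: "cont_clinear_functional \<xi>" and h: "continuous_on {0..1} h"
    and \<rho>: "\<And>k. (\<lambda>\<zeta>. \<rho> \<zeta> $ k) holomorphic_on S"
  shows "(\<lambda>\<zeta>. \<xi> (Y \<zeta> (\<rho> \<zeta>) h)) holomorphic_on S"
proof -
  have "\<xi> (Y \<zeta> (\<rho> \<zeta>) h) = (\<rho> \<zeta> $ 1 * \<xi> (Phi 1 \<zeta>) + \<rho> \<zeta> $ 2 * \<xi> (Phi 2 \<zeta>)) + \<xi> (Y \<zeta> 0 h)" for \<zeta>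
    using functional_Y_add[OF \<xi> continuous_on_const h, of \<zeta> "\<rho> \<zeta>" 0 0] functional_Y_homogeneous[OF \<xi>, of \<zeta> "\<rho> \<zeta>"] by simp
  then show ?thesis
    by (simp only:) (intro holomorphic_intros \<rho> functional_Phi_holomorphic functional_Y_holomorphic \<xi> h)
qed

text \<open>Division by \<open>\<zeta> - \<mu>\<close> with remainder, for initial value and
  solution at once. The value at \<mu> reappears as the inhomogeneity of the quotient, so iterating
  the division builds a chain.\<close>

lemma functional_Y_expand:
  assumes \<xi>: "cont_clinear_functional \<xi>" and h: "continuous_on {0..1} h"
    and \<rho>: "\<rho> \<zeta> = \<rho> \<mu> + (\<zeta> - \<mu>) *s \<rho>' \<zeta>"
  shows "\<xi> (Y \<zeta> (\<rho> \<zeta>) h) = \<xi> (Y \<mu> (\<rho> \<mu>) h) + (\<zeta> - \<mu>) * \<xi> (Y \<zeta> (\<rho>' \<zeta>) (Y \<mu> (\<rho> \<mu>) h))"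
proof -
  let ?C = "Y \<mu> (\<rho> \<mu>) h"
  have C: "continuous_on {0..1} ?C" by (rule continuous_on_Y[OF h])
  have c0: "continuous_on {0..1} (\<lambda>_. 0 :: complex^2)" by simp
  have "\<xi> (Y \<zeta> (\<rho> \<zeta>) h) = \<xi> (Y \<zeta> (\<rho> \<mu>) h) + (\<zeta> - \<mu>) * \<xi> (Y \<zeta> (\<rho>' \<zeta>) (\<lambda>_. 0))"
    using functional_Y_add[OF \<xi> h c0, of \<zeta> "\<rho> \<mu>" "(\<zeta> - \<mu>) *s \<rho>' \<zeta>"] functional_Y_smult[OF \<xi> c0, of \<zeta> "\<zeta> - \<mu>" "\<rho>' \<zeta>"]
    by (simp add: \<rho>)
  moreover have "\<xi> (Y \<zeta> (\<rho> \<mu>) h) = \<xi> ?C + (\<zeta> - \<mu>) * \<xi> (Y \<zeta> 0 ?C)"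
    using functional_Y_resolvent_identity[OF \<xi> h, of \<zeta> "\<rho> \<mu>" \<mu>] by (simp add: algebra_simps)
  moreover have "\<xi> (Y \<zeta> (\<rho>' \<zeta>) ?C) = \<xi> (Y \<zeta> (\<rho>' \<zeta>) (\<lambda>_. 0)) + \<xi> (Y \<zeta> 0 ?C)"
    using functional_Y_add[OF \<xi> c0 C, of \<zeta> "\<rho>' \<zeta>" 0] by simp
  ultimately show ?thesis by (simp add: algebra_simps)
qed

text \<open>Repeatedly splitting off the value at a zero \<open>\<mu>\<close> of \<open>Del\<close> of order \<open>m\<close> produces a chain of root
  functions of length \<open>m\<close>, so a functional that annihilates the root functions loses a factor
  \<open>\<zeta> - \<mu>\<close> in each step.\<close>
lemma functional_W_factor:
  assumes \<xi>: "cont_clinear_functional \<xi>" and root: "\<forall>k y. chain \<mu> k y \<longrightarrow> \<xi> y = 0"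
    and r: "0 < r" and d: "d holomorphic_on ball \<mu> r" and Del: "\<forall>\<zeta>\<in>ball \<mu> r. Del \<zeta> = (\<zeta> - \<mu>) ^ m * d \<zeta>"
    and n: "n \<le> m"
  shows "\<exists>\<rho> h. (\<forall>k. (\<lambda>\<zeta>. \<rho> \<zeta> $ k) holomorphic_on UNIV) \<and> chain \<mu> n h \<and>
     (\<forall>i \<zeta>. (\<zeta> - \<mu>) ^ n * U i (Y \<zeta> (\<rho> \<zeta>) h) = U i (W j \<zeta>)) \<and>
     (\<forall>\<zeta>. (\<zeta> - \<mu>) ^ n * \<xi> (Y \<zeta> (\<rho> \<zeta>) h) = \<xi> (W j \<zeta>))"
  using n
proof (induction n)
  case 0
  show ?case
    by (intro exI[of _ "adj_col j"] exI[of _ "\<lambda>_. 0"]) (simp add: adj_col_holomorphic W_def)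
next
  case (Suc n)
  then obtain \<rho> h where \<rho>: "\<And>k. (\<lambda>\<zeta>. \<rho> \<zeta> $ k) holomorphic_on UNIV" and h: "chain \<mu> n h"
    and U_eq: "\<And>i \<zeta>. (\<zeta> - \<mu>) ^ n * U i (Y \<zeta> (\<rho> \<zeta>) h) = U i (W j \<zeta>)"
    and \<xi>_eq: "\<And>\<zeta>. (\<zeta> - \<mu>) ^ n * \<xi> (Y \<zeta> (\<rho> \<zeta>) h) = \<xi> (W j \<zeta>)" by auto
  have ch: "continuous_on {0..1} h" by (rule chain_continuous[OF h])
  define C where "C = Y \<mu> (\<rho> \<mu>) h"
  have "\<exists>q. q holomorphic_on UNIV \<and> (\<forall>\<zeta>. \<rho> \<zeta> $ k - \<rho> \<mu> $ k = (\<zeta> - \<mu>) * q \<zeta>)" for k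
    by (rule entire_divide_zero[of "\<lambda>\<zeta>. \<rho> \<zeta> $ k - \<rho> \<mu> $ k" \<mu>]) (auto intro!: holomorphic_intros \<rho>)
  then obtain q where q: "\<And>k. q k holomorphic_on UNIV" "\<And>k \<zeta>. \<rho> \<zeta> $ k - \<rho> \<mu> $ k = (\<zeta> - \<mu>) * q k \<zeta>" by metis
  define \<rho>' where "\<rho>' = (\<lambda>\<zeta>. \<chi> k. q k \<zeta>)"
  have \<rho>_eq: "\<rho> \<zeta> = \<rho> \<mu> + (\<zeta> - \<mu>) *s \<rho>' \<zeta>" for \<zeta>
    using q(2)[of \<zeta>] by (simp add: vec_eq_iff \<rho>'_def algebra_simps)
  have expand: "\<omega> (Y \<zeta> (\<rho> \<zeta>) h) = \<omega> C + (\<zeta> - \<mu>) * \<omega> (Y \<zeta> (\<rho>' \<zeta>) C)" if "cont_clinear_functional \<omega>" for \<omega> \<zeta>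
    unfolding C_def by (rule functional_Y_expand[where \<rho> = \<rho> and \<rho>' = \<rho>', OF that ch \<rho>_eq])
  \<comment> \<open>Off \<mu>, \<open>U i\<close> of the remaining solution is
    \<open>(\<zeta> - \<mu>) ^ (m - n) * d \<zeta>\<close> for \<open>i = j\<close> and 0 otherwise.
    As \<open>n < m\<close>, it tends to 0 at \<mu>; so \<open>C\<close> satisfies both boundary
    conditions and prolongs the chain.\<close>
  have UC: "U i C = 0" for i
  proof -
    define u where "u = (\<lambda>\<zeta>. U i (Y \<zeta> (\<rho> \<zeta>) h))"
    have "u holomorphic_on UNIV"
      unfolding u_def by (rule functional_Y_holomorphic_initial[OF U_functional ch \<rho>])
    then have "continuous_on UNIV u" by (rule holomorphic_on_imp_continuous_on)
    then have "(u \<longlongrightarrow> u \<mu>) (at \<mu>)" by (simp add: continuous_on_eq_continuous_at isCont_def)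
    moreover have "(u \<longlongrightarrow> 0) (at \<mu>)"
    proof (rule Lim_transform_eventually)
      define e where "e = (if i = j then 1 else 0 :: complex)"
      have "(d \<longlongrightarrow> d \<mu>) (at \<mu>)"
        using holomorphic_on_imp_continuous_on[OF d] r
        by (metis centre_in_ball continuous_on_eq_continuous_at isCont_def open_ball)
      then have "((\<lambda>\<zeta>. (\<zeta> - \<mu>) ^ (m - n) * d \<zeta> * e) \<longlongrightarrow> (\<mu> - \<mu>) ^ (m - n) * d \<mu> * e) (at \<mu>)"
        by (intro tendsto_intros)
      then show "((\<lambda>\<zeta>. (\<zeta> - \<mu>) ^ (m - n) * d \<zeta> * e) \<longlongrightarrow> 0) (at \<mu>)"
        using Suc.prems by (simp add: power_0_left)
      have "(\<zeta> - \<mu>) ^ (m - n) * d \<zeta> * e = u \<zeta>" if "\<zeta> \<in> ball \<mu> r" "\<zeta> \<noteq> \<mu>" for \<zeta>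
      proof -
        have "(\<zeta> - \<mu>) ^ n * u \<zeta> = (\<zeta> - \<mu>) ^ m * d \<zeta> * e"
          using U_eq[of \<zeta> i] bspec[OF Del that(1)] by (simp add: u_def U_W e_def)
        also have "\<dots> = (\<zeta> - \<mu>) ^ n * ((\<zeta> - \<mu>) ^ (m - n) * d \<zeta> * e)"
          using Suc.prems by (simp flip: power_add mult.assoc)
        finally show ?thesis using that(2) by simp
      qed
      then show "\<forall>\<^sub>F \<zeta> in at \<mu>. (\<zeta> - \<mu>) ^ (m - n) * d \<zeta> * e = u \<zeta>"
        unfolding eventually_at using r by (intro exI[of _ r]) (auto simp: dist_commute)
    qed
    ultimately have "u \<mu> = 0" by (rule tendsto_unique[rotated]) simp
    then show ?thesis by (simp add: u_def C_def)
  qed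
  have chC: "chain \<mu> (Suc n) C"
    using h UC sol_Y[OF ch, of \<mu> "\<rho> \<mu>"] unfolding C_def by auto
  have "\<xi> C = 0" using root chC by blast
  then have "(\<zeta> - \<mu>) ^ Suc n * \<xi> (Y \<zeta> (\<rho>' \<zeta>) C) = \<xi> (W j \<zeta>)" for \<zeta>
    using \<xi>_eq[of \<zeta>] expand[OF \<xi>, of \<zeta>] by (simp add: algebra_simps)
  moreover have "(\<zeta> - \<mu>) ^ Suc n * U i (Y \<zeta> (\<rho>' \<zeta>) C) = U i (W j \<zeta>)" for i \<zeta>
    using U_eq[of \<zeta> i] expand[OF U_functional, of i \<zeta>] by (simp add: UC algebra_simps)
  moreover have "(\<lambda>\<zeta>. \<rho>' \<zeta> $ k) holomorphic_on UNIV" for k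
    using q(1)[of k] by (simp add: \<rho>'_def)
  ultimately show ?case using chC by blast
qed

lemma functional_R_smult_add:
  assumes \<xi>: "cont_clinear_functional \<xi>" and g: "continuous_on {0..1} g" and h: "continuous_on {0..1} h"
  shows "\<xi> (R \<zeta> (\<lambda>x. g x + c *s h x)) = \<xi> (R \<zeta> g) + c * \<xi> (R \<zeta> h)"
proof -
  have "\<omega> (Y \<zeta> 0 (\<lambda>x. g x + c *s h x)) = \<omega> (Y \<zeta> 0 g) + c * \<omega> (Y \<zeta> 0 h)" if "cont_clinear_functional \<omega>" for \<omega>
    using functional_Y_add[OF that g continuous_on_vector_smult[OF h], of \<zeta> 0 0 c] functional_Y_smult[OF that h, of \<zeta> c 0] by simp
  note lin = this[OF \<xi>] this[OF U_functional]
  have "continuous_on {0..1} (\<lambda>x. g x + c *s h x)" by (intro continuous_intros g h)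
  then show ?thesis
    by (simp add: functional_R[OF \<xi>] g h lin add_divide_distrib diff_divide_distrib algebra_simps)
qed

end

context dirac_nondegenerate
begin

lemma Del_factor:
  assumes "Del \<mu> = 0"
  obtains m r d where "0 < m" "0 < r" "d holomorphic_on ball \<mu> r"
    "\<And>\<zeta>. \<zeta> \<in> ball \<mu> r \<Longrightarrow> Del \<zeta> = (\<zeta> - \<mu>) ^ m * d \<zeta>" "\<And>\<zeta>. \<zeta> \<in> ball \<mu> r \<Longrightarrow> d \<zeta> \<noteq> 0"
proof -
  obtain r0 where r0: "0 < r0" "\<And>\<zeta>. \<lbrakk>\<bar>Re \<zeta>\<bar> = \<bar>Im \<zeta>\<bar>; r0 \<le> cmod \<zeta>\<rbrakk> \<Longrightarrow> Del \<zeta> \<noteq> 0"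
    by (fact Del_nonzero_on_diagonals)
  have "r0 \<le> cmod (Complex r0 r0)" using abs_Re_le_cmod[of "Complex r0 r0"] r0(1) by simp
  then have nz: "Del (Complex r0 r0) \<noteq> 0" by (intro r0(2)) auto
  have "\<not> Del constant_on UNIV" using nz assms by (metis UNIV_I constant_on_def)
  then show ?thesis
    using holomorphic_factor_zero_nonconstant[OF Del_holomorphic open_UNIV connected_UNIV UNIV_I assms] that by metis
qed

text \<open>After \<open>m\<close> divisions the full power \<open>(\<zeta> - \<mu>) ^ m\<close> in
  \<open>Del\<close> has cancelled, and only the nonvanishing factor \<open>d\<close> stays in the
  denominator.\<close>

lemma functional_W_quotient:
  assumes \<xi>: "cont_clinear_functional \<xi>" and root: "\<forall>\<mu> k y. chain \<mu> k y \<longrightarrow> \<xi> y = 0"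
  obtains F where "F holomorphic_on UNIV" "exp_type F" "\<And>\<zeta>. Del \<zeta> \<noteq> 0 \<Longrightarrow> F \<zeta> = \<xi> (W j \<zeta>) / Del \<zeta>"
proof -
  obtain r0 where r0: "0 < r0" "\<And>\<zeta>. \<lbrakk>\<bar>Re \<zeta>\<bar> = \<bar>Im \<zeta>\<bar>; r0 \<le> cmod \<zeta>\<rbrakk> \<Longrightarrow> Del \<zeta> \<noteq> 0"
    by (fact Del_nonzero_on_diagonals)
  have "r0 \<le> cmod (Complex r0 r0)" using abs_Re_le_cmod[of "Complex r0 r0"] r0(1) by simp
  then have nz: "Del (Complex r0 r0) \<noteq> 0" by (intro r0(2)) auto
  show ?thesis
  proof (rule entire_quotient_exp_type[where G = "\<lambda>\<zeta>. \<xi> (W j \<zeta>)" and D = Del])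
    fix \<mu> assume "Del \<mu> = 0"
    then obtain d r m where m: "0 < r" "d holomorphic_on ball \<mu> r"
      "\<And>\<zeta>. \<zeta> \<in> ball \<mu> r \<Longrightarrow> Del \<zeta> = (\<zeta> - \<mu>) ^ m * d \<zeta>" "\<And>\<zeta>. \<zeta> \<in> ball \<mu> r \<Longrightarrow> d \<zeta> \<noteq> 0"
      using Del_factor by metis
    obtain \<rho> h where \<rho>: "\<forall>k. (\<lambda>\<zeta>. \<rho> \<zeta> $ k) holomorphic_on UNIV" and h: "chain \<mu> m h"
      and eq: "\<forall>\<zeta>. (\<zeta> - \<mu>) ^ m * \<xi> (Y \<zeta> (\<rho> \<zeta>) h) = \<xi> (W j \<zeta>)"
      using functional_W_factor[OF \<xi> root[THEN spec, of \<mu>] m(1,2) ballI[OF m(3)] order_refl, where j = j] by blast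
    define u where "u = (\<lambda>\<zeta>. \<xi> (Y \<zeta> (\<rho> \<zeta>) h) / d \<zeta>)"
    have "u holomorphic_on ball \<mu> r"
      unfolding u_def using \<rho> m(4)
      by (intro holomorphic_intros functional_Y_holomorphic_initial \<xi> chain_continuous[OF h] m(2))
        (auto intro: holomorphic_on_subset)
    then have "(u \<longlongrightarrow> u \<mu>) (at \<mu>)"
      using m(1) by (metis centre_in_ball continuous_on_eq_continuous_at isCont_def open_ball holomorphic_on_imp_continuous_on)
    moreover have "u \<zeta> = \<xi> (W j \<zeta>) / Del \<zeta>" if "\<zeta> \<in> ball \<mu> r" "\<zeta> \<noteq> \<mu>" for \<zeta>
      using that eq[rule_format, of \<zeta>] m(3)[OF that(1)] by (simp add: u_def flip: eq[rule_format, of \<zeta>])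
    then have "\<forall>\<^sub>F \<zeta> in at \<mu>. u \<zeta> = \<xi> (W j \<zeta>) / Del \<zeta>"
      unfolding eventually_at using m(1) by (intro exI[of _ r]) (auto simp: dist_commute)
    ultimately have "((\<lambda>\<zeta>. \<xi> (W j \<zeta>) / Del \<zeta>) \<longlongrightarrow> u \<mu>) (at \<mu>)" by (rule Lim_transform_eventually)
    then show "\<exists>c. ((\<lambda>\<zeta>. \<xi> (W j \<zeta>) / Del \<zeta>) \<longlongrightarrow> c) (at \<mu>)" ..
  qed (use that nz \<xi> in \<open>auto intro: functional_W_holomorphic functional_W_exp_type Del_holomorphic Del_exp_type\<close>)
qed

section \<open>Annihilating functionals vanish\<close>

text \<open>The entire extension of \<open>\<xi> (R \<zeta> g)\<close> is bounded on the diagonals, hence constant.\<close>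
lemma functional_R_constant:
  assumes \<xi>: "cont_clinear_functional \<xi>" and root: "\<forall>\<mu> k y. chain \<mu> k y \<longrightarrow> \<xi> y = 0"
    and g: "continuous_on {0..1} g" and z: "Del \<zeta> \<noteq> 0" "Del \<zeta>' \<noteq> 0"
  shows "\<xi> (R \<zeta> g) = \<xi> (R \<zeta>' g)"
proof -
  obtain F1 where F1: "F1 holomorphic_on UNIV" "exp_type F1" "\<And>\<zeta>. Del \<zeta> \<noteq> 0 \<Longrightarrow> F1 \<zeta> = \<xi> (W 1 \<zeta>) / Del \<zeta>"
    by (fact functional_W_quotient[OF \<xi> root, where j = 1])
  obtain F2 where F2: "F2 holomorphic_on UNIV" "exp_type F2" "\<And>\<zeta>. Del \<zeta> \<noteq> 0 \<Longrightarrow> F2 \<zeta> = \<xi> (W 2 \<zeta>) / Del \<zeta>"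
    by (fact functional_W_quotient[OF \<xi> root, where j = 2])
  define F where "F = (\<lambda>\<zeta>. \<xi> (Y \<zeta> 0 g) - (U 1 (Y \<zeta> 0 g) * F1 \<zeta> + U 2 (Y \<zeta> 0 g) * F2 \<zeta>))"
  have F_R: "F \<zeta> = \<xi> (R \<zeta> g)" if "Del \<zeta> \<noteq> 0" for \<zeta>
    using that by (simp add: F_def functional_R[OF \<xi> g] F1(3) F2(3) add_divide_distrib)
  have holF: "F holomorphic_on UNIV"
    unfolding F_def by (intro holomorphic_intros functional_Y_holomorphic \<xi> g U_functional F1 F2)
  have "exp_type F"
    unfolding F_def by (intro exp_type_diff exp_type_add exp_type_mult functional_Y_exp_type \<xi> g U_functional F1 F2)
  then obtain A a where A: "\<And>z. cmod (F z) \<le> A * exp (a * cmod z)" unfolding exp_type_def by blast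
  obtain K r0 where "0 < K" "0 < r0" and est: "\<And>\<zeta> g y G x. \<lbrakk>\<bar>Re \<zeta>\<bar> = \<bar>Im \<zeta>\<bar>; r0 \<le> cmod \<zeta>; sol \<zeta> g y; \<And>j. U j y = 0;
       \<And>t. t \<in> {0..1} \<Longrightarrow> norm (g t) \<le> G; x \<in> {0..1}\<rbrakk> \<Longrightarrow> norm (y x) \<le> K * G"
    by (fact resolvent_estimate)
  obtain r1 where r1: "0 < r1" "\<And>\<zeta>. \<lbrakk>\<bar>Re \<zeta>\<bar> = \<bar>Im \<zeta>\<bar>; r1 \<le> cmod \<zeta>\<rbrakk> \<Longrightarrow> Del \<zeta> \<noteq> 0"
    by (fact Del_nonzero_on_diagonals)
  obtain B where B: "\<And>f C. \<lbrakk>continuous_on {0..1} f; \<And>x. x \<in> {0..1} \<Longrightarrow> norm (f x) \<le> C\<rbrakk> \<Longrightarrow> cmod (\<xi> f) \<le> B * C"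
    using cont_clinear_functional_bound[OF \<xi>] by metis
  obtain G where G: "\<And>t. t \<in> {0..1} \<Longrightarrow> norm (g t) \<le> G"
    using compact_imp_bounded[OF compact_continuous_image[OF g compact_Icc]] unfolding bounded_iff by blast
  \<comment> \<open>The a priori estimate holds outside a disc only; on the disc, continuity bounds
    \<open>F\<close>.\<close>
  have "compact (F ` cball 0 (max r0 r1))"
    by (intro compact_continuous_image holomorphic_on_imp_continuous_on holomorphic_on_subset[OF holF]) auto
  then have "bounded (F ` cball 0 (max r0 r1))" by (rule compact_imp_bounded)
  then obtain M where "\<forall>w\<in>F ` cball 0 (max r0 r1). cmod w \<le> M" unfolding bounded_iff by blast
  then have M: "cmod (F z) \<le> M" if "cmod z \<le> max r0 r1" for z using that by simp
  have "cmod (F z) \<le> max M (B * (K * G))" if "\<bar>Re z\<bar> = \<bar>Im z\<bar>" for z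
  proof (cases "cmod z \<le> max r0 r1")
    case True
    then show ?thesis using M[OF True] by simp
  next
    case False
    then have D: "Del z \<noteq> 0" using r1(2)[OF that] by simp
    have "norm (R z g x) \<le> K * G" if x: "x \<in> {0..1}" for x
      by (rule est[OF \<open>\<bar>Re z\<bar> = \<bar>Im z\<bar>\<close> _ sol_R[OF g] U_R[OF D] G x]) (use False in auto)
    then have "cmod (\<xi> (R z g)) \<le> B * (K * G)" by (intro B continuous_on_R g)
    then show ?thesis by (simp add: F_R[OF D])
  qed
  then have "F z = F 0" for z by (rule exponential_type_bounded_on_diagonals_constant[OF holF A])
  then show ?thesis using F_R z by metis
qed

text \<open>It is enough that \<open>\<xi> (R z1 g) = 0\<close> for all continuous \<open>g\<close>,
  because each member \<open>y\<close> of the dense set satisfies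
  \<open>\<xi> y = \<xi> (R z1 g)\<close> with \<open>g\<close> its image under the operator. Two
  density arguments, one for \<open>\<xi> (R z1 g)\<close> and one for \<open>\<psi>\<close>, use
  bounds in the norm of the space.\<close>

lemma functional_zero:
  assumes \<psi>: "bounded_clinear_functional \<psi>" and root: "\<And>\<mu> k y. chain \<mu> k y \<Longrightarrow> \<psi> (abs_L2_C2 y) = 0"
  shows "\<psi> u = 0"
proof -
  define \<xi> where "\<xi> = (\<lambda>f. \<psi> (abs_L2_C2 f))"
  have \<xi>: "cont_clinear_functional \<xi>" unfolding \<xi>_def by (rule bounded_clinear_functional_abs[OF \<psi>])
  have rt: "\<forall>\<mu> k y. chain \<mu> k y \<longrightarrow> \<xi> y = 0" unfolding \<xi>_def using root by blast
  obtain r1 where r1: "0 < r1" "\<And>\<zeta>. \<lbrakk>\<bar>Re \<zeta>\<bar> = \<bar>Im \<zeta>\<bar>; r1 \<le> cmod \<zeta>\<rbrakk> \<Longrightarrow> Del \<zeta> \<noteq> 0"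
    by (fact Del_nonzero_on_diagonals)
  define z1 z2 where "z1 = Complex r1 r1" and "z2 = Complex (2 * r1) (2 * r1)"
  have D: "Del z1 \<noteq> 0" "Del z2 \<noteq> 0"
    unfolding z1_def z2_def using r1(1) abs_Re_le_cmod[of "Complex r1 r1"] abs_Re_le_cmod[of "Complex (2 * r1) (2 * r1)"]
    by (intro r1(2); simp)+
  have z12: "z1 \<noteq> z2" using r1(1) by (simp add: z1_def z2_def)
  \<comment> \<open>Both end values vanish, so these functions satisfy the boundary conditions for
    every choice of the matrix \<open>a\<close>.\<close>
  define N where "N = {abs_L2_C2 y | y y'. (\<forall>x. (y has_vector_derivative y' x) (at x)) \<and> continuous_on UNIV y' \<and> y 0 = 0 \<and> y 1 = 0}"
  have nice: "continuous_on {0..1} y \<and> \<xi> (R z1 y) = 0 \<and> (\<exists>g. continuous_on {0..1} g \<and> \<xi> y = \<xi> (R z1 g))"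
    if dy: "\<forall>x. (y has_vector_derivative y' x) (at x)" and cy': "continuous_on UNIV y'" and y0: "y 0 = 0" "y 1 = 0" for y y'
  proof -
    have cy: "continuous_on {0..1} y"
      by (rule continuous_on_vector_derivative[where f' = y']) (use dy has_vector_derivative_at_within in blast)
    define g where "g = (\<lambda>t. (- \<i>) *s (matB b1 b2 *v y' t) + matQ Q12 Q21 t *v y t)"
    have g_eq: "y' t = field 0 t (y t) (g t)" for t
      using matrix_field_iff[of "y' t" t "y t" "g t"] by (simp add: g_def)
    have cy'': "continuous_on {0..1} y'" by (rule continuous_on_subset[OF cy']) simp
    have "continuous_on {0..1} (\<lambda>t. if i = 1 then (- \<i>) * (inverse (of_real b1) * y' t $ 1) + Q12 t * y t $ 2
        else (- \<i>) * (inverse (of_real b2) * y' t $ 2) + Q21 t * y t $ 1)" for i :: 2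
      by (cases "i = 1") (auto intro!: continuous_intros cy cy'' contQ12 contQ21)
    then have "continuous_on {0..1} (\<lambda>t. (\<chi> i::2. if i = 1 then (- \<i>) * (inverse (of_real b1) * y' t $ 1) + Q12 t * y t $ 2
        else (- \<i>) * (inverse (of_real b2) * y' t $ 2) + Q21 t * y t $ 1))"
      by (rule continuous_on_vec_lambda)
    moreover have "g = (\<lambda>t. \<chi> i::2. if i = 1 then (- \<i>) * (inverse (of_real b1) * y' t $ 1) + Q12 t * y t $ 2
        else (- \<i>) * (inverse (of_real b2) * y' t $ 2) + Q21 t * y t $ 1)"
      by (simp add: g_def fun_eq_iff vec_eq_iff forall_2 matQ_def matB_def matrix_vector_mult_def sum_2)
    ultimately have cg: "continuous_on {0..1} g" by simp
    have s0: "sol 0 g y"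
      using dy by (auto simp: sol_def simp flip: g_eq intro: has_vector_derivative_at_within)
    have U0: "U j y = 0" for j by (simp add: U_def y0)
    \<comment> \<open>The identity \<open>y = R \<zeta> (L y - \<zeta> y)\<close> under the
      functional, with both resolvent terms moved from \<zeta> to \<open>z1\<close> by constancy;
      the explicit factor \<zeta> remains.\<close>
    have eq: "\<xi> y = \<xi> (R z1 g) - \<zeta> * \<xi> (R z1 y)" if z: "Del \<zeta> \<noteq> 0" for \<zeta>
    proof -
      have s: "sol \<zeta> (\<lambda>t. g t + (- \<zeta>) *s y t) y" using s0 sol_shift[of 0 g y \<zeta>] by simp
      have c: "continuous_on {0..1} (\<lambda>t. g t + (- \<zeta>) *s y t)" by (intro continuous_intros cg cy)
      have "\<xi> y = \<xi> (R \<zeta> (\<lambda>t. g t + (- \<zeta>) *s y t))"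
        by (intro cont_clinear_functional_cong[OF \<xi> cy] continuous_on_R R_unique[OF z s U0] c)
      also have "\<dots> = \<xi> (R \<zeta> g) + (- \<zeta>) * \<xi> (R \<zeta> y)" by (rule functional_R_smult_add[OF \<xi> cg cy])
      also have "\<dots> = \<xi> (R z1 g) - \<zeta> * \<xi> (R z1 y)"
        using functional_R_constant[OF \<xi> rt cg z D(1)] functional_R_constant[OF \<xi> rt cy z D(1)] by simp
      finally show ?thesis .
    qed
    have "\<xi> (R z1 g) - z1 * \<xi> (R z1 y) = \<xi> (R z1 g) - z2 * \<xi> (R z1 y)"
      using trans[OF eq[OF D(1), symmetric] eq[OF D(2)]] .
    then have 0: "\<xi> (R z1 y) = 0" using z12 by simp
    then have "\<xi> y = \<xi> (R z1 g)" using eq[OF D(1)] by simp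
    then show ?thesis using cy cg 0 by blast
  qed
  have N: "closure N = UNIV" unfolding N_def by (rule closure_C1_vanishing_endpoints_L2_C2)
  obtain K where K: "0 \<le> K" "\<And>g. continuous_on {0..1} g \<Longrightarrow> cmod (\<xi> (R z1 g)) \<le> K * norm (abs_L2_C2 g)"
  proof -
    obtain K where K: "0 \<le> K" "\<And>\<zeta> g. \<lbrakk>continuous_on {0..1} g; Del \<zeta> \<noteq> 0\<rbrakk> \<Longrightarrow>
       cmod (\<xi> (R \<zeta> g)) \<le> K * (E \<zeta>)^3 * (1 + 1 / cmod (Del \<zeta>)) * norm (abs_L2_C2 g)"
      using functional_R_bound[OF \<xi>] by metis
    show ?thesis
    proof (rule that)
      show "0 \<le> K * (E z1)^3 * (1 + 1 / cmod (Del z1))" using K(1) E_pos[of z1] by simp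
    qed (use K(2) D(1) in blast)
  qed
  have small: "\<exists>v\<in>N. norm (w - v) < e" if "0 < e" for w e
    using N that unfolding closure_approachable set_eq_iff by (metis UNIV_I dist_commute dist_norm)
  have R0: "\<xi> (R z1 g) = 0" if g: "continuous_on {0..1} g" for g
  proof -
    have "cmod (\<xi> (R z1 g)) \<le> 0 + e" if e: "0 < e" for e
    proof -
      define e' where "e' = e / (K + 1)"
      have e': "0 < e'" using e K(1) by (simp add: e'_def)
      obtain v where v: "v \<in> N" "norm (abs_L2_C2 g - v) < e'" using small[OF e'] by blast
      obtain y y' where y: "v = abs_L2_C2 y" "\<forall>x. (y has_vector_derivative y' x) (at x)" "continuous_on UNIV y'" "y 0 = 0" "y 1 = 0"
        using v(1) unfolding N_def by blast
      have cy: "continuous_on {0..1} y" and ry: "\<xi> (R z1 y) = 0" using nice[OF y(2-5)] by auto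
      have "\<xi> (R z1 g) = \<xi> (R z1 (\<lambda>x. g x + (- 1) *s y x))"
        unfolding functional_R_smult_add[OF \<xi> g cy] ry by simp
      also have "cmod \<dots> \<le> K * norm (abs_L2_C2 (\<lambda>x. g x + (- 1) *s y x))"
        by (intro K(2) continuous_intros g cy)
      also have "abs_L2_C2 (\<lambda>x. g x + (- 1) *s y x) = abs_L2_C2 g - v"
        using abs_L2_C2_diff[of g y] g cy by (simp add: y(1) continuous_square_integrable flip: vector_sneg_minus1)
      also have "K * norm (abs_L2_C2 g - v) \<le> (K + 1) * e'" using K(1) v(2) e' by (intro mult_mono) auto
      also have "\<dots> = e" using K(1) by (simp add: e'_def)
      finally show ?thesis by simp
    qed
    then have "cmod (\<xi> (R z1 g)) \<le> 0" by (rule field_le_epsilon)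
    then show ?thesis by simp
  qed
  obtain L where L: "0 \<le> L" "\<And>u. cmod (\<psi> u) \<le> L * norm u" using \<psi> by (auto simp: bounded_clinear_functional_def)
  have "cmod (\<psi> u) \<le> 0 + e" if e: "0 < e" for e
  proof -
    define e' where "e' = e / (L + 1)"
    have e': "0 < e'" using e L(1) by (simp add: e'_def)
    obtain v where v: "v \<in> N" "norm (u - v) < e'" using small[OF e'] by blast
    obtain y y' where y: "v = abs_L2_C2 y" "\<forall>x. (y has_vector_derivative y' x) (at x)" "continuous_on UNIV y'" "y 0 = 0" "y 1 = 0"
      using v(1) unfolding N_def by blast
    have "\<psi> v = 0" using nice[OF y(2-5)] R0 unfolding y(1) \<xi>_def by auto
    moreover have "\<psi> u = \<psi> (u - v) + \<psi> v"
      using \<psi> unfolding bounded_clinear_functional_def by (metis diff_add_cancel)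
    ultimately have "cmod (\<psi> u) \<le> L * norm (u - v)" using L(2) by simp
    also have "\<dots> \<le> (L + 1) * e'" using L(1) v(2) e' by (intro mult_mono) auto
    also have "\<dots> = e" using L(1) by (simp add: e'_def)
    finally show ?thesis by simp
  qed
  then have "cmod (\<psi> u) \<le> 0" by (rule field_le_epsilon)
  then show ?thesis by simp
qed

text \<open>The system provides bases at eigenvalues only. At any other \<mu> the shifted operator
  is injective, so are its powers, and the root subspace is zero.\<close>

lemma root_subspace_subset_span:
  assumes S: "root_function_system T S"
  shows "root_subspace T \<mu> \<subseteq> L2.span S"
proof (cases "eigenvalue T \<mu>")
  case True
  then obtain X where "is_basis (root_subspace T \<mu>) (X \<mu>)" "X \<mu> \<subseteq> S"
    using S unfolding root_function_system_def by blast
  then show ?thesis unfolding is_basis_def using L2.span_mono by metis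
next
  case False
  have "u = 0" if "u \<in> op_kernel (shift_op T \<mu> ^^ k)" for k u
    using that
  proof (induction k arbitrary: u)
    case (Suc k)
    then obtain w where "(u, w) \<in> shift_op T \<mu>" "w \<in> op_kernel (shift_op T \<mu> ^^ k)"
      unfolding op_kernel_def mem_Collect_eq by (meson relpow_Suc_D2)
    with Suc.IH have "u \<in> op_kernel (shift_op T \<mu>)" by (auto simp: op_kernel_def)
    then show ?case using False unfolding eigenvalue_def by blast
  qed (simp add: op_kernel_def)
  then have "(\<Union>k. op_kernel (shift_op T \<mu> ^^ k)) \<subseteq> L2.span S" using L2.span_zero by blast
  then show ?thesis unfolding root_subspace_def by (rule L2.span_minimal) (rule L2.subspace_span)
qed

theorem complete_root_function_system:
  assumes S: "root_function_system T S"
  shows "complete_system S"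
  unfolding complete_system_def
proof (rule ccontr)
  assume "closure (L2.span S) \<noteq> UNIV"
  then obtain g where "g \<notin> closure (L2.span S)" by blast
  then obtain \<psi> where \<psi>: "bounded_clinear_functional \<psi>" "\<And>v. v \<in> L2.span S \<Longrightarrow> \<psi> v = 0" "\<psi> g \<noteq> 0"
    using separating_functional_L2_C2[OF L2.subspace_span] by metis
  have "\<psi> (abs_L2_C2 y) = 0" if "chain \<mu> k y" for \<mu> k y
  proof (rule \<psi>(2), rule subsetD[OF root_subspace_subset_span[OF S, of \<mu>]])
    have "abs_L2_C2 y \<in> op_kernel (shift_op T \<mu> ^^ k)" using that op_kernel_shift_power_iff by blast
    then show "abs_L2_C2 y \<in> root_subspace T \<mu>" unfolding root_subspace_def by (intro L2.span_base) blast
  qed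
  then have "\<psi> g = 0" by (rule functional_zero[OF \<psi>(1)])
  then show False using \<psi>(3) by simp
qed

end

section \<open>Minimality\<close>

text \<open>Linear combinations are formed among functions rather than classes, because the solution
  operator \<open>Y \<mu> 0\<close> acts on functions.\<close>

inductive_set function_span :: "(real \<Rightarrow> complex^2) set \<Rightarrow> (real \<Rightarrow> complex^2) set" for G where
  zero: "(\<lambda>_. 0) \<in> function_span G"
| step: "g \<in> G \<Longrightarrow> h \<in> function_span G \<Longrightarrow> (\<lambda>x. c *s g x + h x) \<in> function_span G"

lemma function_span_continuous:
  "f \<in> function_span G \<Longrightarrow> (\<And>g. g \<in> G \<Longrightarrow> continuous_on {0..1} g) \<Longrightarrow> continuous_on {0..1} f"
  by (induction rule: function_span.induct) (auto intro!: continuous_intros)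

lemma function_span_abs:
  assumes "f \<in> function_span G" "\<And>g. g \<in> G \<Longrightarrow> continuous_on {0..1} g"
  shows "abs_L2_C2 f \<in> L2.span (abs_L2_C2 ` G)"
  using assms(1)
proof induction
  case zero
  then show ?case by (simp add: L2.span_zero flip: zero_L2_C2.abs_eq)
next
  case (step g h c)
  have "abs_L2_C2 (\<lambda>x. c *s g x + h x) = scaleC_L2 c (abs_L2_C2 g) + abs_L2_C2 h"
    using assms(2) step function_span_continuous[OF step(2) assms(2)]
    by (simp add: abs_L2_C2_add abs_L2_C2_scaleC continuous_square_integrable square_integrable_scaleC)
  then show ?case using step by (simp add: L2.span_add L2.span_scale L2.span_base)
qed

context dirac_system
begin

text \<open>Generators for the solutions of the \<open>k\<close>-fold iterated differential
  equation, with the boundary conditions disregarded; at most \<open>2 * k\<close> of them.\<close>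

fun solution_basis :: "complex \<Rightarrow> nat \<Rightarrow> (real \<Rightarrow> complex^2) set" where
  "solution_basis \<mu> 0 = {}"
| "solution_basis \<mu> (Suc k) = {Phi 1 \<mu>, Phi 2 \<mu>} \<union> Y \<mu> 0 ` solution_basis \<mu> k"

lemma finite_solution_basis: "finite (solution_basis \<mu> k)"
  by (induction k) auto

lemma solution_basis_continuous: "g \<in> solution_basis \<mu> k \<Longrightarrow> continuous_on {0..1} g"
  by (induction k arbitrary: g) (auto intro: continuous_on_Phi continuous_on_Y)

lemma sol_cong:
  assumes "sol \<zeta> g y" "\<And>x. x \<in> {0..1} \<Longrightarrow> g x = h x"
  shows "sol \<zeta> h y"
  using assms by (auto simp: sol_def)

text \<open>Variation of constants: \<open>y\<close> is a combination of \<open>Phi 1 \<mu>\<close>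
  and \<open>Phi 2 \<mu>\<close> plus \<open>Y \<mu> 0\<close> of its predecessor, and
  \<open>Y \<mu> 0\<close> carries generators of one level to generators of the next.\<close>

lemma chain_in_function_span:
  assumes "chain \<mu> k y"
  shows "\<exists>f\<in>function_span (solution_basis \<mu> k). \<forall>x\<in>{0..1}. y x = f x"
  using assms
proof (induction k arbitrary: y)
  case 0
  then show ?case by (auto intro: function_span.zero)
next
  case (Suc k)
  let ?B = "solution_basis \<mu> (Suc k)"
  obtain z where z: "chain \<mu> k z" "sol \<mu> z y" using Suc.prems by auto
  obtain f where f: "f \<in> function_span (solution_basis \<mu> k)" "\<And>x. x \<in> {0..1} \<Longrightarrow> z x = f x"
    using Suc.IH[OF z(1)] by blast
  have cf: "continuous_on {0..1} f" by (rule function_span_continuous[OF f(1) solution_basis_continuous])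
  have "\<exists>h\<in>function_span ?B. \<forall>x\<in>{0..1}. Y \<mu> 0 f x = h x"
    using f(1)
  proof induction
    case zero
    have "Y \<mu> 0 (\<lambda>_. 0) x = 0" if "x \<in> {0..1}" for x
      using Y_homogeneous_eq[OF that, of \<mu> 0] by simp
    then show ?case by (intro bexI[of _ "\<lambda>_. 0"]) (auto intro: function_span.zero)
  next
    case (step g h c)
    then obtain h' where h': "h' \<in> function_span ?B" "\<And>x. x \<in> {0..1} \<Longrightarrow> Y \<mu> 0 h x = h' x" by blast
    have cg: "continuous_on {0..1} g" by (rule solution_basis_continuous[OF step(1)])
    have ch: "continuous_on {0..1} h" by (rule function_span_continuous[OF step(2) solution_basis_continuous])
    have "Y \<mu> 0 (\<lambda>x. c *s g x + h x) x = c *s Y \<mu> 0 g x + h' x" if "x \<in> {0..1}" for x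
      using Y_add[OF continuous_on_vector_smult[OF cg] ch that, of \<mu> 0 0 c] Y_smult[OF cg that, of \<mu> c 0] h'(2)[OF that] by simp
    moreover have "(\<lambda>x. c *s Y \<mu> 0 g x + h' x) \<in> function_span ?B"
      using step(1) h'(1) by (intro function_span.step) auto
    ultimately show ?case by (intro bexI[of _ "\<lambda>x. c *s Y \<mu> 0 g x + h' x"]) auto
  qed
  then obtain h where h: "h \<in> function_span ?B" "\<And>x. x \<in> {0..1} \<Longrightarrow> Y \<mu> 0 f x = h x" by blast
  have "y x = y 0 $ 1 *s Phi 1 \<mu> x + (y 0 $ 2 *s Phi 2 \<mu> x + h x)" if x: "x \<in> {0..1}" for x
  proof -
    have "y x = Y \<mu> (y 0) f x" by (rule sol_eq_Y[OF sol_cong[OF z(2) f(2)] cf x])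
    also have "\<dots> = Y \<mu> (y 0) (\<lambda>_. 0) x + Y \<mu> 0 f x"
      using Y_add[OF continuous_on_const cf x, of \<mu> "y 0" 0 0] by simp
    finally show ?thesis using Y_homogeneous_eq[OF x, of \<mu> "y 0"] h(2)[OF x] by simp
  qed
  note eq = this
  have "(\<lambda>x. y 0 $ 2 *s Phi 2 \<mu> x + h x) \<in> function_span ?B"
    by (rule function_span.step[OF _ h(1)]) simp
  then have "(\<lambda>x. y 0 $ 1 *s Phi 1 \<mu> x + (y 0 $ 2 *s Phi 2 \<mu> x + h x)) \<in> function_span ?B"
    by (rule function_span.step[rotated]) simp
  then show ?case by (rule bexI[rotated]) (rule ballI, rule eq)
qed

text \<open>The existential witnesses of a chain are laid out as one sequence, padded by zero
  functions so that no index is exceptional.\<close>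

lemma chain_sequence:
  assumes "chain \<mu> k y"
  obtains s where "s 0 = y" "\<forall>i\<ge>k. s i = (\<lambda>_. 0)" "\<And>i. sol \<mu> (s (Suc i)) (s i)" "\<And>i j. U j (s i) = 0"
    "\<And>i. continuous_on {0..1} (s i)"
proof -
  have "\<exists>s. s 0 = y \<and> (\<forall>i\<ge>k. s i = (\<lambda>_. 0)) \<and> (\<forall>i. sol \<mu> (s (Suc i)) (s i)) \<and> (\<forall>i j. U j (s i) = 0)"
    using assms
  proof (induction k arbitrary: y)
    case 0
    then show ?case by (intro exI[of _ "\<lambda>_ _. 0"]) (auto simp: sol_zero U_def)
  next
    case (Suc k)
    then obtain z where z: "chain \<mu> k z" "sol \<mu> z y" "\<forall>j. U j y = 0" by auto
    then obtain s where s: "s 0 = z" "\<forall>i\<ge>k. s i = (\<lambda>_. 0)" "\<forall>i. sol \<mu> (s (Suc i)) (s i)" "\<forall>i j. U j (s i) = 0"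
      using Suc.IH by blast
    show ?case
      by (intro exI[of _ "case_nat y s"]) (use s z in \<open>auto split: nat.split simp: Suc_le_eq less_Suc_eq_le\<close>)
  qed
  then obtain s where s: "s 0 = y" "\<forall>i\<ge>k. s i = (\<lambda>_. 0)" "\<forall>i. sol \<mu> (s (Suc i)) (s i)" "\<forall>i j. U j (s i) = 0" by blast
  moreover have "continuous_on {0..1} (s i)" for i using s(3) sol_continuous by blast
  ultimately show ?thesis by (intro that[of s]) blast+
qed

text \<open>\<open>chain \<mu> 0\<close> asks for the zero function on the whole line, while
  \<open>s k\<close> is only known to vanish on \<open>{0..1}\<close>; therefore
  \<open>0 < k\<close>. The last step replaces \<open>s k\<close> by the zero function through
  \<open>sol_cong\<close>.\<close>

lemma sequence_chain:
  assumes "\<And>x. x \<in> {0..1} \<Longrightarrow> s k x = 0" "\<And>i. sol \<mu> (s (Suc i)) (s i)" "\<And>i j. U j (s i) = 0"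
  shows "0 < k \<Longrightarrow> chain \<mu> k (s 0)"
  using assms
proof (induction k arbitrary: s)
  case (Suc k)
  show ?case
  proof (cases "k = 0")
    case True
    have "sol \<mu> (\<lambda>_. 0) (s 0)"
      by (rule sol_cong[OF Suc.prems(3)[of 0]]) (use Suc.prems(2) True in auto)
    then show ?thesis using True Suc.prems(4) by simp
  next
    case False
    then have "chain \<mu> k (s (Suc 0))"
      using Suc.IH[of "\<lambda>i. s (Suc i)"] Suc.prems by simp
    then show ?thesis using Suc.prems(3,4) by auto
  qed
qed simp

lemma Del_zero_if_eigenvalue:
  assumes "eigenvalue T \<mu>" shows "Del \<mu> = 0"
proof (rule ccontr)
  assume D: "Del \<mu> \<noteq> 0"
  obtain u where u: "u \<in> op_kernel (shift_op T \<mu>)" "u \<noteq> 0" using assms unfolding eigenvalue_def by blast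
  have "u \<in> op_kernel (shift_op T \<mu> ^^ Suc 0)" using u(1) by simp
  then obtain y where y: "chain \<mu> (Suc 0) y" "u = abs_L2_C2 y" unfolding op_kernel_shift_power_iff by blast
  have "sol \<mu> (\<lambda>_. 0) y" "\<And>j. U j y = 0" using y(1) by auto
  then have "y x = 0" if "x \<in> {0..1}" for x using homogeneous_unique[OF D _ _ that] by blast
  then have "abs_L2_C2 y = abs_L2_C2 (\<lambda>_. 0)"
    by (intro abs_L2_C2_cong continuous_square_integrable chain_continuous[OF y(1)] continuous_on_const)
  then show False using u(2) y(2) by (simp add: abs_L2_C2_zero)
qed

text \<open>\<open>(L - \<zeta>) (s i) = s (Suc i) + (\<mu> - \<zeta>) (s i)\<close> expresses the
  resolvent of \<open>s i\<close> through that of \<open>s (Suc i)\<close>. Iterating until the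
  sequence vanishes gives the Laurent expansion at \<mu>, here a finite sum.\<close>

lemma functional_R_root:
  assumes \<xi>: "cont_clinear_functional \<xi>" and D: "Del \<zeta> \<noteq> 0" and nz: "\<zeta> \<noteq> \<mu>"
    and s: "\<forall>i\<ge>k. s i = (\<lambda>_. 0)" "\<And>i. sol \<mu> (s (Suc i)) (s i)" "\<And>i j. U j (s i) = 0"
  shows "\<xi> (R \<zeta> (s 0)) = - (\<Sum>i<k. \<xi> (s i) / (\<zeta> - \<mu>) ^ Suc i)"
proof -
  have c: "continuous_on {0..1} (s i)" for i using s(2) sol_continuous by blast
  have step: "\<xi> (R \<zeta> (s i)) = (\<xi> (R \<zeta> (s (Suc i))) - \<xi> (s i)) / (\<zeta> - \<mu>)" for i
  proof -
    have "sol \<zeta> (\<lambda>t. s (Suc i) t + (\<mu> - \<zeta>) *s s i t) (s i)"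
      using s(2)[of i] sol_shift[of \<mu> "s (Suc i)" "s i" \<zeta>] by blast
    then have "s i x = R \<zeta> (\<lambda>t. s (Suc i) t + (\<mu> - \<zeta>) *s s i t) x" if "x \<in> {0..1}" for x
      by (rule R_unique[OF D _ s(3) _ that]) (intro continuous_intros c)
    then have "\<xi> (s i) = \<xi> (R \<zeta> (\<lambda>t. s (Suc i) t + (\<mu> - \<zeta>) *s s i t))"
      by (intro cont_clinear_functional_cong[OF \<xi> c] continuous_on_R continuous_intros c)
    also have "\<dots> = \<xi> (R \<zeta> (s (Suc i))) + (\<mu> - \<zeta>) * \<xi> (R \<zeta> (s i))"
      by (rule functional_R_smult_add[OF \<xi> c c])
    finally show ?thesis using nz by (simp add: field_simps)
  qed
  have unroll: "\<xi> (R \<zeta> (s 0)) = \<xi> (R \<zeta> (s n)) / (\<zeta> - \<mu>) ^ n - (\<Sum>i<n. \<xi> (s i) / (\<zeta> - \<mu>) ^ Suc i)" for n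
  proof (induction n)
    case (Suc n)
    have "\<xi> (R \<zeta> (s n)) / (\<zeta> - \<mu>) ^ n = \<xi> (R \<zeta> (s (Suc n))) / (\<zeta> - \<mu>) ^ Suc n - \<xi> (s n) / (\<zeta> - \<mu>) ^ Suc n"
      unfolding step[of n] by (simp add: diff_divide_distrib)
    then show ?case unfolding Suc.IH by simp
  qed simp
  have "\<xi> (R \<zeta> (s k)) = 0"
  proof -
    have "s k = (\<lambda>_. 0)" using s(1) by simp
    then have "R \<zeta> (s k) x = 0" if "x \<in> {0..1}" for x
      using R_unique[OF D sol_zero _ continuous_on_const that] by (simp add: U_def)
    then have "\<xi> (R \<zeta> (s k)) = \<xi> (\<lambda>x. 0 *s s k x)"
      by (intro cont_clinear_functional_cong[OF \<xi>] continuous_on_R continuous_intros c) simp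
    then show ?thesis by (simp only: cont_clinear_functional_smult[OF \<xi> c] mult_zero_left)
  qed
  then show ?thesis unfolding unroll[of k] by simp
qed

end

context dirac_nondegenerate
begin

text \<open>A chain of length \<open>k\<close> gives the resolvent a pole of order \<open>k\<close>, while the order is at most that of
  the zero of \<open>Del\<close>.\<close>
lemma chain_length_bound:
  assumes "Del \<mu> = 0"
  obtains m where "\<And>k y. chain \<mu> k y \<Longrightarrow> chain \<mu> m y"
proof -
  obtain d r m where m: "0 < m" "0 < r" "d holomorphic_on ball \<mu> r"
      "\<And>\<zeta>. \<zeta> \<in> ball \<mu> r \<Longrightarrow> Del \<zeta> = (\<zeta> - \<mu>) ^ m * d \<zeta>" "\<And>\<zeta>. \<zeta> \<in> ball \<mu> r \<Longrightarrow> d \<zeta> \<noteq> 0"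
    by (fact Del_factor[OF assms])
  \<comment> \<open>The last entry \<open>s k\<close> of a chain of length \<open>k + 1\<close> is
    the coefficient of the pole of order \<open>k + 1\<close>, which exceeds the order
    \<open>m\<close> of the zero of \<open>Del\<close>.\<close>
  have top: "s k x = 0" if s: "\<forall>i\<ge>Suc k. s i = (\<lambda>_. 0)" "\<And>i. sol \<mu> (s (Suc i)) (s i)" "\<And>i j. U j (s i) = 0"
    and k: "m \<le> k" and x: "x \<in> {0..1}" for s k x
  proof -
    have c: "continuous_on {0..1} (s i)" for i using s(2) sol_continuous by blast
    have "s k x $ l = 0" for l
    proof -
      define \<xi> where "\<xi> = (\<lambda>f::real \<Rightarrow> complex^2. f x $ l)"
      have \<xi>: "cont_clinear_functional \<xi>" unfolding \<xi>_def by (rule evaluation_functional[OF x])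
      \<comment> \<open>Both are the resolvent times \<open>- ((\<zeta> - \<mu>) ^ Suc k)\<close>:
        \<open>p\<close> from the Laurent sum, with \<open>p \<mu> = \<xi> (s k)\<close>, and
        \<open>q\<close> from Cramer's rule, where a factor \<open>\<zeta> - \<mu>\<close> survives
        because \<open>m < Suc k\<close>.\<close>
      define p where "p = (\<lambda>\<zeta>. \<Sum>i<Suc k. \<xi> (s i) * (\<zeta> - \<mu>) ^ (k - i))"
      define q where "q = (\<lambda>\<zeta>. - ((\<zeta> - \<mu>) ^ (Suc k - m)) * ((\<zeta> - \<mu>) ^ m * \<xi> (Y \<zeta> 0 (s 0)) -
          (U 1 (Y \<zeta> 0 (s 0)) * \<xi> (W 1 \<zeta>) + U 2 (Y \<zeta> 0 (s 0)) * \<xi> (W 2 \<zeta>)) / d \<zeta>))"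
      have "q holomorphic_on ball \<mu> r"
        unfolding q_def using m(5)
        by (intro holomorphic_intros functional_Y_holomorphic functional_W_holomorphic \<xi> c U_functional m(3)) auto
      then have "(q \<longlongrightarrow> q \<mu>) (at \<mu>)"
        using m(2) by (metis centre_in_ball continuous_on_eq_continuous_at isCont_def open_ball holomorphic_on_imp_continuous_on)
      moreover have "q \<mu> = 0" using k by (simp add: q_def)
      moreover have "q \<zeta> = p \<zeta>" if z: "\<zeta> \<in> ball \<mu> r" "\<zeta> \<noteq> \<mu>" for \<zeta>
      proof -
        have D: "Del \<zeta> \<noteq> 0" using m(4,5)[OF z(1)] z(2) by simp
        have "p \<zeta> = (\<zeta> - \<mu>) ^ Suc k * (\<Sum>i<Suc k. \<xi> (s i) / (\<zeta> - \<mu>) ^ Suc i)"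
          unfolding p_def sum_distrib_left
        proof (rule sum.cong)
          fix i assume "i \<in> {..<Suc k}"
          then have "(\<zeta> - \<mu>) ^ Suc k = (\<zeta> - \<mu>) ^ (k - i) * (\<zeta> - \<mu>) ^ Suc i" by (simp flip: power_add)
          then show "\<xi> (s i) * (\<zeta> - \<mu>) ^ (k - i) = (\<zeta> - \<mu>) ^ Suc k * (\<xi> (s i) / (\<zeta> - \<mu>) ^ Suc i)"
            using z(2) by simp
        qed simp
        also have "\<dots> = - ((\<zeta> - \<mu>) ^ Suc k) * \<xi> (R \<zeta> (s 0))"
          unfolding functional_R_root[OF \<xi> D z(2) s(1) s(2,3)] by (simp only: minus_mult_minus)
        also have "(\<zeta> - \<mu>) ^ Suc k = (\<zeta> - \<mu>) ^ (Suc k - m) * (\<zeta> - \<mu>) ^ m"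
          using k by (simp flip: power_add)
        also have "- ((\<zeta> - \<mu>) ^ (Suc k - m) * (\<zeta> - \<mu>) ^ m) * \<xi> (R \<zeta> (s 0)) = q \<zeta>"
          using z(2) m(5)[OF z(1)] unfolding functional_R[OF \<xi> c] m(4)[OF z(1)] q_def by (simp add: field_simps)
        finally show ?thesis ..
      qed
      then have "\<forall>\<^sub>F \<zeta> in at \<mu>. q \<zeta> = p \<zeta>"
        unfolding eventually_at using m(2) by (intro exI[of _ r]) (auto simp: dist_commute)
      ultimately have "(p \<longlongrightarrow> 0) (at \<mu>)" using Lim_transform_eventually by fastforce
      moreover have "(p \<longlongrightarrow> p \<mu>) (at \<mu>)" unfolding p_def by (intro tendsto_intros)
      ultimately have "p \<mu> = 0" by (rule tendsto_unique[OF at_neq_bot, rotated])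
      moreover have "p \<mu> = (\<Sum>i<Suc k. if i = k then \<xi> (s k) else 0)"
        unfolding p_def by (intro sum.cong) (auto simp: power_0_left)
      ultimately show ?thesis by (simp add: \<xi>_def)
    qed
    then show ?thesis by (simp add: vec_eq_iff)
  qed
  have reduce: "chain \<mu> (Suc k) y \<Longrightarrow> m \<le> k \<Longrightarrow> chain \<mu> k y" for k y
  proof -
    assume y: "chain \<mu> (Suc k) y" and k: "m \<le> k"
    obtain s where s: "s 0 = y" "\<forall>i\<ge>Suc k. s i = (\<lambda>_. 0)" "\<And>i. sol \<mu> (s (Suc i)) (s i)" "\<And>i j. U j (s i) = 0"
      "\<And>i. continuous_on {0..1} (s i)"
      by (fact chain_sequence[OF y])
    have "chain \<mu> k (s 0)" using top[OF s(2-4) k] s(3,4) k m(1) by (intro sequence_chain) auto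
    then show "chain \<mu> k y" by (simp add: s(1))
  qed
  have extend: "chain \<mu> k y \<Longrightarrow> chain \<mu> (Suc k) y" for k y
  proof (induction k arbitrary: y)
    case 0
    then show ?case by (auto simp: sol_zero U_def)
  next
    case (Suc k)
    then obtain z where "chain \<mu> k z" "sol \<mu> z y" "\<forall>j. U j y = 0" by auto
    with Suc.IH have "\<exists>z. chain \<mu> (Suc k) z \<and> sol \<mu> z y \<and> (\<forall>j. U j y = 0)" by blast
    then show ?case by (simp only: chain.simps)
  qed
  have "chain \<mu> m y" if "chain \<mu> k y" for k y
  proof (cases "m \<le> k")
    case True
    then show ?thesis using that by (induction k rule: dec_induct) (use reduce in auto)
  next
    case False
    then have "k \<le> m" by simp
    then show ?thesis using that by (induction rule: dec_induct) (use extend in auto)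
  qed
  then show ?thesis using that by blast
qed

lemma root_subspace_finite_dim:
  assumes "Del \<mu> = 0"
  obtains F where "finite F" "root_subspace T \<mu> \<subseteq> L2.span F"
proof -
  obtain m where m: "\<And>k y. chain \<mu> k y \<Longrightarrow> chain \<mu> m y" by (fact chain_length_bound[OF assms])
  let ?F = "abs_L2_C2 ` solution_basis \<mu> m"
  have "u \<in> L2.span ?F" if u: "u \<in> op_kernel (shift_op T \<mu> ^^ k)" for u k
  proof -
    obtain y where y: "chain \<mu> m y" "u = abs_L2_C2 y" using u m unfolding op_kernel_shift_power_iff by blast
    obtain f where f: "f \<in> function_span (solution_basis \<mu> m)" "\<And>x. x \<in> {0..1} \<Longrightarrow> y x = f x"
      using chain_in_function_span[OF y(1)] by blast
    have "abs_L2_C2 y = abs_L2_C2 f"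
      by (intro abs_L2_C2_cong continuous_square_integrable chain_continuous[OF y(1)]
          function_span_continuous[OF f(1) solution_basis_continuous] f(2))
    then show ?thesis using function_span_abs[OF f(1) solution_basis_continuous] y(2) by simp
  qed
  then have "root_subspace T \<mu> \<subseteq> L2.span ?F"
    unfolding root_subspace_def by (intro L2.span_minimal) auto
  then show ?thesis using that finite_solution_basis by blast
qed

section \<open>Riesz projections\<close>

text \<open>Up to the factor \<open>- 2 * pi * \<i>\<close>, the functional of the Riesz projection at \<open>\<mu>\<close>, composed
  with \<open>\<xi>\<close>.\<close>
definition riesz :: "((real \<Rightarrow> complex^2) \<Rightarrow> complex) \<Rightarrow> complex \<Rightarrow> real \<Rightarrow> (real \<Rightarrow> complex^2) \<Rightarrow> complex" where
  "riesz \<xi> \<mu> r g = contour_integral (circlepath \<mu> r) (\<lambda>\<zeta>. \<xi> (R \<zeta> g))"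

lemma functional_R_holomorphic:
  assumes "cont_clinear_functional \<xi>" "continuous_on {0..1} g" "\<forall>\<zeta>\<in>S. Del \<zeta> \<noteq> 0"
  shows "(\<lambda>\<zeta>. \<xi> (R \<zeta> g)) holomorphic_on S"
  unfolding functional_R[OF assms(1,2)]
  by (intro holomorphic_intros functional_Y_holomorphic functional_W_holomorphic U_functional Del_holomorphic assms(1,2))
    (use assms(3) in blast)

lemma functional_R_contour_integrable:
  assumes "cont_clinear_functional \<xi>" "continuous_on {0..1} g" "\<forall>\<zeta>\<in>sphere \<mu> r. Del \<zeta> \<noteq> 0" "0 < r"
  shows "(\<lambda>\<zeta>. \<xi> (R \<zeta> g)) contour_integrable_on circlepath \<mu> r"
  using assms(4) by (intro contour_integrable_continuous_circlepath holomorphic_on_imp_continuous_on functional_R_holomorphic assms(1,2))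
    (use assms(3) in auto)

lemma riesz_smult_add:
  assumes \<xi>: "cont_clinear_functional \<xi>" and g: "continuous_on {0..1} g" and h: "continuous_on {0..1} h"
    and r: "\<forall>\<zeta>\<in>sphere \<mu> r. Del \<zeta> \<noteq> 0" "0 < r"
  shows "riesz \<xi> \<mu> r (\<lambda>x. g x + c *s h x) = riesz \<xi> \<mu> r g + c * riesz \<xi> \<mu> r h"
  unfolding riesz_def functional_R_smult_add[OF \<xi> g h]
  using functional_R_contour_integrable[OF \<xi> g r] functional_R_contour_integrable[OF \<xi> h r]
  by (simp add: contour_integral_add contour_integral_lmul contour_integrable_lmul)

lemma riesz_bound:
  assumes \<xi>: "cont_clinear_functional \<xi>" and r: "\<forall>\<zeta>\<in>sphere \<mu> r. Del \<zeta> \<noteq> 0" "0 < r"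
  obtains K where "0 \<le> K" "\<And>g. continuous_on {0..1} g \<Longrightarrow> cmod (riesz \<xi> \<mu> r g) \<le> K * norm (abs_L2_C2 g)"
proof -
  obtain K where K: "0 \<le> K" "\<And>\<zeta> g. \<lbrakk>continuous_on {0..1} g; Del \<zeta> \<noteq> 0\<rbrakk> \<Longrightarrow>
     cmod (\<xi> (R \<zeta> g)) \<le> K * (E \<zeta>)^3 * (1 + 1 / cmod (Del \<zeta>)) * norm (abs_L2_C2 g)"
    by (fact functional_R_bound[OF \<xi>])
  have contE: "continuous_on S E" for S unfolding E_def \<kappa>_def by (intro continuous_intros)
  have "continuous_on (sphere \<mu> r) (\<lambda>\<zeta>. K * (E \<zeta>)^3 * (1 + 1 / cmod (Del \<zeta>)))"
    using r(1) by (intro continuous_intros contE holomorphic_on_imp_continuous_on Del_holomorphic) auto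
  then have "bounded ((\<lambda>\<zeta>. K * (E \<zeta>)^3 * (1 + 1 / cmod (Del \<zeta>))) ` sphere \<mu> r)"
    by (intro compact_imp_bounded compact_continuous_image compact_sphere)
  then obtain B where B: "\<And>\<zeta>. \<zeta> \<in> sphere \<mu> r \<Longrightarrow> norm (K * (E \<zeta>)^3 * (1 + 1 / cmod (Del \<zeta>))) \<le> B"
    unfolding bounded_iff by blast
  have "cmod (riesz \<xi> \<mu> r g) \<le> (\<bar>B\<bar> * (2 * pi * r)) * norm (abs_L2_C2 g)" if g: "continuous_on {0..1} g" for g
  proof -
    have "cmod (riesz \<xi> \<mu> r g) \<le> (\<bar>B\<bar> * norm (abs_L2_C2 g)) * (2 * pi * r)"
      unfolding riesz_def
    proof (rule has_contour_integral_bound_circlepath[OF has_contour_integral_integral])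
      fix \<zeta> assume "cmod (\<zeta> - \<mu>) = r"
      then have z: "\<zeta> \<in> sphere \<mu> r" by (simp add: dist_norm norm_minus_commute)
      have "cmod (\<xi> (R \<zeta> g)) \<le> K * (E \<zeta>)^3 * (1 + 1 / cmod (Del \<zeta>)) * norm (abs_L2_C2 g)" by (rule K(2)[OF g r(1)[rule_format, OF z]])
      also have "\<dots> \<le> \<bar>B\<bar> * norm (abs_L2_C2 g)"
        using B[OF z] by (intro mult_right_mono) (auto simp del: norm_mult)
      finally show "cmod (\<xi> (R \<zeta> g)) \<le> \<bar>B\<bar> * norm (abs_L2_C2 g)" .
    qed (use functional_R_contour_integrable[OF \<xi> g r] r(2) in simp_all)
    then show ?thesis by (simp add: mult_ac)
  qed
  then show ?thesis using r(2) by (intro that[of "\<bar>B\<bar> * (2 * pi * r)"]) auto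
qed

text \<open>Of the finite Laurent sum at \<mu> only the simple pole contributes, with residue
  \<open>- \<xi> y\<close>. If \<open>\<nu> \<noteq> \<mu>\<close>, then
  \<open>Del \<nu> = 0\<close> places \<nu> outside the ball, where Cauchy's theorem
  applies.\<close>

lemma riesz_root:
  assumes \<xi>: "cont_clinear_functional \<xi>" and r: "0 < r" "r < r'" "\<forall>\<zeta>\<in>ball \<mu> r' - {\<mu>}. Del \<zeta> \<noteq> 0"
    and y: "chain \<nu> k y" and \<nu>: "Del \<nu> = 0"
  shows "riesz \<xi> \<mu> r y = (if \<nu> = \<mu> then - (2 * of_real pi * \<i>) * \<xi> y else 0)"
proof -
  obtain s where s: "s 0 = y" "\<forall>i\<ge>k. s i = (\<lambda>_. 0)" "\<And>i. sol \<nu> (s (Suc i)) (s i)" "\<And>i j. U j (s i) = 0"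
    "\<And>i. continuous_on {0..1} (s i)"
    by (fact chain_sequence[OF y])
  have \<xi>0: "\<xi> (\<lambda>_. 0) = 0" using cont_clinear_functional_smult[OF \<xi> continuous_on_const, of 0 0] by simp
  have sph: "Del \<zeta> \<noteq> 0" if "\<zeta> \<in> path_image (circlepath \<mu> r)" for \<zeta>
    using that r by (intro r(3)[rule_format]) auto
  have "riesz \<xi> \<mu> r y = contour_integral (circlepath \<mu> r) (\<lambda>\<zeta>. - (\<Sum>i<k. \<xi> (s i) / (\<zeta> - \<nu>) ^ Suc i))"
    unfolding riesz_def
  proof (rule contour_integral_eq)
    fix \<zeta> assume "\<zeta> \<in> path_image (circlepath \<mu> r)"
    then have D: "Del \<zeta> \<noteq> 0" by (rule sph)
    then have "\<zeta> \<noteq> \<nu>" using \<nu> by auto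
    from functional_R_root[OF \<xi> D this s(2-4)] show "\<xi> (R \<zeta> y) = - (\<Sum>i<k. \<xi> (s i) / (\<zeta> - \<nu>) ^ Suc i)" by (simp add: s(1))
  qed
  also have "\<dots> = (if \<nu> = \<mu> then - (2 * of_real pi * \<i>) * \<xi> y else 0)"
  proof (cases "\<nu> = \<mu>")
    case True
    have "((\<lambda>\<zeta>. \<xi> (s i) / (\<zeta> - \<mu>) ^ Suc i) has_contour_integral (if i = 0 then 2 * of_real pi * \<i> * \<xi> (s 0) else 0)) (circlepath \<mu> r)" for i
    proof -
      have "((\<lambda>\<zeta>. \<xi> (s i) / (\<zeta> - \<mu>) ^ Suc i) has_contour_integral 2 * of_real pi * \<i> / fact i * (deriv ^^ i) (\<lambda>_. \<xi> (s i)) \<mu>) (circlepath \<mu> r)"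
        using Cauchy_has_contour_integral_higher_derivative_circlepath[of \<mu> r "\<lambda>_. \<xi> (s i)" \<mu> i] r(1)
        by (simp add: holomorphic_on_const)
      then show ?thesis by (cases "i = 0") (auto simp: higher_deriv_const)
    qed
    then have "((\<lambda>\<zeta>. - (\<Sum>i<k. \<xi> (s i) / (\<zeta> - \<mu>) ^ Suc i)) has_contour_integral - (\<Sum>i<k. if i = 0 then 2 * of_real pi * \<i> * \<xi> (s 0) else 0)) (circlepath \<mu> r)"
      by (intro has_contour_integral_neg has_contour_integral_sum) auto
    \<comment> \<open>For \<open>k = 0\<close> the sum is empty and \<open>y\<close>, being
      \<open>s 0\<close>, is the zero function.\<close>
    moreover have "(\<Sum>i<k. if i = 0 then 2 * of_real pi * \<i> * \<xi> (s 0) else 0) = 2 * of_real pi * \<i> * \<xi> y"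
      using s(1,2) \<xi>0 by (cases k) (auto simp: lessThan_Suc_eq_insert_0 sum.delta)
    ultimately show ?thesis using True by (simp add: contour_integral_unique)
  next
    case False
    have "((\<lambda>\<zeta>. - (\<Sum>i<k. \<xi> (s i) / (\<zeta> - \<nu>) ^ Suc i)) has_contour_integral 0) (circlepath \<mu> r)"
    proof (rule Cauchy_theorem_convex_simple)
      have "\<zeta> \<noteq> \<nu>" if "\<zeta> \<in> ball \<mu> r'" for \<zeta> using r(3) False \<nu> that by auto
      then show "(\<lambda>\<zeta>. - (\<Sum>i<k. \<xi> (s i) / (\<zeta> - \<nu>) ^ Suc i)) holomorphic_on ball \<mu> r'"
        by (intro holomorphic_intros) auto
      show "path_image (circlepath \<mu> r) \<subseteq> ball \<mu> r'" using r by auto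
    qed auto
    then show ?thesis using False by (simp add: contour_integral_unique)
  qed
  finally show ?thesis .
qed

text \<open>\<open>riesz\<close> is defined on functions while root subspaces consist of classes, so
  the value is asserted for a suitable continuous representative, built along with the linear
  combination.\<close>

lemma riesz_root_subspace:
  assumes \<psi>: "bounded_clinear_functional \<psi>" and r: "0 < r" "r < r'" "\<forall>\<zeta>\<in>ball \<mu> r' - {\<mu>}. Del \<zeta> \<noteq> 0"
    and u: "u \<in> root_subspace T \<nu>" and \<nu>: "Del \<nu> = 0"
  shows "\<exists>g. continuous_on {0..1} g \<and> u = abs_L2_C2 g \<and>
     riesz (\<lambda>f. \<psi> (abs_L2_C2 f)) \<mu> r g = (if \<nu> = \<mu> then - (2 * of_real pi * \<i>) * \<psi> u else 0)"
proof -
  let ?\<xi> = "\<lambda>f. \<psi> (abs_L2_C2 f)"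
  have \<xi>: "cont_clinear_functional ?\<xi>" by (rule bounded_clinear_functional_abs[OF \<psi>])
  have sph: "\<forall>\<zeta>\<in>sphere \<mu> r. Del \<zeta> \<noteq> 0" using r by auto
  have ch0: "chain \<nu> 0 (\<lambda>_. 0)" by simp
  show ?thesis
    using u unfolding root_subspace_def
  proof (induction rule: L2.span_induct_alt)
    case base
    show ?case
      using riesz_root[OF \<xi> r ch0 \<nu>] by (intro exI[of _ "\<lambda>_. 0"]) (auto simp: abs_L2_C2_zero)
  next
    case (step c v w)
    obtain k y where y: "chain \<nu> k y" "v = abs_L2_C2 y" using step(1) op_kernel_shift_power_iff by blast
    obtain g where g: "continuous_on {0..1} g" "w = abs_L2_C2 g" "riesz ?\<xi> \<mu> r g = (if \<nu> = \<mu> then - (2 * of_real pi * \<i>) * \<psi> w else 0)"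
      using step(2) by blast
    have cy: "continuous_on {0..1} y" by (rule chain_continuous[OF y(1)])
    have eq: "scaleC_L2 c v + w = abs_L2_C2 (\<lambda>x. g x + c *s y x)"
      using g cy by (simp add: y(2) abs_L2_C2_add abs_L2_C2_scaleC continuous_square_integrable square_integrable_scaleC add.commute)
    have "\<psi> (scaleC_L2 c v + w) = c * \<psi> v + \<psi> w" using \<psi> by (simp add: bounded_clinear_functional_def)
    then have "riesz ?\<xi> \<mu> r (\<lambda>x. g x + c *s y x) = (if \<nu> = \<mu> then - (2 * of_real pi * \<i>) * \<psi> (scaleC_L2 c v + w) else 0)"
      using riesz_smult_add[OF \<xi> g(1) cy sph r(1)] g(3) riesz_root[OF \<xi> r y(1) \<nu>] y(2) by (simp add: algebra_simps)
    then show ?case using eq cy g(1) by (intro exI[of _ "\<lambda>x. g x + c *s y x"]) (auto intro!: continuous_intros)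
  qed
qed

text \<open>\<open>\<psi>\<close> vanishes on the other basis elements at \<mu> but not at
  \<open>u\<close>. Composed with the Riesz projection it also vanishes on the root subspaces of all
  other eigenvalues and remains bounded, which separates \<open>u\<close> from the closed span of
  the rest.\<close>

theorem minimal_root_function_system:
  assumes S: "root_function_system T S"
  shows "minimal_system S"
  unfolding minimal_system_def
proof
  fix u assume "u \<in> S"
  obtain X where X: "\<And>\<nu>. eigenvalue T \<nu> \<Longrightarrow> is_basis (root_subspace T \<nu>) (X \<nu>)" "S = (\<Union>\<nu>\<in>{\<nu>. eigenvalue T \<nu>}. X \<nu>)"
    using S unfolding root_function_system_def by blast
  obtain \<mu> where \<mu>: "eigenvalue T \<mu>" "u \<in> X \<mu>" using \<open>u \<in> S\<close> X(2) by blast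
  have D: "Del \<mu> = 0" by (rule Del_zero_if_eigenvalue[OF \<mu>(1)])
  have ind: "L2.independent (X \<mu>)" and span: "L2.span (X \<mu>) = root_subspace T \<mu>"
    using X(1)[OF \<mu>(1)] by (auto simp: is_basis_def)
  obtain F where F: "finite F" "root_subspace T \<mu> \<subseteq> L2.span F" using root_subspace_finite_dim[OF D] by blast
  have "finite (X \<mu>)"
    using L2.independent_span_bound[OF F(1) ind] F(2) L2.span_superset[of "X \<mu>"] unfolding span by blast
  then have "closed (L2.span (X \<mu> - {u}))" by (intro closed_L2_span_finite) simp
  moreover have "u \<notin> L2.span (X \<mu> - {u})" using ind \<mu>(2) by (auto simp: L2.dependent_def)
  \<comment> \<open>Independence separates \<open>u\<close> from the other basis elements
    algebraically; finite dimension turns this into a positive distance.\<close>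
  ultimately have sep: "u \<notin> closure (L2.span (X \<mu> - {u}))" by simp
  obtain \<psi> where \<psi>: "bounded_clinear_functional \<psi>" "\<And>v. v \<in> L2.span (X \<mu> - {u}) \<Longrightarrow> \<psi> v = 0" "\<psi> u \<noteq> 0"
    by (fact separating_functional_L2_C2[OF L2.subspace_span sep])
  let ?\<xi> = "\<lambda>f. \<psi> (abs_L2_C2 f)"
  have \<xi>: "cont_clinear_functional ?\<xi>" by (rule bounded_clinear_functional_abs[OF \<psi>(1)])
  obtain d r' m where "0 < m" and m: "0 < r'" "d holomorphic_on ball \<mu> r'"
      "\<And>\<zeta>. \<zeta> \<in> ball \<mu> r' \<Longrightarrow> Del \<zeta> = (\<zeta> - \<mu>) ^ m * d \<zeta>" "\<And>\<zeta>. \<zeta> \<in> ball \<mu> r' \<Longrightarrow> d \<zeta> \<noteq> 0"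
    by (fact Del_factor[OF D])
  define r where "r = r' / 2"
  have r: "0 < r" "r < r'" "\<forall>\<zeta>\<in>ball \<mu> r' - {\<mu>}. Del \<zeta> \<noteq> 0"
    using m by (auto simp: r_def)
  have sph: "\<forall>\<zeta>\<in>sphere \<mu> r. Del \<zeta> \<noteq> 0" using r by auto
  obtain K where K: "0 \<le> K" "\<And>g. continuous_on {0..1} g \<Longrightarrow> cmod (riesz ?\<xi> \<mu> r g) \<le> K * norm (abs_L2_C2 g)"
    by (fact riesz_bound[OF \<xi> sph r(1)])
  have others: "\<exists>g. continuous_on {0..1} g \<and> v = abs_L2_C2 g \<and> riesz ?\<xi> \<mu> r g = 0" if "v \<in> L2.span (S - {u})" for v
    using that
  proof (induction rule: L2.span_induct_alt)
    case base
    have "chain \<mu> 0 (\<lambda>_. 0)" by simp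
    from riesz_root[OF \<xi> r this D] show ?case
      using \<psi>(2)[OF L2.span_zero] by (intro exI[of _ "\<lambda>_. 0"]) (auto simp: abs_L2_C2_zero)
  next
    case (step c v w)
    obtain \<nu> where \<nu>: "eigenvalue T \<nu>" "v \<in> X \<nu>" using step(1) X(2) by blast
    have "v \<in> root_subspace T \<nu>" using X(1)[OF \<nu>(1)] \<nu>(2) L2.span_base unfolding is_basis_def by metis
    from riesz_root_subspace[OF \<psi>(1) r this Del_zero_if_eigenvalue[OF \<nu>(1)]]
    obtain h where h: "continuous_on {0..1} h" "v = abs_L2_C2 h" "riesz ?\<xi> \<mu> r h = (if \<nu> = \<mu> then - (2 * of_real pi * \<i>) * \<psi> v else 0)"
      by blast
    have "riesz ?\<xi> \<mu> r h = 0"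
    proof (cases "\<nu> = \<mu>")
      case True
      then have "\<psi> v = 0" using step(1) \<nu>(2) by (intro \<psi>(2) L2.span_base) auto
      then show ?thesis by (simp add: h(3))
    qed (simp add: h(3))
    obtain g where g: "continuous_on {0..1} g" "w = abs_L2_C2 g" "riesz ?\<xi> \<mu> r g = 0" using step(2) by blast
    have "scaleC_L2 c v + w = abs_L2_C2 (\<lambda>x. g x + c *s h x)"
      using g h by (simp add: abs_L2_C2_add abs_L2_C2_scaleC continuous_square_integrable square_integrable_scaleC add.commute)
    moreover have "riesz ?\<xi> \<mu> r (\<lambda>x. g x + c *s h x) = 0"
      using riesz_smult_add[OF \<xi> g(1) h(1) sph r(1)] g(3) \<open>riesz ?\<xi> \<mu> r h = 0\<close> by simp
    ultimately show ?case using g(1) h(1) by (intro exI[of _ "\<lambda>x. g x + c *s h x"]) (auto intro!: continuous_intros)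
  qed
  have "u \<in> root_subspace T \<mu>" using \<mu>(2) L2.span_base span by metis
  from riesz_root_subspace[OF \<psi>(1) r this D]
  obtain f where f: "continuous_on {0..1} f" "u = abs_L2_C2 f" "riesz ?\<xi> \<mu> r f = - (2 * of_real pi * \<i>) * \<psi> u" by auto
  define \<delta> where "\<delta> = cmod (riesz ?\<xi> \<mu> r f)"
  have \<delta>: "0 < \<delta>" using \<psi>(3) by (simp add: \<delta>_def f(3) norm_mult)
  show "u \<notin> closure (L2.span (S - {u}))"
  proof
    assume "u \<in> closure (L2.span (S - {u}))"
    \<comment> \<open>Vectors closer to \<open>u\<close> than this have a nonzero value under the
      projected functional; \<open>K + 1\<close> also covers \<open>K = 0\<close>.\<close>
    moreover have "0 < \<delta> / (K + 1)" using \<delta> K(1) by simp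
    ultimately obtain v where v: "v \<in> L2.span (S - {u})" "dist v u < \<delta> / (K + 1)"
      unfolding closure_approachable by blast
    obtain g where g: "continuous_on {0..1} g" "v = abs_L2_C2 g" "riesz ?\<xi> \<mu> r g = 0" using others[OF v(1)] by blast
    have "\<delta> = cmod (riesz ?\<xi> \<mu> r (\<lambda>x. f x + (- 1) *s g x))"
      unfolding \<delta>_def riesz_smult_add[OF \<xi> f(1) g(1) sph r(1)] g(3) by simp
    also have "\<dots> \<le> K * norm (abs_L2_C2 (\<lambda>x. f x + (- 1) *s g x))"
      by (intro K(2) continuous_intros f g)
    also have "abs_L2_C2 (\<lambda>x. f x + (- 1) *s g x) = u - v"
      using abs_L2_C2_diff[of f g] f(1) g(1) by (simp add: f(2) g(2) continuous_square_integrable flip: vector_sneg_minus1)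
    also have "K * norm (u - v) \<le> K * (\<delta> / (K + 1))"
      using v(2) K(1) by (intro mult_left_mono) (auto simp: dist_norm norm_minus_commute)
    also have "\<dots> < \<delta>" using K(1) \<delta> by (simp add: field_simps)
    finally show False by simp
  qed
qed

end

theorem theorem5p1:
  fixes a :: "complex^4^2"
    and b\<^sub>1 b\<^sub>2 :: real
    and Q\<^sub>1\<^sub>2 Q\<^sub>2\<^sub>1 :: "real \<Rightarrow> complex"
    and S :: "L2_C2 set"
  assumes "rank a = 2"
    and "b\<^sub>1 < 0" and "0 < b\<^sub>2"
    and "continuous_on {0..1} Q\<^sub>1\<^sub>2" and "continuous_on {0..1} Q\<^sub>2\<^sub>1"
    and "cmod (J a 3 2) + cmod (b\<^sub>1 * J a 1 3 * Q\<^sub>1\<^sub>2 0 + b\<^sub>2 * J a 4 2 * Q\<^sub>2\<^sub>1 1) \<noteq> 0"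
    and "cmod (J a 1 4) + cmod (b\<^sub>1 * J a 1 3 * Q\<^sub>1\<^sub>2 1 + b\<^sub>2 * J a 4 2 * Q\<^sub>2\<^sub>1 0) \<noteq> 0"
    and "root_function_system (L_op (matB b\<^sub>1 b\<^sub>2) (matQ Q\<^sub>1\<^sub>2 Q\<^sub>2\<^sub>1) (matC a) (matD a)) S"
  shows "complete_system S \<and> minimal_system S"
proof -
  interpret dirac_nondegenerate b\<^sub>1 b\<^sub>2 Q\<^sub>1\<^sub>2 Q\<^sub>2\<^sub>1 a
    using assms by unfold_locales auto
  show ?thesis
    using complete_root_function_system[OF assms(8)] minimal_root_function_system[OF assms(8)] by blast
qed

end
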